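(* Consider the linear time-invariant system $\dot x=Ax+Gw$, $y=Cx+Hv$ with $A\in\mathbb{R}^{n\times n}$, $G\in\mathbb{R}^{n\times n}$, $C\in\mathbb{R}^{p\times n}$, $H$ such that $HH^{\top}>0$, and $(A,G,C)$ controllable and observable. Let $r\in\{1,\dots,n-1\}$ with $\mathrm{Re}(\lambda_r(A))>\mathrm{Re}(\lambda_{r+1}(A))$, and suppose $A$ has $r'$ unstable eigenvalues (counted with multiplicity). Fix $\bar U\in\mathcal{U}$ and run the low-rank approximated Kalman--Bucy filter with $U(t)\equiv\bar U$: $\tilde R(t)\in\mathbb{R}^{r\times r}$ solves \[\dot{\tilde R}=A_{\bar U}\tilde R+\tilde R A_{\bar U}^{\top}+G_{\bar U}G_{\bar U}^{\top}-\tilde R C_{\bar U}^{\top}(HH^{\top})^{-1}C_{\bar U}\tilde R,\quad \tilde R(0)>0,\] where $A_{\bar U}=\bar U^{\top}A\bar U$, $C_{\bar U}=C\bar U$, $G_{\bar U}=\bar U^{\top}G$; $\tilde P(t)=\bar U\tilde R(t)\bar U^{\top}$; and the error covariance $\tilde V(t)$ solves \[\dot{\tilde V}=(A-\tilde P C^{\top}(HH^{\top})^{-1}C)\tilde V+\tilde V(A-\tilde P C^{\top}(HH^{\top})^{-1}C)^{\top}+GG^{\top}+\tilde P C^{\top}(HH^{\top})^{-1}C\tilde P.\] Let $\tilde P_r:=\bar U\tilde R_{\bar U}\bar U^{\top}$, where $\tilde R_{\bar U}$ is the unique positive definite solution of the corresponding reduced algebraic Riccati equation $A_{\bar U}R+RA_{\bar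 U}^{\top}+G_{\bar U}G_{\bar U}^{\top}-RC_{\bar U}^{\top}(HH^{\top})^{-1}C_{\bar U}R=0$. Then $A-\tilde P_rC^{\top}(HH^{\top})^{-1}C$ is stable if and only if $r\ge r'$. Furthermore, if $A-\tilde P_rC^{\top}(HH^{\top})^{-1}C$ is stable, then the error covariance matrix $\tilde V(t)$ is bounded and converges to a steady-state solution.
   Context: Eigenvalues of $A$ are ordered as $\mathrm{Re}(\lambda_1(A))\ge\dots\ge\mathrm{Re}(\lambda_n(A))$. An eigenvalue is unstable if its real part is nonnegative; a matrix is stable if all its eigenvalues have negative real part. $\mathrm{St}(r,n):=\{X\in\mathbb{R}^{n\times r}\mid X^{\top}X=I_r\}$. $\Psi=[\psi_1,\dots,\psi_n]$ is an invertible matrix of unit-norm (generalized) eigenvectors of $A$ for $\lambda_1(A),\dots,\lambda_n(A)$ with $\Psi^{-1}A\Psi$ the Jordan form. $\mathcal{U}:=\{U\in\mathrm{St}(r,n)\mid \Psi^{-1}U=\begin{bsmallmatrix}K\\ O_{n-r,r}\end{bsmallmatrix}\text{ for some }K\in\mathbb{C}^{r\times r}\}$; these are equilibria of the Oja flow $\dot U=(I_n-UU^{\top})AU$, so $U(0)=\bar U$ gives $U(t)\equiv\bar U$. The initial condition $\tilde V(0)$ is a positive semidefinite matrix.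
   Formalization: The existence of the unique positive definite solution of the reduced Riccati equation is assumed: controllability of (A,G) does not ensure it (A=[[-1,1],[0,-2]], G=diag(0,1), C=[1 0], H=1, r=1 has none). A unit-norm Jordan basis Ψ is likewise taken as given. *)

theory Defs
  imports "HOL-Analysis.Analysis" "Jordan_Normal_Form.Jordan_Normal_Form"
    "Jordan_Normal_Form.Gauss_Jordan_Elimination" "Jordan_Normal_Form.DL_Rank"
    "HOL-Library.Multiset"
begin

abbreviation cmat :: "real mat \<Rightarrow> complex mat" where
  "cmat M \<equiv> map_mat complex_of_real M"

definition eig_mset :: "real mat \<Rightarrow> complex multiset" where
  "eig_mset A = proots (char_poly (cmat A))"

text \<open>Real parts of the eigenvalues, in non-increasing order:
  entry k (0-based) is Re(lambda_(k+1)(A)).\<close>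
definition re_eigs_desc :: "real mat \<Rightarrow> real list" where
  "re_eigs_desc A = rev (sorted_list_of_multiset (image_mset Re (eig_mset A)))"

definition num_unstable :: "real mat \<Rightarrow> nat" where
  "num_unstable A = size (filter_mset (\<lambda>z. Re z \<ge> 0) (eig_mset A))"

definition mat_stable :: "real mat \<Rightarrow> bool" where
  "mat_stable A \<longleftrightarrow> (\<forall>z. eigenvalue (cmat A) z \<longrightarrow> Re z < 0)"

definition pos_def :: "nat \<Rightarrow> real mat \<Rightarrow> bool" where
  "pos_def n M \<longleftrightarrow> M \<in> carrier_mat n n \<and> transpose_mat M = M \<and>
     (\<forall>x \<in> carrier_vec n. x \<noteq> 0\<^sub>v n \<longrightarrow> x \<bullet> (M *\<^sub>v x) > 0)"

definition pos_semidef :: "nat \<Rightarrow> real mat \<Rightarrow> bool" where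
  "pos_semidef n M \<longleftrightarrow> M \<in> carrier_mat n n \<and> transpose_mat M = M \<and>
     (\<forall>x \<in> carrier_vec n. x \<bullet> (M *\<^sub>v x) \<ge> 0)"

text \<open>Kalman controllability matrix [B, AB, ..., A^(n-1) B] for A n x n, B n x m.\<close>
definition ctrb_mat :: "real mat \<Rightarrow> real mat \<Rightarrow> real mat" where
  "ctrb_mat A B = (let n = dim_row A; m = dim_col B in
     mat n (n * m) (\<lambda>(i, j). ((A ^\<^sub>m (j div m)) * B) $$ (i, j mod m)))"

definition controllable :: "real mat \<Rightarrow> real mat \<Rightarrow> bool" where
  "controllable A B \<longleftrightarrow> vec_space.rank (dim_row A) (ctrb_mat A B) = dim_row A"

definition observable :: "real mat \<Rightarrow> real mat \<Rightarrow> bool" where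
  "observable A C \<longleftrightarrow> controllable (transpose_mat A) (transpose_mat C)"

definition stiefel :: "nat \<Rightarrow> nat \<Rightarrow> real mat set" where
  "stiefel r n = {X \<in> carrier_mat n r. transpose_mat X * X = 1\<^sub>m r}"

definition jordan_basis :: "real mat \<Rightarrow> complex mat \<Rightarrow> complex mat \<Rightarrow> bool" where
  "jordan_basis A Psi Psi_inv \<longleftrightarrow>
     (let n = dim_row A in
       Psi \<in> carrier_mat n n \<and> Psi_inv \<in> carrier_mat n n \<and>
       Psi * Psi_inv = 1\<^sub>m n \<and> Psi_inv * Psi = 1\<^sub>m n \<and>
       (\<forall>j<n. (\<Sum>i<n. (cmod (Psi $$ (i, j)))\<^sup>2) = 1) \<and>
       (\<exists>n_as. Psi_inv * cmat A * Psi = jordan_matrix n_as \<and>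
               sorted_wrt (\<ge>) (map Re (diag_mat (jordan_matrix n_as)))))"

text \<open>The set U of equilibria of the Oja flow (w.r.t. a given Psi).\<close>
definition equilibria_U :: "nat \<Rightarrow> nat \<Rightarrow> complex mat \<Rightarrow> real mat set" where
  "equilibria_U r n Psi_inv = {U \<in> stiefel r n.
     \<forall>i j. r \<le> i \<longrightarrow> i < n \<longrightarrow> j < r \<longrightarrow> (Psi_inv * cmat U) $$ (i, j) = 0}"

definition has_mat_deriv_on_nonneg ::
    "(real \<Rightarrow> real mat) \<Rightarrow> (real \<Rightarrow> real mat) \<Rightarrow> nat \<Rightarrow> nat \<Rightarrow> bool" where
  "has_mat_deriv_on_nonneg X X' m k \<longleftrightarrow>
     (\<forall>t \<ge> 0. X t \<in> carrier_mat m k \<and> X' t \<in> carrier_mat m k \<and>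
        (\<forall>i<m. \<forall>j<k. ((\<lambda>s. X s $$ (i, j)) has_real_derivative (X' t $$ (i, j)))
                         (at t within {0..})))"

definition mat_bounded_nonneg :: "(real \<Rightarrow> real mat) \<Rightarrow> nat \<Rightarrow> nat \<Rightarrow> bool" where
  "mat_bounded_nonneg X m k \<longleftrightarrow> (\<exists>B. \<forall>t \<ge> 0. \<forall>i<m. \<forall>j<k. \<bar>X t $$ (i, j)\<bar> \<le> B)"

definition mat_tendsto :: "(real \<Rightarrow> real mat) \<Rightarrow> real mat \<Rightarrow> bool" where
  "mat_tendsto X L \<longleftrightarrow> (\<forall>i<dim_row L. \<forall>j<dim_col L.
      ((\<lambda>t. X t $$ (i, j)) \<longlongrightarrow> L $$ (i, j)) at_top)"

end

theory Submission
  imports Defs "Jordan_Normal_Form.Schur_Decomposition"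
begin

text \<open>
  Since \<open>U\<close> spans the invariant subspace of the first \<open>r\<close> generalised eigenvectors, \<open>A U = U A\<^sub>U\<close>, and in a
  basis extending \<open>U\<close> the closed-loop matrix is block upper triangular with diagonal blocks
  \<open>F = A\<^sub>U - R Q\<close> (with \<open>R\<close> the Riccati solution and \<open>Q = C\<^sub>U\<^sup>T (H H\<^sup>T)\<^sup>-\<^sup>1 C\<^sub>U\<close>) and the part of the Jordan form carrying
  \<open>\<lambda>\<^sub>r\<^sub>+\<^sub>1, \<dots>, \<lambda>\<^sub>n\<close>. Observability alone makes \<open>F\<close> stable, so stability is decided by the second block.

  For the convergence, no transition matrices are used. A form \<open>v \<bullet> W(t) v\<close> stays below a barrier
  \<open>\<phi>(t) (v \<bullet> P v)\<close> as soon as its derivative is smaller than that of the barrier at the vectors with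
  \<open>W(t) v = \<phi>(t) P v\<close>. There the Riccati and Lyapunov equations reduce to scalar inequalities. Exponentially
  decaying barriers give \<open>R(t) \<rightarrow> R\<close>; for the covariance, a constant barrier gives boundedness, and decaying
  barriers for \<open>V(t + h) - V(t)\<close>, uniform in \<open>h\<close>, give the Cauchy property.
\<close>

section \<open>Quadratic forms\<close>

text \<open>The coefficients vary in time, so norm estimates would lead to a propagator. At a vector
  where the solution touches a multiple of a fixed form \<open>P\<close>, the derivative of the form
  sees these coefficients only through their action on the fixed vector
  \<open>P *\<^sub>v v\<close>; this is why scalar inequalities suffice. The Riccati flow is not
  symmetric about its equilibrium: the quadratic term diminishes a deviation above it, however
  large, and enlarges one below it. The initial deficit must therefore stay strictly below the
  equilibrium itself, and this is where positive definiteness of \<open>R 0\<close> enters. The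
  equilibrium dissipates only weakly along its closed loop, since the noise and output forms may
  vanish at a vector; hence a small multiple of a strict Lyapunov matrix is added to it. The limit
  of the covariance is not known in advance, so deviations from it cannot be estimated. Comparing
  the solution with its own time shifts avoids this, and the algebraic equation for the limit is
  read off afterwards from the vanishing of the limiting derivative.\<close>

no_notation inner (infix "\<bullet>" 70)
no_notation vec_nth (infixl "$" 90)

lemma scalar_prod_mult_mat_vec:
  assumes "M \<in> carrier_mat n m" "u \<in> carrier_vec n" "v \<in> carrier_vec m"
  shows "u \<bullet> (M *\<^sub>v v) = (\<Sum>i<n. \<Sum>j<m. u $ i * M $$ (i, j) * v $ j)"
proof -
  have "u \<bullet> (M *\<^sub>v v) = (\<Sum>i<n. u $ i * (\<Sum>j<m. M $$ (i, j) * v $ j))"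
    using assms by (auto simp: scalar_prod_def atLeast0LessThan intro!: sum.cong)
  then show ?thesis by (simp add: sum_distrib_left mult.assoc)
qed

abbreviation qform :: "real mat \<Rightarrow> real vec \<Rightarrow> real" where
  "qform M v \<equiv> v \<bullet> (M *\<^sub>v v)"

lemma scalar_prod_self_sum:
  fixes v :: "real vec"
  assumes "v \<in> carrier_vec n"
  shows "v \<bullet> v = (\<Sum>i<n. (v $ i)\<^sup>2)"
  using assms by (simp add: scalar_prod_def atLeast0LessThan power2_eq_square)

lemma scalar_prod_self_nonneg: "(v::real vec) \<bullet> v \<ge> 0"
  by (simp add: scalar_prod_def sum_nonneg)

lemma scalar_prod_self_pos:
  fixes v :: "real vec"
  assumes "v \<in> carrier_vec n" "v \<noteq> 0\<^sub>v n"
  shows "v \<bullet> v > 0"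
proof (rule ccontr)
  assume "\<not> v \<bullet> v > 0"
  then have "(\<Sum>i<n. (v $ i)\<^sup>2) = 0"
    using scalar_prod_self_nonneg[of v] scalar_prod_self_sum[OF assms(1)] by simp
  then have "\<forall>i<n. v $ i = 0" by (simp add: sum_nonneg_eq_0_iff)
  then have "v = 0\<^sub>v n" using assms(1) by auto
  with assms(2) show False by simp
qed

text \<open>Unit vectors are encoded as functions, so that compactness comes from the product
  topology; vanishing from index \<open>n\<close> on makes the encoding unique and keeps the set
  inside a compact cube.\<close>

definition unit_sphere :: "nat \<Rightarrow> (nat \<Rightarrow> real) set" where
  "unit_sphere n = {x. (\<forall>i\<ge>n. x i = 0) \<and> (\<Sum>i<n. (x i)\<^sup>2) = 1}"

lemma compact_unit_sphere: "compact (unit_sphere n)"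
proof -
  \<comment> \<open>Compact by Tychonoff; the sphere is a closed subset of this cube.\<close>
  let ?K = "PiE UNIV (\<lambda>i::nat. {-1..1::real})"
  have "compactin (product_topology (\<lambda>i::nat. euclidean) UNIV) ?K"
    by (subst compactin_PiE) (simp add: compactin_euclidean_iff)
  then have K: "compact ?K"
    by (simp add: euclidean_product_topology compactin_euclidean_iff)
  have "closed {x::nat \<Rightarrow> real. (\<Sum>i<n. (x i)\<^sup>2) = 1}"
    by (intro closed_Collect_eq continuous_intros continuous_on_product_coordinates)
  moreover have "closed {x::nat \<Rightarrow> real. \<forall>i\<in>{n..}. x i = 0}"
  proof -
    have "closed (\<Inter>i\<in>{n..}. {x::nat \<Rightarrow> real. x i = 0})"
      by (intro closed_INT ballI closed_Collect_eq continuous_intros continuous_on_product_coordinates)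
    moreover have "(\<Inter>i\<in>{n..}. {x::nat \<Rightarrow> real. x i = 0}) = {x. \<forall>i\<in>{n..}. x i = 0}" by auto
    ultimately show ?thesis by simp
  qed
  ultimately have C: "closed ({x::nat \<Rightarrow> real. (\<Sum>i<n. (x i)\<^sup>2) = 1} \<inter> {x. \<forall>i\<in>{n..}. x i = 0})"
    by (rule closed_Int)
  have "unit_sphere n \<subseteq> ?K"
  proof
    fix x assume x: "x \<in> unit_sphere n"
    have "\<bar>x i\<bar> \<le> 1" for i
    proof (cases "i < n")
      case True
      then have "(x i)\<^sup>2 \<le> (\<Sum>i<n. (x i)\<^sup>2)" by (intro member_le_sum) auto
      with x show ?thesis by (simp add: unit_sphere_def abs_square_le_1)
    next
      case False with x show ?thesis by (simp add: unit_sphere_def)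
    qed
    then have "- 1 \<le> x i \<and> x i \<le> 1" for i by (simp add: abs_le_iff minus_le_iff)
    then show "x \<in> ?K" by (intro PiE_I) auto
  qed
  moreover have "unit_sphere n = ({x::nat \<Rightarrow> real. (\<Sum>i<n. (x i)\<^sup>2) = 1} \<inter> {x. \<forall>i\<in>{n..}. x i = 0})"
    by (auto simp: unit_sphere_def)
  ultimately have "unit_sphere n = ?K \<inter> ({x::nat \<Rightarrow> real. (\<Sum>i<n. (x i)\<^sup>2) = 1} \<inter> {x. \<forall>i\<in>{n..}. x i = 0})"
    by blast
  then show ?thesis using compact_Int_closed[OF K C] by simp
qed

lemma unit_sphere_vec:
  assumes "x \<in> unit_sphere n"
  shows "Matrix.vec n x \<in> carrier_vec n" "Matrix.vec n x \<noteq> 0\<^sub>v n"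
    and "Matrix.vec n x \<bullet> Matrix.vec n x = 1"
proof -
  show c: "Matrix.vec n x \<in> carrier_vec n" by simp
  show o: "Matrix.vec n x \<bullet> Matrix.vec n x = 1"
    using assms by (subst scalar_prod_self_sum[OF c]) (simp add: unit_sphere_def)
  show "Matrix.vec n x \<noteq> 0\<^sub>v n" using o by (metis scalar_prod_left_zero c zero_neq_one)
qed

lemma unit_sphere_scale:
  fixes v :: "real vec"
  assumes "v \<in> carrier_vec n" "v \<noteq> 0\<^sub>v n"
  obtains x c where "x \<in> unit_sphere n" "c > 0" "v = c \<cdot>\<^sub>v Matrix.vec n x" "c\<^sup>2 = v \<bullet> v"
proof -
  define c where "c = sqrt (v \<bullet> v)"
  have c: "c > 0" "c\<^sup>2 = v \<bullet> v" using scalar_prod_self_pos[OF assms] by (simp_all add: c_def)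
  define x where "x = (\<lambda>i. if i < n then v $ i / c else 0)"
  have "(\<Sum>i<n. (x i)\<^sup>2) = (\<Sum>i<n. (v $ i)\<^sup>2) / c\<^sup>2"
    by (simp add: x_def power_divide sum_divide_distrib)
  also have "\<dots> = 1" using c scalar_prod_self_sum[OF assms(1)] scalar_prod_self_pos[OF assms] by simp
  finally have "x \<in> unit_sphere n" by (simp add: unit_sphere_def x_def)
  moreover have "v = c \<cdot>\<^sub>v Matrix.vec n x" using assms(1) c by (auto simp: x_def)
  ultimately show ?thesis using that c by blast
qed

lemma quadform_smult:
  fixes M :: "real mat"
  assumes "M \<in> carrier_mat n n" "v \<in> carrier_vec n"
  shows "qform M (c \<cdot>\<^sub>v v) = c\<^sup>2 * qform M v"
  using assms by (simp add: mult_mat_vec[OF assms] power2_eq_square)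

lemma continuous_on_quadform_vec:
  fixes M :: "real mat"
  assumes "M \<in> carrier_mat n n"
  shows "continuous_on S (\<lambda>x. Matrix.vec n x \<bullet> (M *\<^sub>v Matrix.vec n x))"
proof -
  have c: "continuous_on S (\<lambda>x. x i)" for i :: nat and S :: "(nat \<Rightarrow> real) set"
    by (rule continuous_on_subset[OF continuous_on_product_coordinates subset_UNIV])
  have "continuous_on S (\<lambda>x. \<Sum>i<n. \<Sum>j<n. x i * M $$ (i, j) * x j)"
    by (intro continuous_intros c)
  then show ?thesis by (simp add: scalar_prod_mult_mat_vec[OF assms])
qed

text \<open>The minimum over the compact unit sphere is attained, hence positive, and homogeneity of
  degree two spreads it to all vectors. This turns positivity at each vector into a uniform
  constant, on which \<open>quadform_dominated\<close> rests.\<close>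

lemma quadform_lower_bound:
  fixes M :: "real mat"
  assumes M: "M \<in> carrier_mat n n"
    and pos: "\<And>v. v \<in> carrier_vec n \<Longrightarrow> v \<noteq> 0\<^sub>v n \<Longrightarrow> qform M v > 0"
  obtains e where "e > 0" "\<And>v. v \<in> carrier_vec n \<Longrightarrow> qform M v \<ge> e * (v \<bullet> v)"
proof (cases "unit_sphere n = {}")
  \<comment> \<open>The sphere is empty only for \<open>n = 0\<close>, where any positive constant
    serves.\<close>
  case True
  have "v = 0\<^sub>v n" if "v \<in> carrier_vec n" for v :: "real vec"
    using unit_sphere_scale[OF that] True by blast
  then have "qform M v \<ge> 1 * (v \<bullet> v)" if "v \<in> carrier_vec n" for v
    using that M by (metis mult_mat_vec_carrier order_refl scalar_prod_left_zero mult_zero_right)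
  then show ?thesis using that[of 1] by simp
next
  case False
  obtain x where x: "x \<in> unit_sphere n"
    and min: "\<And>y. y \<in> unit_sphere n \<Longrightarrow> Matrix.vec n x \<bullet> (M *\<^sub>v Matrix.vec n x) \<le> Matrix.vec n y \<bullet> (M *\<^sub>v Matrix.vec n y)"
    using continuous_attains_inf[OF compact_unit_sphere False continuous_on_quadform_vec[OF M]] by blast
  define e where "e = Matrix.vec n x \<bullet> (M *\<^sub>v Matrix.vec n x)"
  have "e > 0" using pos unit_sphere_vec[OF x] by (simp add: e_def)
  moreover have "qform M v \<ge> e * (v \<bullet> v)" if v: "v \<in> carrier_vec n" for v
  proof (cases "v = 0\<^sub>v n")
    case True
    then show ?thesis using M by simp
  next
    case False
    then obtain y c where y: "y \<in> unit_sphere n" "v = c \<cdot>\<^sub>v Matrix.vec n y" "c\<^sup>2 = v \<bullet> v"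
      using unit_sphere_scale[OF v] by metis
    have "c\<^sup>2 * e \<le> c\<^sup>2 * (Matrix.vec n y \<bullet> (M *\<^sub>v Matrix.vec n y))"
      using min[OF y(1)] by (intro mult_left_mono) (auto simp: e_def)
    also have "\<dots> = qform M v" using quadform_smult[OF M unit_sphere_vec(1)[OF y(1)]] y(2) by simp
    finally show ?thesis using y(3) by (simp add: mult.commute)
  qed
  ultimately show ?thesis using that by blast
qed

lemma quadform_abs_le:
  fixes M :: "real mat"
  assumes M: "M \<in> carrier_mat n n" and v: "v \<in> carrier_vec n"
    and b: "\<And>i j. i < n \<Longrightarrow> j < n \<Longrightarrow> \<bar>M $$ (i, j)\<bar> \<le> b"
  shows "\<bar>qform M v\<bar> \<le> b * real n * (v \<bullet> v)"
proof -
  have "\<bar>qform M v\<bar> \<le> (\<Sum>i<n. \<bar>\<Sum>j<n. v $ i * M $$ (i, j) * v $ j\<bar>)"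
    unfolding scalar_prod_mult_mat_vec[OF M v v] by (rule sum_abs)
  also have "\<dots> \<le> (\<Sum>i<n. \<Sum>j<n. \<bar>v $ i * M $$ (i, j) * v $ j\<bar>)"
    by (intro sum_mono sum_abs)
  also have "\<dots> \<le> (\<Sum>i<n. \<Sum>j<n. b * (((v $ i)\<^sup>2 + (v $ j)\<^sup>2) / 2))"
  proof (intro sum_mono)
    fix i j assume ij: "i \<in> {..<n}" "j \<in> {..<n}"
    have "0 \<le> b" using b[of i j] ij by force
    have "\<bar>v $ i * M $$ (i, j) * v $ j\<bar> = \<bar>M $$ (i, j)\<bar> * (\<bar>v $ i\<bar> * \<bar>v $ j\<bar>)" by (simp add: abs_mult)
    also have "\<dots> \<le> b * (((v $ i)\<^sup>2 + (v $ j)\<^sup>2) / 2)"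
    proof (rule mult_mono)
      show "\<bar>v $ i\<bar> * \<bar>v $ j\<bar> \<le> ((v $ i)\<^sup>2 + (v $ j)\<^sup>2) / 2"
        using sum_squares_bound[of "\<bar>v $ i\<bar>" "\<bar>v $ j\<bar>"] by simp
    qed (use b ij \<open>0 \<le> b\<close> in auto)
    finally show "\<bar>v $ i * M $$ (i, j) * v $ j\<bar> \<le> b * (((v $ i)\<^sup>2 + (v $ j)\<^sup>2) / 2)" .
  qed
  also have "\<dots> = b * real n * (v \<bullet> v)"
  proof -
    have "(\<Sum>i<n. \<Sum>j<n. b * (((v $ i)\<^sup>2 + (v $ j)\<^sup>2) / 2)) = b / 2 * (\<Sum>i<n. \<Sum>j<n. (v $ i)\<^sup>2 + (v $ j)\<^sup>2)"
      unfolding sum_distrib_left by (intro sum.cong refl) simp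
    also have "(\<Sum>i<n. \<Sum>j<n. (v $ i)\<^sup>2 + (v $ j)\<^sup>2) = 2 * real n * (\<Sum>i<n. (v $ i)\<^sup>2)"
      by (simp add: sum.distrib sum_distrib_left[symmetric])
    finally show ?thesis by (simp add: scalar_prod_self_sum[OF v])
  qed
  finally show ?thesis .
qed

lemma quadform_upper_bound:
  fixes M :: "real mat"
  assumes M: "M \<in> carrier_mat n n"
  obtains k where "k > 0" "\<And>v. v \<in> carrier_vec n \<Longrightarrow> qform M v \<le> k * (v \<bullet> v)"
proof -
  define b where "b = (\<Sum>i<n. \<Sum>j<n. \<bar>M $$ (i, j)\<bar>)"
  have b: "\<bar>M $$ (i, j)\<bar> \<le> b" if "i < n" "j < n" for i j
  proof -
    have "\<bar>M $$ (i, j)\<bar> \<le> (\<Sum>j<n. \<bar>M $$ (i, j)\<bar>)" using that by (intro member_le_sum) auto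
    also have "\<dots> \<le> b" unfolding b_def using that
      by (intro member_le_sum[where f = "\<lambda>i. \<Sum>j<n. \<bar>M $$ (i, j)\<bar>"]) (auto intro: sum_nonneg)
    finally show ?thesis .
  qed
  have "b \<ge> 0" unfolding b_def by (intro sum_nonneg) auto
  \<comment> \<open>The added 1 keeps the constant positive when \<open>b = 0\<close>.\<close>
  have "qform M v \<le> (b * real n + 1) * (v \<bullet> v)" if "v \<in> carrier_vec n" for v
    using quadform_abs_le[OF M that b] scalar_prod_self_nonneg[of v] by (auto simp: algebra_simps)
  then show ?thesis using that[of "b * real n + 1"] \<open>b \<ge> 0\<close> by (simp add: add_nonneg_pos)
qed

lemma scalar_prod_symmetric_mat:
  fixes M :: "real mat"
  assumes "M \<in> carrier_mat n n" "M\<^sup>T = M" "u \<in> carrier_vec n" "v \<in> carrier_vec n"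
  shows "u \<bullet> (M *\<^sub>v v) = v \<bullet> (M *\<^sub>v u)"
proof -
  have "u \<bullet> (M *\<^sub>v v) = (M *\<^sub>v v) \<bullet> u" using assms by (intro comm_scalar_prod) auto
  also have "\<dots> = v \<bullet> (M *\<^sub>v u)" using transpose_vec_mult_scalar[OF assms(1,3,4)] assms(2) by simp
  finally show ?thesis .
qed

text \<open>A semidefinite form that vanishes at \<open>x\<close> has a minimum there, so its
  gradient, twice \<open>M *\<^sub>v x\<close>, is zero. Otherwise moving from \<open>x\<close>
  against this gradient would produce a negative value.\<close>

lemma semidef_null_vector:
  fixes M :: "real mat"
  assumes M: "M \<in> carrier_mat n n" "M\<^sup>T = M"
    and nonneg: "\<And>v. v \<in> carrier_vec n \<Longrightarrow> qform M v \<ge> 0"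
    and x: "x \<in> carrier_vec n" "qform M x = 0"
  shows "M *\<^sub>v x = 0\<^sub>v n"
proof (rule ccontr)
  assume ne: "M *\<^sub>v x \<noteq> 0\<^sub>v n"
  define y where "y = M *\<^sub>v x"
  have y: "y \<in> carrier_vec n" using M x by (simp add: y_def)
  define a where "a = y \<bullet> y"
  define b where "b = qform M y"
  have a: "a > 0" using scalar_prod_self_pos[OF y] ne by (simp add: a_def y_def)
  have b: "b \<ge> 0" using nonneg[OF y] by (simp add: b_def)
  \<comment> \<open>This step length satisfies \<open>s * b = - a - s\<close>, so the value
    \<open>2 * s * a + s * s * b\<close> becomes \<open>s * a - s * s\<close>. The 1 in the
    denominator covers \<open>b = 0\<close>.\<close>
  define s where "s = - a / (b + 1)"
  have My: "M *\<^sub>v y \<in> carrier_vec n" using M y by simp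
  have xy: "x \<bullet> (M *\<^sub>v y) = a"
    using scalar_prod_symmetric_mat[OF M x(1) y] by (simp add: a_def y_def)
  have "M *\<^sub>v (x + s \<cdot>\<^sub>v y) = y + s \<cdot>\<^sub>v (M *\<^sub>v y)"
    using M x y mult_mat_vec[OF M(1) y] by (simp add: mult_add_distrib_mat_vec[OF M(1)] y_def)
  then have "qform M (x + s \<cdot>\<^sub>v y) = x \<bullet> y + s * (x \<bullet> (M *\<^sub>v y)) + s * (y \<bullet> y) + s * (s * qform M y)"
    using x(1) y My
    by (simp add: add_scalar_prod_distrib[where n=n] scalar_prod_add_distrib[where n=n] algebra_simps)
  also have "\<dots> = 2 * s * a + s * s * b"
    using x(2) xy by (simp add: a_def b_def y_def algebra_simps)
  also have "\<dots> = s * a - s * s"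
  proof -
    have "s * b = - a - s" using b by (simp add: s_def field_simps)
    then have "s * s * b = s * (- a - s)" by (metis mult.assoc)
    then show ?thesis by (simp add: algebra_simps)
  qed
  also have "\<dots> < 0"
  proof -
    have "s < 0" using a b by (simp add: s_def field_simps)
    then have "s * a < 0" using a by (rule mult_neg_pos)
    then show ?thesis using zero_le_square[of s] by linarith
  qed
  finally show False using nonneg[of "x + s \<cdot>\<^sub>v y"] x(1) y by simp
qed

section \<open>Comparison principle for matrix-valued functions\<close>

lemma has_derivative_transform_nonneg:
  assumes "(f has_real_derivative D) (at t within {0..})" "t \<ge> 0"
    and "\<And>s. s \<ge> 0 \<Longrightarrow> f s = g s" "D = E"
  shows "(g has_real_derivative E) (at t within {0..})"
  using has_field_derivative_transform_within[OF assms(1), of 1] assms(2-4) by auto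

lemma quadform_has_derivative:
  assumes S: "has_mat_deriv_on_nonneg S S' n n" and v: "v \<in> carrier_vec n" and t: "t \<ge> 0"
  shows "((\<lambda>s. qform (S s) v) has_real_derivative qform (S' t) v) (at t within {0..})"
proof -
  note d = S[unfolded has_mat_deriv_on_nonneg_def, rule_format]
  have "((\<lambda>s. \<Sum>i<n. \<Sum>j<n. v $ i * S s $$ (i, j) * v $ j) has_real_derivative
      (\<Sum>i<n. \<Sum>j<n. v $ i * S' t $$ (i, j) * v $ j)) (at t within {0..})"
    using d[OF t] by (intro DERIV_sum DERIV_cmult_right DERIV_cmult) auto
  then show ?thesis
  proof (rule has_derivative_transform_nonneg[OF _ t])
    show "(\<Sum>i<n. \<Sum>j<n. v $ i * S' t $$ (i, j) * v $ j) = qform (S' t) v"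
      using d[OF t] by (subst scalar_prod_mult_mat_vec[OF _ v v]) auto
    show "(\<Sum>i<n. \<Sum>j<n. v $ i * S s $$ (i, j) * v $ j) = qform (S s) v" if "s \<ge> 0" for s
      using d[of s] that by (subst scalar_prod_mult_mat_vec[OF _ v v]) auto
  qed
qed

lemma quadform_continuous:
  assumes S: "has_mat_deriv_on_nonneg S S' n n" and v: "v \<in> carrier_vec n"
  shows "continuous_on {0..} (\<lambda>s. qform (S s) v)"
  using quadform_has_derivative[OF S v]
  by (auto simp: continuous_on_eq_continuous_within intro: DERIV_continuous)

text \<open>At the first time the form degenerates, a unit vector \<open>x\<close> in its kernel minimises it, so the
  derivative of \<open>x \<bullet> S t x\<close> there cannot be positive.\<close>

lemma positive_definite_invariant:
  assumes S: "has_mat_deriv_on_nonneg S S' n n"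
    and sym: "\<And>t. t \<ge> 0 \<Longrightarrow> (S t)\<^sup>T = S t"
    and S0: "\<And>v. v \<in> carrier_vec n \<Longrightarrow> v \<noteq> 0\<^sub>v n \<Longrightarrow> qform (S 0) v > 0"
    and step: "\<And>t v. t > 0 \<Longrightarrow> v \<in> carrier_vec n \<Longrightarrow> v \<noteq> 0\<^sub>v n \<Longrightarrow> S t *\<^sub>v v = 0\<^sub>v n
      \<Longrightarrow> qform (S' t) v > 0"
    and t1: "t1 \<ge> 0" and v1: "v1 \<in> carrier_vec n" "v1 \<noteq> 0\<^sub>v n"
  shows "qform (S t1) v1 > 0"
proof (rule ccontr)
  assume neg: "\<not> qform (S t1) v1 > 0"
  note d = S[unfolded has_mat_deriv_on_nonneg_def, rule_format]
  have car: "S t \<in> carrier_mat n n" if "t \<ge> 0" for t using d[OF that] by blast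
  define q where "q = (\<lambda>(t, x). \<Sum>i<n. \<Sum>j<n. x i * S t $$ (i, j) * x j)"
  have q: "Matrix.vec n x \<bullet> (S t *\<^sub>v Matrix.vec n x) = q (t, x)" if "t \<ge> 0" for t x
    using scalar_prod_mult_mat_vec[OF car[OF that], of "Matrix.vec n x" "Matrix.vec n x"] by (simp add: q_def)
  define D where "D = {0..t1} \<times> unit_sphere n"
  have "compact D" unfolding D_def by (intro compact_Times compact_unit_sphere) simp
  have entry: "continuous_on D (\<lambda>p. S (fst p) $$ (i, j))" if "i < n" "j < n" for i j
  proof (rule continuous_on_compose2[where g = "\<lambda>t. S t $$ (i, j)" and t = "{0..}"])
    show "continuous_on {0..} (\<lambda>t. S t $$ (i, j))"
      using d that by (auto simp: continuous_on_eq_continuous_within intro!: DERIV_continuous)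
  qed (auto intro!: continuous_intros simp: D_def)
  have coord: "continuous_on D (\<lambda>p. snd p i)" for i
    by (rule continuous_on_compose2[OF continuous_on_product_coordinates[of i], of D snd])
      (rule continuous_on_snd[OF continuous_on_id] subset_UNIV)+
  have cont: "continuous_on D q"
    unfolding q_def case_prod_unfold by (intro continuous_intros entry coord) auto
  \<comment> \<open>Pairs of a time and a unit direction with nonpositive value form a compact set,
    so a least time \<open>t0\<close> is attained together with a direction \<open>x0\<close>; at
    all earlier times the form is positive in every direction.\<close>
  define Z where "Z = {p \<in> D. q p \<le> 0}"
  have "Z = D \<inter> (D \<inter> q -` {..0})" by (auto simp: Z_def)
  moreover have "closed (D \<inter> q -` {..0})"
    using continuous_closed_preimage[OF cont compact_imp_closed[OF \<open>compact D\<close>] closed_atMost] .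
  ultimately have "compact Z" using compact_Int_closed[OF \<open>compact D\<close>] by metis
  obtain y c where y: "y \<in> unit_sphere n" "c > 0" "v1 = c \<cdot>\<^sub>v Matrix.vec n y"
    using unit_sphere_scale[OF v1] by metis
  have "c\<^sup>2 * q (t1, y) \<le> 0"
    using neg quadform_smult[OF car[OF t1] unit_sphere_vec(1)[OF y(1)]] y(3) q[OF t1] by simp
  then have "q (t1, y) \<le> 0" using y(2) by (simp add: mult_le_0_iff)
  then have "(t1, y) \<in> Z" using y t1 by (simp add: Z_def D_def)
  then have "\<exists>p\<in>Z. \<forall>z\<in>Z. fst p \<le> fst z"
    by (intro continuous_attains_inf[OF \<open>compact Z\<close>] continuous_intros) auto
  then obtain p where p: "p \<in> Z" and min: "\<And>z. z \<in> Z \<Longrightarrow> fst p \<le> fst z" by blast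
  obtain t0 x0 where p0: "p = (t0, x0)" by (cases p)
  have x0: "x0 \<in> unit_sphere n" and t0: "0 \<le> t0" "t0 \<le> t1" and q0: "q (t0, x0) \<le> 0"
    using p p0 by (auto simp: Z_def D_def)
  let ?x = "Matrix.vec n x0"
  note x = unit_sphere_vec[OF x0]
  have "t0 > 0" using S0[OF x(1,2)] q0 q[of 0 x0] t0 by (cases "t0 = 0") auto
  have before: "q (t, x) > 0" if "0 \<le> t" "t < t0" "x \<in> unit_sphere n" for t x
    using min[of "(t, x)"] that t0 p0 by (force simp: Z_def D_def)
  \<comment> \<open>A left limit of positive values; the left filter is nontrivial because the
    strict initial condition gives \<open>t0 > 0\<close>.\<close>
  have nonneg_sphere: "q (t0, x) \<ge> 0" if "x \<in> unit_sphere n" for x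
  proof (rule tendsto_lowerbound)
    have "continuous_on {0..t0} (\<lambda>t. Matrix.vec n x \<bullet> (S t *\<^sub>v Matrix.vec n x))"
      using quadform_continuous[OF S] by (rule continuous_on_subset) auto
    then have "continuous_on {0..t0} (\<lambda>t. q (t, x))"
      by (rule continuous_on_eq) (simp add: q)
    then show "((\<lambda>t. q (t, x)) \<longlongrightarrow> q (t0, x)) (at t0 within {0..t0})"
      using t0 by (simp add: continuous_on_def)
    show "eventually (\<lambda>t. 0 \<le> q (t, x)) (at t0 within {0..t0})"
      using before that by (auto simp: eventually_at_filter intro!: always_eventually less_imp_le)
    show "at t0 within {0..t0} \<noteq> bot"
      using \<open>t0 > 0\<close> by (simp add: at_within_Icc_at_left trivial_limit_at_left_real)
  qed
  have nonneg: "qform (S t0) v \<ge> 0" if v: "v \<in> carrier_vec n" for v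
  proof (cases "v = 0\<^sub>v n")
    case True
    then show ?thesis using car[OF t0(1)] by simp
  next
    case False
    then obtain y c where "y \<in> unit_sphere n" "v = c \<cdot>\<^sub>v Matrix.vec n y"
      using unit_sphere_scale[OF v] by metis
    then show ?thesis
      using quadform_smult[OF car[OF t0(1)] unit_sphere_vec(1)] nonneg_sphere q[OF t0(1)] by simp
  qed
  have zero: "?x \<bullet> (S t0 *\<^sub>v ?x) = 0" using q0 nonneg[OF x(1)] q[OF t0(1)] by simp
  then have "S t0 *\<^sub>v ?x = 0\<^sub>v n"
    using semidef_null_vector[OF car sym nonneg x(1)] t0 by blast
  from step[OF \<open>t0 > 0\<close> x(1,2) this] have "?x \<bullet> (S' t0 *\<^sub>v ?x) > 0" .
  \<comment> \<open>A positive derivative at the zero would make the form negative just before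
    \<open>t0\<close>, against the choice of \<open>t0\<close>.\<close>
  from has_real_derivative_pos_inc_left[OF quadform_has_derivative[OF S x(1) t0(1)] this]
  obtain e where e: "e > 0"
    "\<And>h. h > 0 \<Longrightarrow> t0 - h \<in> {0..} \<Longrightarrow> h < e \<Longrightarrow> ?x \<bullet> (S (t0 - h) *\<^sub>v ?x) < ?x \<bullet> (S t0 *\<^sub>v ?x)"
    by blast
  define h where "h = min t0 e / 2"
  have h: "h > 0" "h < e" "h < t0" using \<open>e > 0\<close> \<open>t0 > 0\<close> by (auto simp: h_def min_def)
  then have "q (t0 - h, x0) < 0" using e(2)[of h] zero q[of "t0 - h"] by simp
  with before[of "t0 - h" x0] h x0 show False by simp
qed

text \<open>This is \<open>positive_definite_invariant\<close> for the difference of barrier and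
  form. The kernel of that difference consists of the touching vectors, so the derivative test is
  only required where the unknown \<open>W t *\<^sub>v v\<close> can be replaced by a multiple of
  the known \<open>P *\<^sub>v v\<close>.\<close>

lemma barrier_comparison:
  fixes W W' :: "real \<Rightarrow> real mat" and P :: "real mat"
  assumes W: "has_mat_deriv_on_nonneg W W' n n"
    and sym: "\<And>t. t \<ge> 0 \<Longrightarrow> (W t)\<^sup>T = W t"
    and P: "P \<in> carrier_mat n n" "P\<^sup>T = P"
    and \<phi>: "\<And>t. t \<ge> 0 \<Longrightarrow> (\<phi> has_real_derivative \<phi>' t) (at t within {0..})"
    and init: "\<And>v. v \<in> carrier_vec n \<Longrightarrow> v \<noteq> 0\<^sub>v n \<Longrightarrow> qform (W 0) v < \<phi> 0 * qform P v"
    and step: "\<And>t v. t > 0 \<Longrightarrow> v \<in> carrier_vec n \<Longrightarrow> v \<noteq> 0\<^sub>v n \<Longrightarrow> W t *\<^sub>v v = \<phi> t \<cdot>\<^sub>v (P *\<^sub>v v)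
      \<Longrightarrow> qform (W' t) v < \<phi>' t * qform P v"
    and t: "t \<ge> 0" and v: "v \<in> carrier_vec n"
  shows "qform (W t) v \<le> \<phi> t * qform P v"
proof -
  note d = W[unfolded has_mat_deriv_on_nonneg_def, rule_format]
  have car: "W t \<in> carrier_mat n n" "W' t \<in> carrier_mat n n" if "t \<ge> 0" for t using d[OF that] by blast+
  define S where "S = (\<lambda>t. \<phi> t \<cdot>\<^sub>m P - W t)"
  define S' where "S' = (\<lambda>t. \<phi>' t \<cdot>\<^sub>m P - W' t)"
  have smult: "(c \<cdot>\<^sub>m P) *\<^sub>v u = c \<cdot>\<^sub>v (P *\<^sub>v u)" if "u \<in> carrier_vec n" for c u
    using P that by (auto simp: scalar_prod_def sum_distrib_left mult.assoc)
  have Sv: "S t *\<^sub>v u = \<phi> t \<cdot>\<^sub>v (P *\<^sub>v u) - W t *\<^sub>v u" "S' t *\<^sub>v u = \<phi>' t \<cdot>\<^sub>v (P *\<^sub>v u) - W' t *\<^sub>v u"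
    if "t \<ge> 0" "u \<in> carrier_vec n" for t u
    using minus_mult_distrib_mat_vec[OF smult_carrier_mat[OF P(1)] car(1)[OF that(1)] that(2)]
      minus_mult_distrib_mat_vec[OF smult_carrier_mat[OF P(1)] car(2)[OF that(1)] that(2)] that
    by (simp_all add: S_def S'_def smult)
  have qS: "qform (S t) u = \<phi> t * qform P u - qform (W t) u"
    "qform (S' t) u = \<phi>' t * qform P u - qform (W' t) u"
    if "t \<ge> 0" "u \<in> carrier_vec n" for t u
    using Sv[OF that] that car[OF that(1)] P
    by (simp_all add: scalar_prod_minus_distrib[where n=n])
  have "has_mat_deriv_on_nonneg S S' n n"
    unfolding has_mat_deriv_on_nonneg_def
  proof (intro allI impI conjI)
    fix t :: real assume t: "0 \<le> t"
    show "S t \<in> carrier_mat n n" "S' t \<in> carrier_mat n n" using car[OF t] P by (auto simp: S_def S'_def)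
    fix i j assume ij: "i < n" "j < n"
    have "((\<lambda>s. \<phi> s * P $$ (i, j) - W s $$ (i, j)) has_real_derivative
        (\<phi>' t * P $$ (i, j) - W' t $$ (i, j))) (at t within {0..})"
      using d[OF t] ij \<phi>[OF t] by (intro DERIV_diff DERIV_cmult_right) auto
    then show "((\<lambda>s. S s $$ (i, j)) has_real_derivative S' t $$ (i, j)) (at t within {0..})"
    proof (rule has_derivative_transform_nonneg[OF _ t])
      show "\<phi>' t * P $$ (i, j) - W' t $$ (i, j) = S' t $$ (i, j)"
        using car[OF t] P ij by (simp add: S'_def)
      show "\<phi> s * P $$ (i, j) - W s $$ (i, j) = S s $$ (i, j)" if "s \<ge> 0" for s
        using car[of s] that P ij by (simp add: S_def)
    qed
  qed
  moreover have "(S t)\<^sup>T = S t" if "t \<ge> 0" for t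
  proof (rule eq_matI)
    fix i j assume ij: "i < dim_row (S t)" "j < dim_col (S t)"
    then have ij: "i < n" "j < n" using car[OF that] by (auto simp: S_def)
    have "P $$ (j, i) = P $$ (i, j)" using P ij by (metis index_transpose_mat(1) carrier_matD)
    moreover have "W t $$ (j, i) = W t $$ (i, j)"
      using car[OF that] sym[OF that] ij by (metis index_transpose_mat(1) carrier_matD)
    ultimately show "(S t)\<^sup>T $$ (i, j) = S t $$ (i, j)"
      using car[OF that] P ij by (simp add: S_def)
  qed (use car[OF that] in \<open>auto simp: S_def\<close>)
  moreover have "qform (S 0) u > 0" if "u \<in> carrier_vec n" "u \<noteq> 0\<^sub>v n" for u
    using init[OF that] qS(1)[of 0 u] that by simp
  moreover have "qform (S' t) u > 0"
    if "t > 0" "u \<in> carrier_vec n" "u \<noteq> 0\<^sub>v n" "S t *\<^sub>v u = 0\<^sub>v n" for t u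
  proof -
    have "W t *\<^sub>v u = \<phi> t \<cdot>\<^sub>v (P *\<^sub>v u)"
    proof (rule eq_vecI)
      fix i assume "i < dim_vec (\<phi> t \<cdot>\<^sub>v (P *\<^sub>v u))"
      then have i: "i < n" using P by simp
      have "(\<phi> t \<cdot>\<^sub>v (P *\<^sub>v u) - W t *\<^sub>v u) $ i = 0\<^sub>v n $ i"
        using Sv(1)[of t u] that by simp
      then show "(W t *\<^sub>v u) $ i = (\<phi> t \<cdot>\<^sub>v (P *\<^sub>v u)) $ i"
        using i P car(1)[of t] that by simp
    qed (use P car(1)[of t] that in auto)
    then show ?thesis using step[OF that(1-3)] qS(2)[of t u] that by simp
  qed
  ultimately have "v \<noteq> 0\<^sub>v n \<Longrightarrow> qform (S t) v > 0"
    using positive_definite_invariant[of S S' n t v] t v by blast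
  then have "qform (S t) v \<ge> 0"
    using v \<open>has_mat_deriv_on_nonneg S S' n n\<close> t
    by (cases "v = 0\<^sub>v n") (auto simp: has_mat_deriv_on_nonneg_def)
  then show ?thesis using qS(1)[OF t v] by simp
qed

section \<open>Derivative rules and perturbed Lyapunov inequalities\<close>

lemma has_mat_deriv_const:
  assumes "M \<in> carrier_mat n m"
  shows "has_mat_deriv_on_nonneg (\<lambda>_. M) (\<lambda>_. 0\<^sub>m n m) n m"
  using assms by (auto simp: has_mat_deriv_on_nonneg_def)

lemma has_mat_deriv_diff:
  assumes "has_mat_deriv_on_nonneg X X' n m" "has_mat_deriv_on_nonneg Y Y' n m"
  shows "has_mat_deriv_on_nonneg (\<lambda>t. X t - Y t) (\<lambda>t. X' t - Y' t) n m"
  unfolding has_mat_deriv_on_nonneg_def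
proof (intro allI impI conjI)
  note d = assms[unfolded has_mat_deriv_on_nonneg_def, rule_format]
  fix t :: real assume t: "0 \<le> t"
  show "X t - Y t \<in> carrier_mat n m" "X' t - Y' t \<in> carrier_mat n m"
    using d(1)[OF t] d(2)[OF t] by auto
  fix i j assume ij: "i < n" "j < m"
  have "((\<lambda>s. X s $$ (i, j) - Y s $$ (i, j)) has_real_derivative
      X' t $$ (i, j) - Y' t $$ (i, j)) (at t within {0..})"
    using d(1)[OF t] d(2)[OF t] ij by (intro DERIV_diff) auto
  then show "((\<lambda>s. (X s - Y s) $$ (i, j)) has_real_derivative (X' t - Y' t) $$ (i, j)) (at t within {0..})"
  proof (rule has_derivative_transform_nonneg[OF _ t])
    show "X s $$ (i, j) - Y s $$ (i, j) = (X s - Y s) $$ (i, j)" if "0 \<le> s" for s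
      using d(1)[OF that] d(2)[OF that] ij by auto
    show "X' t $$ (i, j) - Y' t $$ (i, j) = (X' t - Y' t) $$ (i, j)"
      using d(1)[OF t] d(2)[OF t] ij by auto
  qed
qed

lemma has_mat_deriv_shift:
  assumes "has_mat_deriv_on_nonneg X X' n m" "h \<ge> 0"
  shows "has_mat_deriv_on_nonneg (\<lambda>t. X (t + h)) (\<lambda>t. X' (t + h)) n m"
  unfolding has_mat_deriv_on_nonneg_def
proof (intro allI impI conjI)
  note d = assms(1)[unfolded has_mat_deriv_on_nonneg_def, rule_format]
  fix t :: real assume t: "0 \<le> t"
  with assms(2) have th: "0 \<le> t + h" by simp
  show "X (t + h) \<in> carrier_mat n m" "X' (t + h) \<in> carrier_mat n m"
    using d[OF th] by auto
  fix i j assume ij: "i < n" "j < m"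
  have "((\<lambda>s. X s $$ (i, j)) has_real_derivative X' (t + h) $$ (i, j)) (at (t + h) within (\<lambda>s. s + h) ` {0..})"
    by (rule has_field_derivative_subset[where s = "{0..}"]) (use d[OF th] ij assms(2) in auto)
  then have "((\<lambda>s. X s $$ (i, j)) \<circ> (\<lambda>s. s + h) has_real_derivative X' (t + h) $$ (i, j) * 1) (at t within {0..})"
    by (rule DERIV_image_chain) (auto intro!: derivative_eq_intros)
  then show "((\<lambda>s. X (s + h) $$ (i, j)) has_real_derivative X' (t + h) $$ (i, j)) (at t within {0..})"
    by (simp add: o_def)
qed

lemma transpose_minus_mat:
  fixes A B :: "real mat"
  assumes "A \<in> carrier_mat n m" "B \<in> carrier_mat n m"
  shows "(A - B)\<^sup>T = A\<^sup>T - B\<^sup>T"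
  using assms by (intro eq_matI) auto

lemma quadform_minus:
  fixes A B :: "real mat"
  assumes "A \<in> carrier_mat n n" "B \<in> carrier_mat n n" "v \<in> carrier_vec n"
  shows "qform (A - B) v = qform A v - qform B v"
  using assms minus_mult_distrib_mat_vec[OF assms]
  by (simp add: scalar_prod_minus_distrib[where n=n])

lemma quadform_zero:
  fixes v :: "real vec"
  assumes "v \<in> carrier_vec n"
  shows "qform (0\<^sub>m n n) v = 0"
  by (subst scalar_prod_mult_mat_vec[OF zero_carrier_mat assms assms]) simp

text \<open>In the applications \<open>L v\<close> is the pairing of \<open>v\<close> with
  \<open>F0 *\<^sub>v (P *\<^sub>v v)\<close> for a stable limit matrix \<open>F0\<close>. The
  \<open>\<beta>\<close> term is the deviation of the matrix from \<open>F0\<close>, the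
  \<open>\<gamma>\<close> term the source. The deviation multiplies the size \<open>d\<close> of the
  solution itself, so a pure exponential barrier could fail while
  \<open>\<kappa> * exp (- \<beta> * t)\<close> is large; a bounded correction factor repairs
  this.\<close>

lemma perturbed_lyapunov_upper:
  fixes W W' :: "real \<Rightarrow> real mat" and L :: "real vec \<Rightarrow> real"
  assumes W: "has_mat_deriv_on_nonneg W W' n n"
    and sym: "\<And>t. t \<ge> 0 \<Longrightarrow> (W t)\<^sup>T = W t"
    and P: "pos_def n P"
    and L: "\<And>v. v \<in> carrier_vec n \<Longrightarrow> L v \<le> - \<alpha> * qform P v"
    and const: "\<alpha> > 0" "\<beta> > 0" "\<gamma> \<ge> 0" "\<gamma> \<le> \<alpha>" "\<kappa> \<ge> 0"
    and init: "\<And>v. v \<in> carrier_vec n \<Longrightarrow> qform (W 0) v \<le> \<kappa> * qform P v"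
    and step: "\<And>t v d. t > 0 \<Longrightarrow> v \<in> carrier_vec n \<Longrightarrow> W t *\<^sub>v v = d \<cdot>\<^sub>v (P *\<^sub>v v) \<Longrightarrow>
      qform (W' t) v \<le> 2 * d * L v + (\<bar>d\<bar> * \<kappa> * exp (- \<beta> * t) + \<kappa> * exp (- \<gamma> * t)) * qform P v"
    and t: "t \<ge> 0" and v: "v \<in> carrier_vec n"
  shows "qform (W t) v \<le> (\<kappa> / \<alpha> + \<kappa> + 1) * exp (\<kappa> / \<beta>) * exp (- \<gamma> * t) * qform P v"
proof -
  have Pc: "P \<in> carrier_mat n n" "P\<^sup>T = P"
    and Ppos: "\<And>v. v \<in> carrier_vec n \<Longrightarrow> v \<noteq> 0\<^sub>v n \<Longrightarrow> qform P v > 0"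
    using P by (auto simp: pos_def_def)
  have Pnn: "qform P v \<ge> 0" if "v \<in> carrier_vec n" for v :: "real vec"
    using Ppos[OF that] Pc that by (cases "v = 0\<^sub>v n") auto
  \<comment> \<open>The last factor of \<open>\<phi>\<close> below is least at \<open>t = 0\<close>,
    where it is \<open>exp (- (\<kappa> / \<beta>))\<close>; the factor
    \<open>exp (\<kappa> / \<beta>)\<close> undoes this. In the bracket,
    \<open>\<kappa> / \<alpha>\<close> beats the source, \<open>\<kappa>\<close> the initial value,
    and 1 makes both comparisons strict.\<close>
  define c where "c = (\<kappa> / \<alpha> + \<kappa> + 1) * exp (\<kappa> / \<beta>)"
  have c: "c > 0" using const by (auto simp: c_def intro!: mult_pos_pos add_nonneg_pos)
  \<comment> \<open>The solution of \<open>\<phi>' = \<phi> * (- \<gamma> + \<kappa> * exp (-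
    \<beta> * t))\<close>: the growth that the deviation may cause is built into the barrier and
    stays bounded because the exponential is integrable.\<close>
  define \<phi> where "\<phi> t = c * exp (- \<gamma> * t) * exp (- (\<kappa> / \<beta>) * exp (- \<beta> * t))" for t
  have pos: "\<phi> t > 0" for t using c by (simp add: \<phi>_def)
  have der: "(\<phi> has_real_derivative \<phi> t * (- \<gamma> + \<kappa> * exp (- \<beta> * t))) (at t within {0..})" for t
    unfolding \<phi>_def using const
    by (auto intro!: derivative_eq_intros simp: algebra_simps)
  have low: "(\<kappa> / \<alpha> + \<kappa> + 1) * exp (- \<gamma> * t) \<le> \<phi> t" if "t \<ge> 0" for t
  proof -
    have "exp (- \<beta> * t) \<le> 1" using const that by simp
    then have "(\<kappa> / \<beta>) * exp (- \<beta> * t) \<le> (\<kappa> / \<beta>) * 1" using const by (intro mult_left_mono) auto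
    then have "1 \<le> exp (\<kappa> / \<beta>) * exp (- (\<kappa> / \<beta>) * exp (- \<beta> * t))"
      by (simp add: mult_exp_exp)
    then have "(\<kappa> / \<alpha> + \<kappa> + 1) * exp (- \<gamma> * t) * 1
      \<le> (\<kappa> / \<alpha> + \<kappa> + 1) * exp (- \<gamma> * t) * (exp (\<kappa> / \<beta>) * exp (- (\<kappa> / \<beta>) * exp (- \<beta> * t)))"
      using const by (intro mult_left_mono) auto
    then show ?thesis by (simp add: \<phi>_def c_def mult_ac)
  qed
  have "qform (W t) v \<le> \<phi> t * qform P v"
  proof (rule barrier_comparison[OF W sym Pc der _ _ t v])
    fix v :: "real vec" assume v: "v \<in> carrier_vec n" "v \<noteq> 0\<^sub>v n"
    have "qform (W 0) v \<le> \<kappa> * qform P v" using init[OF v(1)] .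
    also have "\<dots> < \<phi> 0 * qform P v"
    proof (rule mult_strict_right_mono[OF _ Ppos[OF v]])
      have "\<kappa> / \<alpha> \<ge> 0" using const by simp
      then show "\<kappa> < \<phi> 0" using low[of 0] by simp
    qed
    finally show "qform (W 0) v < \<phi> 0 * qform P v" .
  next
    fix t and v :: "real vec" assume t: "t > (0::real)" and v: "v \<in> carrier_vec n" "v \<noteq> 0\<^sub>v n"
      and eq: "W t *\<^sub>v v = \<phi> t \<cdot>\<^sub>v (P *\<^sub>v v)"
    define p where "p = qform P v"
    have p: "p > 0" using Ppos[OF v] by (simp add: p_def)
    define e where "e = \<kappa> * exp (- \<gamma> * t)"
    define b where "b = \<phi> t * \<kappa> * exp (- \<beta> * t)"
    have "\<kappa> / \<alpha> * exp (- \<gamma> * t) < (\<kappa> / \<alpha> + \<kappa> + 1) * exp (- \<gamma> * t)" using const by (intro mult_strict_right_mono) auto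
    then have "\<kappa> / \<alpha> * exp (- \<gamma> * t) < \<phi> t" using low[of t] t by simp
    \<comment> \<open>The dissipation \<open>2 * \<phi> t * \<alpha>\<close> is spent in halves: one
      on the source \<open>e\<close>, the other on the decay of the barrier, whence the condition
      \<open>\<gamma> \<le> \<alpha>\<close>.\<close>
    then have "e < \<phi> t * \<alpha>" using const by (simp add: e_def field_simps)
    moreover have "\<phi> t * \<gamma> \<le> \<phi> t * \<alpha>" using pos[of t] const by simp
    ultimately have *: "- 2 * \<phi> t * \<alpha> + (b + e) < - \<phi> t * \<gamma> + b" by simp
    have "qform (W' t) v \<le> 2 * \<phi> t * L v + (b + e) * p"
      using step[OF t v(1) eq] pos[of t] by (simp add: p_def e_def b_def mult.assoc)
    also have "2 * \<phi> t * L v \<le> 2 * \<phi> t * (- \<alpha> * p)"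
      using L[OF v(1)] pos[of t] by (intro mult_left_mono) (auto simp: p_def)
    also have "2 * \<phi> t * (- \<alpha> * p) + (b + e) * p = (- 2 * \<phi> t * \<alpha> + (b + e)) * p" by (simp add: algebra_simps)
    also have "\<dots> < (- \<phi> t * \<gamma> + b) * p"
      using * p by (rule mult_strict_right_mono)
    finally show "qform (W' t) v < \<phi> t * (- \<gamma> + \<kappa> * exp (- \<beta> * t)) * qform P v"
      by (simp add: p_def b_def algebra_simps)
  qed
  also have "\<dots> \<le> c * exp (- \<gamma> * t) * qform P v"
  proof (rule mult_right_mono[OF _ Pnn[OF v]])
    have "exp (- (\<kappa> / \<beta>) * exp (- \<beta> * t)) \<le> 1" using const by simp
    then have "c * exp (- \<gamma> * t) * exp (- (\<kappa> / \<beta>) * exp (- \<beta> * t)) \<le> c * exp (- \<gamma> * t) * 1"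
      using c by (intro mult_left_mono) auto
    then show "\<phi> t \<le> c * exp (- \<gamma> * t)" by (simp add: \<phi>_def)
  qed
  finally show ?thesis by (simp add: c_def)
qed

text \<open>The hypotheses are invariant under changing the signs of \<open>W\<close> and
  \<open>d\<close>, so the one-sided bound applies to both signs. The negative is written as a
  difference from the zero matrix to reuse the rules for differences.\<close>

lemma perturbed_lyapunov_bound:
  fixes W W' :: "real \<Rightarrow> real mat" and L :: "real vec \<Rightarrow> real"
  assumes W: "has_mat_deriv_on_nonneg W W' n n"
    and sym: "\<And>t. t \<ge> 0 \<Longrightarrow> (W t)\<^sup>T = W t"
    and P: "pos_def n P"
    and L: "\<And>v. v \<in> carrier_vec n \<Longrightarrow> L v \<le> - \<alpha> * qform P v"
    and const: "\<alpha> > 0" "\<beta> > 0" "\<gamma> \<ge> 0" "\<gamma> \<le> \<alpha>" "\<kappa> \<ge> 0"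
    and init: "\<And>v. v \<in> carrier_vec n \<Longrightarrow> \<bar>qform (W 0) v\<bar> \<le> \<kappa> * qform P v"
    and step: "\<And>t v d. t > 0 \<Longrightarrow> v \<in> carrier_vec n \<Longrightarrow> W t *\<^sub>v v = d \<cdot>\<^sub>v (P *\<^sub>v v) \<Longrightarrow>
      \<bar>qform (W' t) v - 2 * d * L v\<bar> \<le> (\<bar>d\<bar> * \<kappa> * exp (- \<beta> * t) + \<kappa> * exp (- \<gamma> * t)) * qform P v"
    and t: "t \<ge> 0" and v: "v \<in> carrier_vec n"
  shows "\<bar>qform (W t) v\<bar> \<le> (\<kappa> / \<alpha> + \<kappa> + 1) * exp (\<kappa> / \<beta>) * exp (- \<gamma> * t) * qform P v"
proof -
  have car: "W t \<in> carrier_mat n n" "W' t \<in> carrier_mat n n" if "t \<ge> 0" for t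
    using W that by (auto simp: has_mat_deriv_on_nonneg_def)
  have Pc: "P \<in> carrier_mat n n" using P by (simp add: pos_def_def)
  define N where "N = (\<lambda>t. 0\<^sub>m n n - W t)"
  define N' where "N' = (\<lambda>t. 0\<^sub>m n n - W' t)"
  have N: "has_mat_deriv_on_nonneg N N' n n"
    unfolding N_def N'_def using has_mat_deriv_diff[OF has_mat_deriv_const[of "0\<^sub>m n n"] W] by simp
  have Nq: "qform (N t) u = - qform (W t) u" "qform (N' t) u = - qform (W' t) u"
    if "t \<ge> 0" "u \<in> carrier_vec n" for t u
    using quadform_zero[OF that(2)] quadform_minus[OF zero_carrier_mat car(1)[OF that(1)] that(2)]
      quadform_minus[OF zero_carrier_mat car(2)[OF that(1)] that(2)] that
    by (simp_all add: N_def N'_def)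
  have up: "qform (W t) v \<le> (\<kappa> / \<alpha> + \<kappa> + 1) * exp (\<kappa> / \<beta>) * exp (- \<gamma> * t) * qform P v"
  proof (rule perturbed_lyapunov_upper[OF W sym P L const _ _ t v])
    show "qform (W 0) v \<le> \<kappa> * qform P v" if "v \<in> carrier_vec n" for v
      using init[OF that] by (simp add: abs_le_iff)
    show "qform (W' t) v \<le> 2 * d * L v +
       (\<bar>d\<bar> * \<kappa> * exp (- \<beta> * t) + \<kappa> * exp (- \<gamma> * t)) * qform P v"
      if "t > 0" "v \<in> carrier_vec n" "W t *\<^sub>v v = d \<cdot>\<^sub>v (P *\<^sub>v v)" for t v d
      using step[OF that] by linarith
  qed
  have "qform (N t) v \<le> (\<kappa> / \<alpha> + \<kappa> + 1) * exp (\<kappa> / \<beta>) * exp (- \<gamma> * t) * qform P v"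
  proof (rule perturbed_lyapunov_upper[OF N _ P L const _ _ t v])
    show "(N t)\<^sup>T = N t" if "t \<ge> 0" for t
      using sym[OF that] car(1)[OF that] transpose_minus_mat[of "0\<^sub>m n n" n n "W t"] by (simp add: N_def)
    show "qform (N 0) v \<le> \<kappa> * qform P v" if "v \<in> carrier_vec n" for v :: "real vec"
      using init[OF that] Nq(1)[of 0 v] that by (simp add: abs_le_iff)
    fix t d and v :: "real vec" assume t: "t > (0::real)" and v: "v \<in> carrier_vec n" and eq: "N t *\<^sub>v v = d \<cdot>\<^sub>v (P *\<^sub>v v)"
    have "W t *\<^sub>v v = (- d) \<cdot>\<^sub>v (P *\<^sub>v v)"
    proof (rule eq_vecI)
      fix i assume "i < dim_vec ((- d) \<cdot>\<^sub>v (P *\<^sub>v v))"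
      then have i: "i < n" using Pc by simp
      have "(N t *\<^sub>v v) $ i = - (W t *\<^sub>v v) $ i"
        using minus_mult_distrib_mat_vec[of "0\<^sub>m n n" n n "W t" v] car(1)[of t] t v i by (simp add: N_def)
      then show "(W t *\<^sub>v v) $ i = ((- d) \<cdot>\<^sub>v (P *\<^sub>v v)) $ i" using eq i Pc by simp
    qed (use Pc car(1)[of t] t in auto)
    from step[OF t v this] show "qform (N' t) v \<le> 2 * d * L v +
       (\<bar>d\<bar> * \<kappa> * exp (- \<beta> * t) + \<kappa> * exp (- \<gamma> * t)) * qform P v"
      using Nq(2)[of t v] t v by (simp add: abs_le_iff)
  qed
  then show ?thesis using up Nq(1)[OF t v] by (simp add: abs_le_iff)
qed

text \<open>Gronwall for the energy \<open>g\<close>: Cauchy-Schwarz gives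
  \<open>g' t \<le> c * g t\<close>, so \<open>g t * exp (- c * t)\<close> cannot grow from its
  initial value 0. The coefficient bound is asked for only up to \<open>T\<close>, since a Riccati
  solution is not yet known to be globally bounded where this is applied.\<close>

lemma linear_system_zero:
  fixes f f' :: "'i \<Rightarrow> real \<Rightarrow> real"
  assumes I: "finite I"
    and der: "\<And>i t. i \<in> I \<Longrightarrow> t \<ge> 0 \<Longrightarrow> (f i has_real_derivative f' i t) (at t within {0..})"
    and f0: "\<And>i. i \<in> I \<Longrightarrow> f i 0 = 0"
    and bound: "\<And>i t. i \<in> I \<Longrightarrow> 0 \<le> t \<Longrightarrow> t \<le> T \<Longrightarrow> \<bar>f' i t\<bar> \<le> K * (\<Sum>j\<in>I. \<bar>f j t\<bar>)"
    and T: "0 \<le> T" and i: "i \<in> I"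
  shows "f i T = 0"
proof -
  define c where "c = 2 * \<bar>K\<bar> * real (card I)"
  define g where "g t = (\<Sum>i\<in>I. (f i t)\<^sup>2)" for t
  define g' where "g' t = (\<Sum>i\<in>I. 2 * f i t * f' i t)" for t
  have g: "(g has_real_derivative g' t) (at t within {0..})" if "t \<ge> 0" for t
    unfolding g_def g'_def using der that
    by (intro DERIV_sum) (auto intro!: derivative_eq_intros)
  have g': "g' t \<le> c * g t" if "0 \<le> t" "t \<le> T" for t
  proof -
    let ?s = "\<Sum>j\<in>I. \<bar>f j t\<bar>"
    have "g' t \<le> (\<Sum>i\<in>I. 2 * \<bar>f i t\<bar> * (\<bar>K\<bar> * ?s))"
      unfolding g'_def
    proof (rule sum_mono)
      fix i assume i: "i \<in> I"
      have "2 * f i t * f' i t \<le> 2 * \<bar>f i t\<bar> * \<bar>f' i t\<bar>"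
        using abs_ge_self[of "2 * f i t * f' i t"] by (simp add: abs_mult)
      also have "\<dots> \<le> 2 * \<bar>f i t\<bar> * (K * ?s)" using bound[OF i that] by (intro mult_left_mono) auto
      also have "\<dots> \<le> 2 * \<bar>f i t\<bar> * (\<bar>K\<bar> * ?s)"
        by (intro mult_left_mono mult_right_mono sum_nonneg) auto
      finally show "2 * f i t * f' i t \<le> 2 * \<bar>f i t\<bar> * (\<bar>K\<bar> * ?s)" .
    qed
    also have "\<dots> = (\<Sum>i\<in>I. (2 * \<bar>K\<bar> * ?s) * \<bar>f i t\<bar>)" by (intro sum.cong refl) (simp only: mult_ac)
    also have "\<dots> = (2 * \<bar>K\<bar> * ?s) * ?s" by (rule sum_distrib_left[symmetric])
    also have "\<dots> = 2 * \<bar>K\<bar> * ?s\<^sup>2" by (simp only: power2_eq_square mult.assoc)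
    also have "?s\<^sup>2 \<le> (\<Sum>i\<in>I. \<bar>f i t\<bar>\<^sup>2) * card I" by (rule sum_squared_le_sum_of_squares)
    also have "(\<Sum>i\<in>I. \<bar>f i t\<bar>\<^sup>2) = g t" by (simp add: g_def)
    also have "2 * \<bar>K\<bar> * (g t * card I) = c * g t" by (simp add: c_def)
    finally show ?thesis by (simp add: mult_left_mono)
  qed
  define h where "h t = g t * exp (- c * t)" for t
  have h: "(h has_real_derivative (g' t - c * g t) * exp (- c * t)) (at t within {0..})" if "t \<ge> 0" for t
    unfolding h_def using g[OF that] by (auto intro!: derivative_eq_intros simp: algebra_simps)
  have "h T \<le> h 0"
  proof (rule DERIV_nonpos_imp_decreasing_open[OF T])
    fix t assume t: "0 < t" "t < T"
    have "at t within {0..} = at t" using t by (intro at_within_interior) (simp add: interior_real_atLeast)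
    then show "\<exists>y. (h has_real_derivative y) (at t) \<and> y \<le> 0"
      using h[of t] g'[of t] t by (auto intro!: exI[of _ "(g' t - c * g t) * exp (- c * t)"] mult_nonpos_nonneg)
  next
    show "continuous_on {0..T} h"
      using h by (intro continuous_on_subset[of "{0..}" h "{0..T}"])
        (auto simp: continuous_on_eq_continuous_within intro: DERIV_continuous)
  qed
  also have "h 0 = 0" using f0 by (simp add: h_def g_def)
  finally have "g T \<le> 0" by (simp add: h_def mult_le_0_iff)
  then have "g T = 0" by (simp add: g_def antisym sum_nonneg)
  then show ?thesis using I i by (simp add: g_def sum_nonneg_eq_0_iff)
qed

section \<open>Lyapunov functions for stable matrices\<close>

text \<open>Measured in the weighted moduli \<open>z i = k ^ i * cmod (y i)\<close>, an entry above
  the diagonal gains at least one factor \<open>1 / k\<close>. All of them together then cost at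
  most half of the diagonal dissipation \<open>a\<close>.\<close>

lemma triangular_dissipative:
  fixes b :: "nat \<Rightarrow> nat \<Rightarrow> complex"
  assumes upper: "\<And>i j. i < n \<Longrightarrow> j < i \<Longrightarrow> b i j = 0"
    and diag: "\<And>i. i < n \<Longrightarrow> Re (b i i) \<le> - a"
    and bound: "\<And>i j. i < n \<Longrightarrow> j < n \<Longrightarrow> cmod (b i j) \<le> \<tau>"
    and k: "k \<ge> 1" "\<tau> * real n \<le> k * (a / 2)"
  shows "(\<Sum>i<n. k ^ (2 * i) * Re (cnj (\<Sum>j<n. b i j * y j) * y i))
    \<le> - (a / 2) * (\<Sum>i<n. k ^ (2 * i) * (cmod (y i))\<^sup>2)"
proof -
  define z where "z i = k ^ i * cmod (y i)" for i
  have z2: "(z i)\<^sup>2 = k ^ (2 * i) * (cmod (y i))\<^sup>2" for i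
    by (simp add: z_def power_mult_distrib power_mult[symmetric] mult.commute)
  \<comment> \<open>The nonnegative second summand is granted to all pairs, on and below the
    diagonal too, so that the double sum has a closed form.\<close>
  have bnd: "k ^ (2 * i) * Re (cnj (b i j * y j) * y i)
      \<le> (if j = i then - a * (z i)\<^sup>2 else 0) + \<tau> / (2 * k) * ((z i)\<^sup>2 + (z j)\<^sup>2)"
    if i: "i < n" and j: "j < n" for i j
  proof -
    have tau: "\<tau> \<ge> 0" using bound[OF i j] norm_ge_zero order_trans by blast
    then have nn: "0 \<le> \<tau> / (2 * k) * ((z i)\<^sup>2 + (z j)\<^sup>2)" using k by simp
    consider "j = i" | "j < i" | "i < j" by linarith
    then show ?thesis
    proof cases
      case 1
      have "Re (cnj (b i i * y i) * y i) = Re (b i i) * (cmod (y i))\<^sup>2"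
        by (simp add: cmod_power2) (simp add: algebra_simps power2_eq_square)
      also have "k ^ (2 * i) * \<dots> = Re (b i i) * (z i)\<^sup>2" by (simp add: z2)
      also have "\<dots> \<le> - a * (z i)\<^sup>2" using diag[OF i] by (rule mult_right_mono) simp
      finally show ?thesis using nn 1 by simp
    next
      case 2
      then show ?thesis using upper[OF i 2] nn by simp
    next
      case 3
      have kpow: "k * k ^ i \<le> k ^ j"
        using power_increasing[of "Suc i" j k] 3 k by simp
      have "k ^ (2 * i) * Re (cnj (b i j * y j) * y i) \<le> k ^ (2 * i) * (cmod (b i j) * cmod (y j) * cmod (y i))"
        using complex_Re_le_cmod[of "cnj (b i j * y j) * y i"] k
        by (intro mult_left_mono) (auto simp: norm_mult)
      also have "\<dots> \<le> k ^ (2 * i) * (\<tau> * cmod (y j) * cmod (y i))"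
        using bound[OF i j] k by (intro mult_left_mono mult_right_mono) auto
      also have "\<dots> = (\<tau> / k) * (z i * ((k * k ^ i) * cmod (y j)))"
        using k by (simp add: z_def power_mult power2_eq_square power_mult_distrib mult_ac flip: power_add)
      also have "\<dots> \<le> (\<tau> / k) * (z i * z j)"
        unfolding z_def[of j] using kpow tau k
        by (intro mult_left_mono mult_right_mono) (auto simp: z_def)
      also have "\<dots> \<le> (\<tau> / k) * (((z i)\<^sup>2 + (z j)\<^sup>2) / 2)"
        using sum_squares_bound[of "z i" "z j"] tau k by (intro mult_left_mono) auto
      finally show ?thesis using 3 by simp
    qed
  qed
  have "(\<Sum>i<n. k ^ (2 * i) * Re (cnj (\<Sum>j<n. b i j * y j) * y i))
      = (\<Sum>i<n. \<Sum>j<n. k ^ (2 * i) * Re (cnj (b i j * y j) * y i))"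
    unfolding cnj_sum sum_distrib_right Re_sum sum_distrib_left ..
  also have "\<dots> \<le> (\<Sum>i<n. \<Sum>j<n. (if j = i then - a * (z i)\<^sup>2 else 0) + \<tau> / (2 * k) * ((z i)\<^sup>2 + (z j)\<^sup>2))"
    using bnd by (intro sum_mono) auto
  also have "\<dots> = - a * (\<Sum>i<n. (z i)\<^sup>2) + \<tau> / (2 * k) * (\<Sum>i<n. \<Sum>j<n. (z i)\<^sup>2 + (z j)\<^sup>2)"
  proof -
    have split: "(\<Sum>x\<in>X. f x + c * g x) = sum f X + c * sum g X" for f g :: "nat \<Rightarrow> real" and c X
      by (simp add: sum.distrib sum_distrib_left)
    have "(\<Sum>j<n. (if j = i then - a * (z i)\<^sup>2 else 0) + \<tau> / (2 * k) * ((z i)\<^sup>2 + (z j)\<^sup>2))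
        = - a * (z i)\<^sup>2 + \<tau> / (2 * k) * (\<Sum>j<n. (z i)\<^sup>2 + (z j)\<^sup>2)" if "i < n" for i
      unfolding split using that by simp
    then have "(\<Sum>i<n. \<Sum>j<n. (if j = i then - a * (z i)\<^sup>2 else 0) + \<tau> / (2 * k) * ((z i)\<^sup>2 + (z j)\<^sup>2))
        = (\<Sum>i<n. - a * (z i)\<^sup>2 + \<tau> / (2 * k) * (\<Sum>j<n. (z i)\<^sup>2 + (z j)\<^sup>2))"
      by (intro sum.cong refl) simp
    then show ?thesis unfolding split sum_distrib_left[symmetric] .
  qed
  also have "(\<Sum>i<n. \<Sum>j<n. (z i)\<^sup>2 + (z j)\<^sup>2) = 2 * real n * (\<Sum>i<n. (z i)\<^sup>2)"
    by (simp add: sum.distrib sum_distrib_left[symmetric])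
  also have "- a * (\<Sum>i<n. (z i)\<^sup>2) + \<tau> / (2 * k) * (2 * real n * (\<Sum>i<n. (z i)\<^sup>2))
      = (- a + \<tau> * real n / k) * (\<Sum>i<n. (z i)\<^sup>2)"
    by (simp add: algebra_simps)
  also have "\<dots> \<le> - (a / 2) * (\<Sum>i<n. (z i)\<^sup>2)"
  proof (rule mult_right_mono)
    have "\<tau> * real n / k \<le> a / 2" using k by (simp add: field_simps)
    then show "- a + \<tau> * real n / k \<le> - (a / 2)" by linarith
  qed (simp add: sum_nonneg)
  finally show ?thesis by (simp add: z2)
qed

text \<open>In Schur form \<open>T\<close>, conjugating by \<open>diag (k ^ i)\<close> shrinks the strictly upper triangular part of
  \<open>T\<close> below the gap to the imaginary axis.\<close>

lemma stable_lyapunov: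
  fixes M :: "real mat"
  assumes M: "M \<in> carrier_mat n n" and st: "mat_stable M"
  obtains P \<alpha> where "pos_def n P" "\<alpha> > 0"
    "\<And>v. v \<in> carrier_vec n \<Longrightarrow> v \<bullet> (M *\<^sub>v (P *\<^sub>v v)) \<le> - \<alpha> * qform P v"
proof -
  \<comment> \<open>Covariances evolve by \<open>M * P + P * M\<^sup>T\<close>, so the form to be
    estimated pairs \<open>M\<^sup>T *\<^sub>v v\<close> with \<open>P *\<^sub>v v\<close>, and it
    is the transpose that is brought to Schur form.\<close>
  define T where "T = cmat (M\<^sup>T)"
  have T: "T \<in> carrier_mat n n" using M by (simp add: T_def)
  obtain es where es: "char_poly T = (\<Prod>e\<leftarrow>es. [:- e, 1:])"
    using char_poly_factorized[OF T] by blast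
  obtain B S Q where "schur_decomposition T es = (B, S, Q)"
    by (cases "schur_decomposition T es") auto
  from schur_decomposition[OF T es this]
  have sim: "similar_mat_wit T B S Q" and ut: "upper_triangular B" and diag: "diag_mat B = es" by auto
  have car: "B \<in> carrier_mat n n" "S \<in> carrier_mat n n" "Q \<in> carrier_mat n n"
    and SQ: "S * Q = 1\<^sub>m n" "Q * S = 1\<^sub>m n" "T = S * B * Q"
    using sim T by (auto simp: similar_mat_wit_def Let_def)
  have neg: "Re (B $$ (i, i)) < 0" if "i < n" for i
  proof -
    have "B $$ (i, i) \<in> set es" using that car diag by (auto simp: diag_mat_def)
    then have "poly (char_poly T) (B $$ (i, i)) = 0"
      unfolding es by (induction es) auto
    moreover have "T = (cmat M)\<^sup>T" using M by (intro eq_matI) (auto simp: T_def)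
    ultimately have "poly (char_poly (cmat M)) (B $$ (i, i)) = 0"
      using char_poly_transpose_mat[of "cmat M" n] M by simp
    then have "eigenvalue (cmat M) (B $$ (i, i))"
      using eigenvalue_root_char_poly[of "cmat M" n] M by simp
    then show ?thesis using st by (simp add: mat_stable_def)
  qed
  \<comment> \<open>The inserted 1 gives the minimum a meaning for \<open>n = 0\<close>.\<close>
  define a where "a = Min (insert 1 ((\<lambda>i. - Re (B $$ (i, i))) ` {..<n}))"
  have a: "a > 0" unfolding a_def using neg by (subst Min_gr_iff) auto
  have aB: "Re (B $$ (i, i)) \<le> - a" if "i < n" for i
  proof -
    have "a \<le> - Re (B $$ (i, i))" unfolding a_def using that by (intro Min_le) auto
    then show ?thesis by simp
  qed
  define \<tau> where "\<tau> = (\<Sum>p\<in>{..<n} \<times> {..<n}. cmod (B $$ p))"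
  have \<tau>: "cmod (B $$ (i, j)) \<le> \<tau>" if "i < n" "j < n" for i j
    unfolding \<tau>_def using that by (intro member_le_sum[where f = "\<lambda>p. cmod (B $$ p)"]) auto
  \<comment> \<open>The least base that meets both requirements of
    \<open>triangular_dissipative\<close>.\<close>
  define k where "k = max 1 (\<tau> * real n / (a / 2))"
  have k: "k \<ge> 1" by (simp add: k_def)
  have "\<tau> * real n / (a / 2) \<le> k" unfolding k_def by (rule max.cobounded2)
  then have k2: "\<tau> * real n \<le> k * (a / 2)" using a by (simp add: field_simps)
  define y where "y v i = (\<Sum>j<n. Q $$ (i, j) * complex_of_real (v $ j))" for v i
  \<comment> \<open>The real part of the Hermitian Gram matrix of \<open>Q\<close> with weights
    \<open>k ^ (2 * l)\<close>; on real vectors its form is the squared weighted norm of the Schur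
    coordinates \<open>y v\<close>.\<close>
  define P where "P = mat n n (\<lambda>(i, j). \<Sum>l<n. k ^ (2 * l) * Re (cnj (Q $$ (l, i)) * Q $$ (l, j)))"
  have P: "P \<in> carrier_mat n n" by (simp add: P_def)
  have form: "u \<bullet> (P *\<^sub>v v) = (\<Sum>l<n. k ^ (2 * l) * Re (cnj (y u l) * y v l))"
    if u: "u \<in> carrier_vec n" and v: "v \<in> carrier_vec n" for u v
  proof -
    have "u \<bullet> (P *\<^sub>v v) = (\<Sum>i<n. \<Sum>j<n. u $ i * (\<Sum>l<n. k ^ (2 * l) * Re (cnj (Q $$ (l, i)) * Q $$ (l, j))) * v $ j)"
      by (subst scalar_prod_mult_mat_vec[OF P u v]) (simp add: P_def)
    also have "\<dots> = (\<Sum>i<n. \<Sum>j<n. \<Sum>l<n. k ^ (2 * l) * Re (cnj (Q $$ (l, i) * u $ i) * (Q $$ (l, j) * v $ j)))"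
      unfolding sum_distrib_left sum_distrib_right
      by (intro sum.cong refl) (simp add: algebra_simps)
    also have "\<dots> = (\<Sum>i<n. \<Sum>l<n. \<Sum>j<n. k ^ (2 * l) * Re (cnj (Q $$ (l, i) * u $ i) * (Q $$ (l, j) * v $ j)))"
      by (intro sum.cong refl sum.swap)
    also have "\<dots> = (\<Sum>l<n. \<Sum>i<n. \<Sum>j<n. k ^ (2 * l) * Re (cnj (Q $$ (l, i) * u $ i) * (Q $$ (l, j) * v $ j)))"
      by (rule sum.swap)
    also have "\<dots> = (\<Sum>l<n. \<Sum>j<n. \<Sum>i<n. k ^ (2 * l) * Re (cnj (Q $$ (l, i) * u $ i) * (Q $$ (l, j) * v $ j)))"
      by (intro sum.cong refl sum.swap)
    also have "\<dots> = (\<Sum>l<n. k ^ (2 * l) * Re (cnj (y u l) * y v l))"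
      unfolding y_def cnj_sum sum_distrib_right Re_sum sum_distrib_left ..
    finally show ?thesis .
  qed
  have diagform: "qform P v = (\<Sum>l<n. k ^ (2 * l) * (cmod (y v l))\<^sup>2)" if v: "v \<in> carrier_vec n" for v
    unfolding form[OF v v] by (intro sum.cong refl) (simp add: cmod_power2 flip: power2_eq_square)
  have yM: "y (M\<^sup>T *\<^sub>v v) i = (\<Sum>j<n. B $$ (i, j) * y v j)"
    if v: "v \<in> carrier_vec n" and i: "i < n" for v i
  proof -
    define cv where "cv = map_vec complex_of_real v"
    have cv: "cv \<in> carrier_vec n" using v by (simp add: cv_def)
    have yQ: "(Q *\<^sub>v map_vec complex_of_real w) $ i = y w i" if "w \<in> carrier_vec n" "i < n" for w i
      using that car by (simp add: y_def scalar_prod_def atLeast0LessThan)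
    have Tv: "map_vec complex_of_real (M\<^sup>T *\<^sub>v v) = T *\<^sub>v cv"
      using M v by (intro eq_vecI) (auto simp: T_def cv_def scalar_prod_def)
    have "Q * T = B * Q"
    proof -
      have "Q * T = Q * (S * (B * Q))" using SQ car by simp
      also have "\<dots> = (Q * S) * (B * Q)" using car by (intro assoc_mult_mat[symmetric]) auto
      finally show ?thesis using SQ car by simp
    qed
    then have "Q *\<^sub>v (T *\<^sub>v cv) = B *\<^sub>v (Q *\<^sub>v cv)"
      using assoc_mult_mat_vec[OF car(3) T cv] assoc_mult_mat_vec[OF car(1) car(3) cv] by simp
    then have "y (M\<^sup>T *\<^sub>v v) i = (B *\<^sub>v (Q *\<^sub>v cv)) $ i"
      using yQ[of "M\<^sup>T *\<^sub>v v" i] Tv M v i by simp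
    also have "\<dots> = (\<Sum>j<n. B $$ (i, j) * (Q *\<^sub>v cv) $ j)"
      using car i by (simp add: scalar_prod_def atLeast0LessThan)
    also have "\<dots> = (\<Sum>j<n. B $$ (i, j) * y v j)"
      using yQ[OF v] by (intro sum.cong) (auto simp: cv_def)
    finally show ?thesis .
  qed
  have pd: "pos_def n P"
    unfolding pos_def_def
  proof (intro conjI ballI impI P)
    show "P\<^sup>T = P"
      by (intro eq_matI) (auto simp: P_def intro!: sum.cong)
    fix v :: "real vec" assume v: "v \<in> carrier_vec n" "v \<noteq> 0\<^sub>v n"
    have "\<exists>i<n. y v i \<noteq> 0"
    proof (rule ccontr)
      define cv where "cv = map_vec complex_of_real v"
      have cv: "cv \<in> carrier_vec n" using v by (simp add: cv_def)
      assume "\<not> (\<exists>i<n. y v i \<noteq> 0)"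
      then have "Q *\<^sub>v cv = 0\<^sub>v n"
        using car v by (intro eq_vecI) (auto simp: y_def cv_def scalar_prod_def atLeast0LessThan)
      then have "S *\<^sub>v (Q *\<^sub>v cv) = 0\<^sub>v n" using car by (intro eq_vecI) auto
      then have "cv = 0\<^sub>v n" using assoc_mult_mat_vec[OF car(2,3) cv] SQ(1) cv by simp
      then have "v $ i = 0" if "i < n" for i
        using that v by (metis cv_def carrier_vecD index_map_vec(1) index_zero_vec(1) of_real_eq_0_iff)
      then have "v = 0\<^sub>v n" using v by (intro eq_vecI) auto
      with v(2) show False by simp
    qed
    then obtain i where i: "i < n" "y v i \<noteq> 0" by blast
    have "0 < k ^ (2 * i) * (cmod (y v i))\<^sup>2" using k i by simp
    also have "\<dots> \<le> (\<Sum>l<n. k ^ (2 * l) * (cmod (y v l))\<^sup>2)"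
      using k i by (intro member_le_sum[where f = "\<lambda>l. k ^ (2 * l) * (cmod (y v l))\<^sup>2"]) auto
    finally show "qform P v > 0" using diagform[OF v(1)] by simp
  qed
  have "v \<bullet> (M *\<^sub>v (P *\<^sub>v v)) \<le> - (a / 2) * qform P v" if v: "v \<in> carrier_vec n" for v
  proof -
    have Mv: "M\<^sup>T *\<^sub>v v \<in> carrier_vec n" using M v by simp
    have Pv: "P *\<^sub>v v \<in> carrier_vec n" using P v by simp
    have "v \<bullet> (M *\<^sub>v (P *\<^sub>v v)) = (M\<^sup>T *\<^sub>v v) \<bullet> (P *\<^sub>v v)"
      using transpose_vec_mult_scalar[OF M Pv v] by simp
    also have "\<dots> = (\<Sum>l<n. k ^ (2 * l) * Re (cnj (\<Sum>j<n. B $$ (l, j) * y v j) * y v l))"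
      unfolding form[OF Mv v] using yM[OF v] by (intro sum.cong refl) auto
    also have "\<dots> \<le> - (a / 2) * (\<Sum>l<n. k ^ (2 * l) * (cmod (y v l))\<^sup>2)"
    proof (rule triangular_dissipative[OF _ aB \<tau> k k2])
      show "B $$ (i, j) = 0" if "i < n" "j < i" for i j using ut car that by auto
    qed
    finally show ?thesis using diagform[OF v] by simp
  qed
  then show ?thesis using that[OF pd, of "a / 2"] a by simp
qed

section \<open>Exponential convergence\<close>

text \<open>The explicit rate is kept because the barrier of \<open>perturbed_lyapunov_upper\<close>
  absorbs a deviation of the coefficients through the integral of its exponential envelope.\<close>

definition exp_conv :: "real \<Rightarrow> (real \<Rightarrow> real) \<Rightarrow> real \<Rightarrow> bool" where
  "exp_conv \<beta> f l \<longleftrightarrow> (\<exists>c. \<forall>t\<ge>0. \<bar>f t - l\<bar> \<le> c * exp (- \<beta> * t))"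

text \<open>For \<open>\<beta> = 0\<close> this says that the entries are bounded.\<close>

definition mat_exp_conv :: "real \<Rightarrow> nat \<Rightarrow> nat \<Rightarrow> (real \<Rightarrow> real mat) \<Rightarrow> real mat \<Rightarrow> bool" where
  "mat_exp_conv \<beta> n m X Y \<longleftrightarrow> Y \<in> carrier_mat n m \<and> (\<forall>t\<ge>0. X t \<in> carrier_mat n m) \<and>
     (\<forall>i<n. \<forall>j<m. exp_conv \<beta> (\<lambda>t. X t $$ (i, j)) (Y $$ (i, j)))"

lemma exp_convE:
  assumes "exp_conv \<beta> f l"
  obtains c where "c \<ge> 0" "\<And>t. t \<ge> 0 \<Longrightarrow> \<bar>f t - l\<bar> \<le> c * exp (- \<beta> * t)"
proof -
  obtain c where c: "\<forall>t\<ge>0. \<bar>f t - l\<bar> \<le> c * exp (- \<beta> * t)" using assms by (auto simp: exp_conv_def)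
  then have "c \<ge> 0" using c[rule_format, of 0] by simp
  then show ?thesis using that c by blast
qed

lemma exp_conv_const: "exp_conv \<beta> (\<lambda>_. l) l"
  unfolding exp_conv_def by (rule exI[of _ 0]) simp

lemma exp_conv_cong:
  assumes "exp_conv \<beta> f l" "\<And>t. t \<ge> 0 \<Longrightarrow> f t = g t"
  shows "exp_conv \<beta> g l"
  using assms by (simp add: exp_conv_def)

lemma exp_conv_mono:
  assumes "exp_conv \<beta> f l" "\<gamma> \<le> \<beta>"
  shows "exp_conv \<gamma> f l"
proof -
  obtain c where c: "c \<ge> 0" "\<And>t. t \<ge> 0 \<Longrightarrow> \<bar>f t - l\<bar> \<le> c * exp (- \<beta> * t)"
    using exp_convE[OF assms(1)] by blast
  have "\<bar>f t - l\<bar> \<le> c * exp (- \<gamma> * t)" if "t \<ge> 0" for t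
  proof -
    have "c * exp (- \<beta> * t) \<le> c * exp (- \<gamma> * t)"
      using c assms(2) that by (intro mult_left_mono) (auto intro: mult_right_mono)
    with c(2)[OF that] show ?thesis by linarith
  qed
  then show ?thesis by (auto simp: exp_conv_def)
qed

lemma exp_conv_add:
  assumes "exp_conv \<beta> f l" "exp_conv \<beta> g m"
  shows "exp_conv \<beta> (\<lambda>t. f t + g t) (l + m)"
proof -
  obtain c where c: "\<And>t. t \<ge> 0 \<Longrightarrow> \<bar>f t - l\<bar> \<le> c * exp (- \<beta> * t)"
    using exp_convE[OF assms(1)] by blast
  obtain d where d: "\<And>t. t \<ge> 0 \<Longrightarrow> \<bar>g t - m\<bar> \<le> d * exp (- \<beta> * t)"
    using exp_convE[OF assms(2)] by blast
  have "\<bar>f t + g t - (l + m)\<bar> \<le> (c + d) * exp (- \<beta> * t)" if "t \<ge> 0" for t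
    using c[OF that] d[OF that] by (simp add: distrib_right)
  then show ?thesis by (auto simp: exp_conv_def)
qed

lemma exp_conv_mult:
  assumes "exp_conv \<beta> f l" "exp_conv \<beta> g m" "\<beta> \<ge> 0"
  shows "exp_conv \<beta> (\<lambda>t. f t * g t) (l * m)"
proof -
  obtain c where c: "c \<ge> 0" "\<And>t. t \<ge> 0 \<Longrightarrow> \<bar>f t - l\<bar> \<le> c * exp (- \<beta> * t)"
    using exp_convE[OF assms(1)] by blast
  obtain d where d: "d \<ge> 0" "\<And>t. t \<ge> 0 \<Longrightarrow> \<bar>g t - m\<bar> \<le> d * exp (- \<beta> * t)"
    using exp_convE[OF assms(2)] by blast
  have "\<bar>f t * g t - l * m\<bar> \<le> (c * (\<bar>m\<bar> + d) + \<bar>l\<bar> * d) * exp (- \<beta> * t)" if t: "t \<ge> 0" for t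
  proof -
    have "exp (- \<beta> * t) \<le> 1" using assms(3) t by simp
    then have "d * exp (- \<beta> * t) \<le> d" using d(1) mult_left_le by blast
    then have "\<bar>g t\<bar> \<le> \<bar>m\<bar> + d" using d(2)[OF t] by linarith
    then have "\<bar>f t - l\<bar> * \<bar>g t\<bar> \<le> (c * exp (- \<beta> * t)) * (\<bar>m\<bar> + d)"
      using c t by (intro mult_mono) auto
    moreover have "\<bar>l\<bar> * \<bar>g t - m\<bar> \<le> \<bar>l\<bar> * (d * exp (- \<beta> * t))"
      using d(2)[OF t] by (intro mult_left_mono) auto
    moreover have "f t * g t - l * m = (f t - l) * g t + l * (g t - m)" by (simp add: algebra_simps)
    then have "\<bar>f t * g t - l * m\<bar> \<le> \<bar>f t - l\<bar> * \<bar>g t\<bar> + \<bar>l\<bar> * \<bar>g t - m\<bar>"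
      by (metis abs_mult abs_triangle_ineq)
    ultimately have "\<bar>f t * g t - l * m\<bar> \<le> (c * exp (- \<beta> * t)) * (\<bar>m\<bar> + d) + \<bar>l\<bar> * (d * exp (- \<beta> * t))"
      by linarith
    then show ?thesis by (simp add: algebra_simps)
  qed
  then show ?thesis by (auto simp: exp_conv_def)
qed

lemma exp_conv_diff:
  assumes "exp_conv \<beta> f l" "exp_conv \<beta> g m"
  shows "exp_conv \<beta> (\<lambda>t. f t - g t) (l - m)"
proof -
  have "exp_conv \<beta> (\<lambda>t. - g t) (- m)"
    using assms(2) by (simp add: exp_conv_def abs_minus_commute)
  from exp_conv_add[OF assms(1) this] show ?thesis by simp
qed

lemma exp_conv_sum:
  assumes "\<And>i. i \<in> I \<Longrightarrow> exp_conv \<beta> (f i) (l i)"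
  shows "exp_conv \<beta> (\<lambda>t. \<Sum>i\<in>I. f i t) (\<Sum>i\<in>I. l i)"
  using assms by (induction I rule: infinite_finite_induct) (auto intro: exp_conv_const exp_conv_add)

lemma exp_conv_tendsto:
  assumes "exp_conv \<beta> f l" "\<beta> > 0"
  shows "(f \<longlongrightarrow> l) at_top"
proof -
  obtain c where c: "c \<ge> 0" "\<And>t. t \<ge> 0 \<Longrightarrow> \<bar>f t - l\<bar> \<le> c * exp (- \<beta> * t)"
    using exp_convE[OF assms(1)] by blast
  have "LIM t at_top. - \<beta> * t :> at_bot"
    by (rule filterlim_tendsto_neg_mult_at_bot[OF tendsto_const _ filterlim_ident]) (use assms(2) in simp)
  then have lim: "((\<lambda>t. c * exp (- \<beta> * t)) \<longlongrightarrow> c * 0) at_top"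
    by (intro tendsto_mult tendsto_const filterlim_compose[OF exp_at_bot])
  have "((\<lambda>t. f t - l) \<longlongrightarrow> 0) at_top"
  proof (rule Lim_null_comparison)
    show "((\<lambda>t. c * exp (- \<beta> * t)) \<longlongrightarrow> 0) at_top" using lim by simp
    show "\<forall>\<^sub>F t in at_top. norm (f t - l) \<le> c * exp (- \<beta> * t)"
      unfolding eventually_at_top_linorder using c(2) by (intro exI[of _ 0]) simp
  qed
  then show ?thesis by (simp add: LIM_zero_iff)
qed

lemma mat_exp_conv_const: "M \<in> carrier_mat n m \<Longrightarrow> mat_exp_conv \<beta> n m (\<lambda>_. M) M"
  by (simp add: mat_exp_conv_def exp_conv_const)

lemma mat_exp_conv_mono: "mat_exp_conv \<beta> n m X Y \<Longrightarrow> \<gamma> \<le> \<beta> \<Longrightarrow> mat_exp_conv \<gamma> n m X Y"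
  by (auto simp: mat_exp_conv_def intro: exp_conv_mono)

lemma mat_exp_conv_add:
  assumes "mat_exp_conv \<beta> n m X X0" "mat_exp_conv \<beta> n m Y Y0"
  shows "mat_exp_conv \<beta> n m (\<lambda>t. X t + Y t) (X0 + Y0)"
  unfolding mat_exp_conv_def
proof (intro conjI allI impI)
  note d = assms[unfolded mat_exp_conv_def]
  show "X0 + Y0 \<in> carrier_mat n m" "\<And>t. 0 \<le> t \<Longrightarrow> X t + Y t \<in> carrier_mat n m" using d by auto
  fix i j assume ij: "i < n" "j < m"
  then have "exp_conv \<beta> (\<lambda>t. X t $$ (i, j) + Y t $$ (i, j)) (X0 $$ (i, j) + Y0 $$ (i, j))"
    using d by (intro exp_conv_add) auto
  moreover have "(X0 + Y0) $$ (i, j) = X0 $$ (i, j) + Y0 $$ (i, j)" using d ij by auto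
  moreover have "X t $$ (i, j) + Y t $$ (i, j) = (X t + Y t) $$ (i, j)" if "t \<ge> 0" for t using d ij that by auto
  ultimately show "exp_conv \<beta> (\<lambda>t. (X t + Y t) $$ (i, j)) ((X0 + Y0) $$ (i, j))"
    by (metis (no_types, lifting) exp_conv_cong)
qed

lemma mat_exp_conv_diff:
  assumes "mat_exp_conv \<beta> n m X X0" "mat_exp_conv \<beta> n m Y Y0"
  shows "mat_exp_conv \<beta> n m (\<lambda>t. X t - Y t) (X0 - Y0)"
  unfolding mat_exp_conv_def
proof (intro conjI allI impI)
  note d = assms[unfolded mat_exp_conv_def]
  show "X0 - Y0 \<in> carrier_mat n m" "\<And>t. 0 \<le> t \<Longrightarrow> X t - Y t \<in> carrier_mat n m"
    using d by (simp_all add: minus_carrier_mat)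
  fix i j assume ij: "i < n" "j < m"
  then have "exp_conv \<beta> (\<lambda>t. X t $$ (i, j) - Y t $$ (i, j)) (X0 $$ (i, j) - Y0 $$ (i, j))"
    using d by (intro exp_conv_diff) auto
  moreover have "(X0 - Y0) $$ (i, j) = X0 $$ (i, j) - Y0 $$ (i, j)" using d ij by auto
  moreover have "X t $$ (i, j) - Y t $$ (i, j) = (X t - Y t) $$ (i, j)" if "t \<ge> 0" for t using d ij that by auto
  ultimately show "exp_conv \<beta> (\<lambda>t. (X t - Y t) $$ (i, j)) ((X0 - Y0) $$ (i, j))"
    by (metis (no_types, lifting) exp_conv_cong)
qed

lemma mat_exp_conv_transpose:
  assumes "mat_exp_conv \<beta> n m X X0"
  shows "mat_exp_conv \<beta> m n (\<lambda>t. (X t)\<^sup>T) (X0\<^sup>T)"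
  unfolding mat_exp_conv_def
proof (intro conjI allI impI)
  note d = assms[unfolded mat_exp_conv_def]
  show "X0\<^sup>T \<in> carrier_mat m n" "\<And>t. 0 \<le> t \<Longrightarrow> (X t)\<^sup>T \<in> carrier_mat m n" using d by auto
  fix i j assume ij: "i < m" "j < n"
  then have "exp_conv \<beta> (\<lambda>t. X t $$ (j, i)) (X0 $$ (j, i))" using d by auto
  moreover have "X0\<^sup>T $$ (i, j) = X0 $$ (j, i)" using d ij by auto
  moreover have "X t $$ (j, i) = (X t)\<^sup>T $$ (i, j)" if "t \<ge> 0" for t using d ij that by auto
  ultimately show "exp_conv \<beta> (\<lambda>t. (X t)\<^sup>T $$ (i, j)) (X0\<^sup>T $$ (i, j))"
    by (metis (no_types, lifting) exp_conv_cong)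
qed

lemma mat_exp_conv_mult:
  assumes X: "mat_exp_conv \<beta> n m X X0" and Y: "mat_exp_conv \<beta> m k Y Y0" and b: "\<beta> \<ge> 0"
  shows "mat_exp_conv \<beta> n k (\<lambda>t. X t * Y t) (X0 * Y0)"
  unfolding mat_exp_conv_def
proof (intro conjI allI impI)
  note d = X[unfolded mat_exp_conv_def] Y[unfolded mat_exp_conv_def]
  show "X0 * Y0 \<in> carrier_mat n k" "\<And>t. 0 \<le> t \<Longrightarrow> X t * Y t \<in> carrier_mat n k" using d by auto
  fix i j assume ij: "i < n" "j < k"
  have entry: "(M * N) $$ (i, j) = (\<Sum>l<m. M $$ (i, l) * N $$ (l, j))"
    if "M \<in> carrier_mat n m" "N \<in> carrier_mat m k" for M N :: "real mat"
    using that ij by (simp add: scalar_prod_def atLeast0LessThan)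
  have "exp_conv \<beta> (\<lambda>t. \<Sum>l<m. X t $$ (i, l) * Y t $$ (l, j)) (\<Sum>l<m. X0 $$ (i, l) * Y0 $$ (l, j))"
    using d ij b by (intro exp_conv_sum exp_conv_mult) auto
  then show "exp_conv \<beta> (\<lambda>t. (X t * Y t) $$ (i, j)) ((X0 * Y0) $$ (i, j))"
    using d by (auto simp: entry intro: exp_conv_cong)
qed

lemma mat_exp_convE:
  assumes "mat_exp_conv \<beta> n m X Y"
  obtains c where "c \<ge> 0"
    "\<And>t i j. t \<ge> 0 \<Longrightarrow> i < n \<Longrightarrow> j < m \<Longrightarrow> \<bar>X t $$ (i, j) - Y $$ (i, j)\<bar> \<le> c * exp (- \<beta> * t)"
proof -
  have "\<exists>c\<ge>0. \<forall>t\<ge>0. \<bar>X t $$ p - Y $$ p\<bar> \<le> c * exp (- \<beta> * t)" if "p \<in> {..<n} \<times> {..<m}" for p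
  proof -
    have "exp_conv \<beta> (\<lambda>t. X t $$ p) (Y $$ p)" using assms that by (auto simp: mat_exp_conv_def)
    then show ?thesis by (metis exp_convE)
  qed
  then obtain f where f: "\<And>p. p \<in> {..<n} \<times> {..<m} \<Longrightarrow> f p \<ge> 0"
    "\<And>p t. p \<in> {..<n} \<times> {..<m} \<Longrightarrow> t \<ge> 0 \<Longrightarrow> \<bar>X t $$ p - Y $$ p\<bar> \<le> f p * exp (- \<beta> * t)"
    by metis
  define c where "c = (\<Sum>p\<in>{..<n} \<times> {..<m}. f p)"
  have "\<bar>X t $$ (i, j) - Y $$ (i, j)\<bar> \<le> c * exp (- \<beta> * t)" if "t \<ge> 0" "i < n" "j < m" for t i j
  proof -
    have "f (i, j) \<le> c" unfolding c_def using that f(1) by (intro member_le_sum) auto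
    then have "f (i, j) * exp (- \<beta> * t) \<le> c * exp (- \<beta> * t)" by (intro mult_right_mono) auto
    moreover have "\<bar>X t $$ (i, j) - Y $$ (i, j)\<bar> \<le> f (i, j) * exp (- \<beta> * t)"
      using f(2)[of "(i, j)" t] that by simp
    ultimately show ?thesis by (rule order_trans[rotated])
  qed
  moreover have "c \<ge> 0" unfolding c_def using f(1) by (intro sum_nonneg)
  ultimately show ?thesis using that by blast
qed

lemma mat_exp_conv_boundE:
  assumes "mat_exp_conv \<beta> n m X Y" "\<beta> \<ge> 0"
  obtains c where "c \<ge> 0" "\<And>t i j. t \<ge> 0 \<Longrightarrow> i < n \<Longrightarrow> j < m \<Longrightarrow> \<bar>X t $$ (i, j)\<bar> \<le> c"
proof -
  obtain c where c: "c \<ge> 0"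
    "\<And>t i j. t \<ge> 0 \<Longrightarrow> i < n \<Longrightarrow> j < m \<Longrightarrow> \<bar>X t $$ (i, j) - Y $$ (i, j)\<bar> \<le> c * exp (- 0 * t)"
    using mat_exp_convE[OF mat_exp_conv_mono[OF assms]] by metis
  define y where "y = (\<Sum>p\<in>{..<n} \<times> {..<m}. \<bar>Y $$ p\<bar>)"
  have y: "y \<ge> 0" unfolding y_def by (intro sum_nonneg) auto
  have "\<bar>X t $$ (i, j)\<bar> \<le> y + c" if "t \<ge> 0" "i < n" "j < m" for t i j
  proof -
    have "\<bar>Y $$ (i, j)\<bar> \<le> y"
      unfolding y_def using that by (intro member_le_sum[where f = "\<lambda>p. \<bar>Y $$ p\<bar>"]) auto
    then show ?thesis using c(2)[OF that] by simp
  qed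
  then show ?thesis using that[of "y + c"] c y by simp
qed

text \<open>Polarisation with two unit vectors and their sum leads back from forms to entries. The
  argument yields \<open>2 * b\<close>; the constant 3 is generous.\<close>

lemma entry_le_quadform:
  fixes M :: "real mat"
  assumes M: "M \<in> carrier_mat n n" "M\<^sup>T = M"
    and b: "\<And>v. v \<in> carrier_vec n \<Longrightarrow> \<bar>qform M v\<bar> \<le> b * (v \<bullet> v)" "b \<ge> 0"
    and ij: "i < n" "j < n"
  shows "\<bar>M $$ (i, j)\<bar> \<le> 3 * b"
proof -
  have entry: "unit_vec n k \<bullet> (M *\<^sub>v unit_vec n l) = M $$ (k, l)" if "k < n" "l < n" for k l
    using M(1) that by (simp add: scalar_prod_left_unit[of _ n] scalar_prod_right_unit)
  have diag: "\<bar>M $$ (k, k)\<bar> \<le> b" if "k < n" for k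
    using b(1)[of "unit_vec n k"] entry[OF that that] that by (simp add: scalar_prod_left_unit[of _ n])
  have sym: "M $$ (j, i) = M $$ (i, j)" using M ij by (metis carrier_matD index_transpose_mat(1))
  show ?thesis
  proof (cases "i = j")
    case True
    then show ?thesis using diag[OF ij(1)] b(2) by simp
  next
    case False
    let ?u = "unit_vec n i :: real vec" and ?w = "unit_vec n j :: real vec"
    have "qform M (?u + ?w) = M $$ (i, i) + M $$ (i, j) + (M $$ (j, i) + M $$ (j, j))"
      using M(1) entry ij
      by (simp add: mult_add_distrib_mat_vec[OF M(1)] add_scalar_prod_distrib[where n=n] scalar_prod_add_distrib[where n=n])
    moreover have "(?u + ?w) \<bullet> (?u + ?w) = 2"
      using ij False by (simp add: add_scalar_prod_distrib[where n=n] scalar_prod_add_distrib[where n=n] scalar_prod_left_unit[of _ n])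
    ultimately have "\<bar>M $$ (i, i) + 2 * M $$ (i, j) + M $$ (j, j)\<bar> \<le> b * 2"
      using b(1)[of "?u + ?w"] sym by (simp add: algebra_simps)
    then show ?thesis using diag[OF ij(1)] diag[OF ij(2)] by linarith
  qed
qed

section \<open>Riccati and Lyapunov differential equations\<close>

text \<open>Freezing time at \<open>T\<close> expresses boundedness on a compact interval as
  convergence with rate 0, so that products and differences are covered by the closure rules above.
  At that rate the reference matrix 0 is an arbitrary choice.\<close>

lemma mat_continuous_bounded:
  assumes X: "has_mat_deriv_on_nonneg X X' n m" and T: "T \<ge> 0"
  shows "mat_exp_conv 0 n m (\<lambda>t. X (min t T)) (0\<^sub>m n m)"
  unfolding mat_exp_conv_def
proof (intro conjI allI impI)
  note d = X[unfolded has_mat_deriv_on_nonneg_def, rule_format]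
  show "\<And>t. 0 \<le> t \<Longrightarrow> X (min t T) \<in> carrier_mat n m" using d T by (simp add: min_def)
  fix i j assume ij: "i < n" "j < m"
  have "continuous_on {0..} (\<lambda>t. X t $$ (i, j))"
    using d ij by (auto simp: continuous_on_eq_continuous_within intro!: DERIV_continuous)
  then have "continuous_on {0..T} (\<lambda>t. X t $$ (i, j))" by (rule continuous_on_subset) auto
  then have "bounded ((\<lambda>t. X t $$ (i, j)) ` {0..T})"
    by (intro compact_imp_bounded compact_continuous_image) auto
  then obtain b where "\<forall>t\<in>{0..T}. \<bar>X t $$ (i, j)\<bar> \<le> b" by (auto simp: bounded_iff)
  then have "\<bar>X (min t T) $$ (i, j)\<bar> \<le> b" if "t \<ge> 0" for t using that T by simp
  then show "exp_conv 0 (\<lambda>t. X (min t T) $$ (i, j)) (0\<^sub>m n m $$ (i, j))"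
    using ij by (auto simp: exp_conv_def)
qed simp

text \<open>The skew part of \<open>X\<close> solves a homogeneous linear equation with initial
  value 0, hence vanishes. The differential equations come without symmetry of their solutions,
  while the barrier arguments are about symmetric forms. \<open>M\<close> may itself depend on
  \<open>X\<close>; what counts is its boundedness on each compact interval.\<close>

lemma mat_ode_symmetric:
  assumes X: "has_mat_deriv_on_nonneg X X' n n"
    and X0: "(X 0)\<^sup>T = X 0"
    and M: "\<And>t. t \<ge> 0 \<Longrightarrow> M t \<in> carrier_mat n n"
    and eq: "\<And>t. t \<ge> 0 \<Longrightarrow> X' t - (X' t)\<^sup>T =
      M t * (X t - (X t)\<^sup>T) + (X t - (X t)\<^sup>T) * (M t)\<^sup>T"
    and bdd: "\<And>T. T \<ge> 0 \<Longrightarrow> \<exists>L. mat_exp_conv 0 n n (\<lambda>t. M (min t T)) L"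
    and T: "T \<ge> 0"
  shows "(X T)\<^sup>T = X T"
proof -
  note d = X[unfolded has_mat_deriv_on_nonneg_def, rule_format]
  have car: "X t \<in> carrier_mat n n" "X' t \<in> carrier_mat n n" if "t \<ge> 0" for t using d[OF that] by blast+
  obtain m where m: "\<And>t i j. t \<ge> 0 \<Longrightarrow> i < n \<Longrightarrow> j < n \<Longrightarrow> \<bar>M (min t T) $$ (i, j)\<bar> \<le> m"
    using bdd[OF T] mat_exp_conv_boundE[of 0] by (metis order_refl)
  define I where "I = {..<n} \<times> {..<n}"
  define f where "f p t = X t $$ p - X t $$ (snd p, fst p)" for p t
  define f' where "f' p t = X' t $$ p - X' t $$ (snd p, fst p)" for p t
  have "f p T = 0" if p: "p \<in> I" for p
  proof (rule linear_system_zero[of I f f' T "2 * m"])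
    show "finite I" by (simp add: I_def)
    show "(f q has_real_derivative f' q t) (at t within {0..})" if "q \<in> I" "t \<ge> 0" for q t
      unfolding f_def f'_def using d[OF that(2)] that(1) by (intro DERIV_diff) (auto simp: I_def)
    show "f q 0 = 0" if "q \<in> I" for q
    proof -
      have "X 0 $$ q = (X 0)\<^sup>T $$ q" using X0 by simp
      then show ?thesis using car(1)[of 0] that by (auto simp: f_def I_def)
    qed
    show "\<bar>f' q t\<bar> \<le> 2 * m * (\<Sum>p\<in>I. \<bar>f p t\<bar>)" if q: "q \<in> I" and t: "0 \<le> t" "t \<le> T" for q t
    proof -
      obtain i j where ij: "q = (i, j)" "i < n" "j < n" using q by (auto simp: I_def)
      let ?D = "X t - (X t)\<^sup>T"
      have D: "?D \<in> carrier_mat n n" using car(1)[OF t(1)] by (simp add: minus_carrier_mat)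
      have entry: "?D $$ (k, l) = f (k, l) t" if "k < n" "l < n" for k l
        using car(1)[OF t(1)] that by (simp add: f_def)
      have le: "\<bar>f (k, l) t\<bar> \<le> (\<Sum>p\<in>I. \<bar>f p t\<bar>)" if "k < n" "l < n" for k l
        using that by (intro member_le_sum[where f = "\<lambda>p. \<bar>f p t\<bar>"]) (auto simp: I_def)
      have Mt: "\<bar>M t $$ (k, l)\<bar> \<le> m" if "k < n" "l < n" for k l using m[of t k l] t that by simp
      have m0: "m \<ge> 0" using Mt[OF ij(2,3)] by linarith
      have "f' q t = (X' t - (X' t)\<^sup>T) $$ (i, j)"
        using car(2)[OF t(1)] ij by (simp add: f'_def)
      also have "\<dots> = (M t * ?D) $$ (i, j) + (?D * (M t)\<^sup>T) $$ (i, j)"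
        unfolding eq[OF t(1)] using M[OF t(1)] D ij by (subst index_add_mat(1)) auto
      also have "(M t * ?D) $$ (i, j) = (\<Sum>k<n. M t $$ (i, k) * f (k, j) t)"
        using M[OF t(1)] D ij entry by (simp add: scalar_prod_def atLeast0LessThan del: index_minus_mat)
      also have "(?D * (M t)\<^sup>T) $$ (i, j) = (\<Sum>k<n. f (i, k) t * M t $$ (j, k))"
        using M[OF t(1)] D ij entry by (simp add: scalar_prod_def atLeast0LessThan del: index_minus_mat)
      finally have f': "f' q t = (\<Sum>k<n. M t $$ (i, k) * f (k, j) t) + (\<Sum>k<n. f (i, k) t * M t $$ (j, k))" .
      have "\<bar>\<Sum>k<n. M t $$ (i, k) * f (k, j) t\<bar> \<le> (\<Sum>k<n. m * \<bar>f (k, j) t\<bar>)"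
        using Mt ij by (intro order_trans[OF sum_abs] sum_mono) (auto simp: abs_mult intro: mult_right_mono)
      also have "\<dots> = m * (\<Sum>p\<in>(\<lambda>k. (k, j)) ` {..<n}. \<bar>f p t\<bar>)"
        by (subst sum.reindex) (auto simp: inj_on_def sum_distrib_left)
      also have "\<dots> \<le> m * (\<Sum>p\<in>I. \<bar>f p t\<bar>)"
        using m0 ij by (intro mult_left_mono sum_mono2) (auto simp: I_def)
      finally have 1: "\<bar>\<Sum>k<n. M t $$ (i, k) * f (k, j) t\<bar> \<le> m * (\<Sum>p\<in>I. \<bar>f p t\<bar>)" .
      have "\<bar>\<Sum>k<n. f (i, k) t * M t $$ (j, k)\<bar> \<le> (\<Sum>k<n. m * \<bar>f (i, k) t\<bar>)"
        using Mt ij by (intro order_trans[OF sum_abs] sum_mono) (auto simp: abs_mult mult.commute[of m] intro: mult_left_mono)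
      also have "\<dots> = m * (\<Sum>p\<in>(\<lambda>k. (i, k)) ` {..<n}. \<bar>f p t\<bar>)"
        by (subst sum.reindex) (auto simp: inj_on_def sum_distrib_left)
      also have "\<dots> \<le> m * (\<Sum>p\<in>I. \<bar>f p t\<bar>)"
        using m0 ij by (intro mult_left_mono sum_mono2) (auto simp: I_def)
      finally have 2: "\<bar>\<Sum>k<n. f (i, k) t * M t $$ (j, k)\<bar> \<le> m * (\<Sum>p\<in>I. \<bar>f p t\<bar>)" .
      show ?thesis unfolding f' using 1 2 by linarith
    qed
  qed (use T p in auto)
  then have "X T $$ (j, i) = X T $$ (i, j)" if "i < n" "j < n" for i j
    using that by (force simp: I_def f_def)
  then show ?thesis using car(1)[OF T] by (intro eq_matI) auto
qed

section \<open>The Riccati differential equation: symmetry, barriers, convergence\<close>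

lemma quadform_dominated:
  fixes M P :: "real mat"
  assumes M: "M \<in> carrier_mat n n" and P: "pos_def n P"
  obtains k where "k > 0" "\<And>v. v \<in> carrier_vec n \<Longrightarrow> qform M v \<le> k * qform P v"
proof -
  obtain e where e: "e > 0" "\<And>v. v \<in> carrier_vec n \<Longrightarrow> qform P v \<ge> e * (v \<bullet> v)"
    using quadform_lower_bound[of P n] P by (auto simp: pos_def_def)
  obtain k where k: "k > 0" "\<And>v. v \<in> carrier_vec n \<Longrightarrow> qform M v \<le> k * (v \<bullet> v)"
    using quadform_upper_bound[OF M] by blast
  have "qform M v \<le> k / e * qform P v" if "v \<in> carrier_vec n" for v
  proof -
    have "qform M v \<le> k / e * (e * (v \<bullet> v))" using k(2)[OF that] e by simp
    also have "\<dots> \<le> k / e * qform P v" using e(2)[OF that] e(1) k(1) by (intro mult_left_mono) auto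
    finally show ?thesis .
  qed
  then show ?thesis using that[of "k / e"] e k by simp
qed

text \<open>The quadratic term factors without symmetry of \<open>R\<close>: adding and subtracting
  \<open>R\<^sup>T * Q * R\<close> splits \<open>R * Q * R - R\<^sup>T * Q * R\<^sup>T\<close> into
  \<open>R\<^sup>T * Q * (R - R\<^sup>T)\<close> and \<open>(R - R\<^sup>T) * Q * R\<close>. This is
  where the transpose in the coefficient comes from.\<close>

lemma riccati_skew_part:
  fixes A R N Q :: "real mat"
  assumes car: "A \<in> carrier_mat n n" "R \<in> carrier_mat n n" "N \<in> carrier_mat n n" "Q \<in> carrier_mat n n"
    and sym: "N\<^sup>T = N" "Q\<^sup>T = Q"
  defines "X \<equiv> A * R + R * A\<^sup>T + N - R * Q * R"
  shows "X - X\<^sup>T = (A - R\<^sup>T * Q) * (R - R\<^sup>T)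
    + (R - R\<^sup>T) * (A - R\<^sup>T * Q)\<^sup>T"
proof -
  define S where "S = R\<^sup>T"
  define B where "B = A\<^sup>T"
  have S: "S \<in> carrier_mat n n" "B \<in> carrier_mat n n" "S\<^sup>T = R" "B\<^sup>T = A"
    using car by (simp_all add: S_def B_def)
  have prods: "R * B \<in> carrier_mat n n" "A * R \<in> carrier_mat n n" "S * B \<in> carrier_mat n n" "A * S \<in> carrier_mat n n"
    "Q * R \<in> carrier_mat n n" "S * Q \<in> carrier_mat n n" "R * Q \<in> carrier_mat n n" "R - S \<in> carrier_mat n n"
    "S * Q * R \<in> carrier_mat n n" "S * Q * S \<in> carrier_mat n n" "R * Q * R \<in> carrier_mat n n"
    using car S by (auto intro!: mult_carrier_mat minus_carrier_mat)
  \<comment> \<open>Here \<open>g\<close> is the mixed product that is added and subtracted.\<close>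
  have regroup: "a + b + N - e - (c + d + N - f) = (a - d - (g - f)) + (b - c - (e - g))"
    if "a \<in> carrier_mat n n" "b \<in> carrier_mat n n" "c \<in> carrier_mat n n" "d \<in> carrier_mat n n"
      "e \<in> carrier_mat n n" "f \<in> carrier_mat n n" "g \<in> carrier_mat n n" "N \<in> carrier_mat n n"
    for a b c d e f g N :: "real mat"
    using that by (intro eq_matI) auto
  have "X\<^sup>T = S * B + A * S + N - S * Q * S"
    using car S sym prods
    by (simp add: X_def transpose_minus_mat[where n=n and m=n] transpose_add[where nr=n and nc=n] transpose_mult[where nr=n and n=n and nc=n] flip: S_def B_def)
  moreover have "(A - S * Q)\<^sup>T = B - Q * R"
    using car S sym prods
    by (simp add: transpose_minus_mat[where n=n and m=n] transpose_mult[where nr=n and n=n and nc=n] flip: B_def)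
  moreover have "(A - S * Q) * (R - S) = (A * R - A * S) - (S * Q * R - S * Q * S)"
    using car S prods by (simp add: minus_mult_distrib_mat[OF car(1) prods(6) prods(8)] mult_minus_distrib_mat[where nr=n and n=n and nc=n])
  moreover have "(R - S) * (B - Q * R) = (R * B - S * B) - (R * Q * R - S * Q * R)"
    using car S prods
    by (simp add: mult_minus_distrib_mat[OF prods(8) S(2) prods(5)] minus_mult_distrib_mat[where nr=n and n=n and nc=n]
      assoc_mult_mat[OF _ car(4) car(2)])
  ultimately show ?thesis
    unfolding S_def[symmetric] X_def B_def[symmetric]
    using regroup[OF prods(2,1,3,4) prods(11,10,9) car(3)] by simp
qed

lemma riccati_quadform:
  fixes A R N Q :: "real mat"
  assumes car: "A \<in> carrier_mat n n" "R \<in> carrier_mat n n" "N \<in> carrier_mat n n" "Q \<in> carrier_mat n n"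
    and sym: "R\<^sup>T = R" and v: "v \<in> carrier_vec n"
  shows "qform (A * R + R * A\<^sup>T + N - R * Q * R) v
    = 2 * (v \<bullet> (A *\<^sub>v (R *\<^sub>v v))) + qform N v - qform Q (R *\<^sub>v v)"
proof -
  have vecs: "R *\<^sub>v v \<in> carrier_vec n" "N *\<^sub>v v \<in> carrier_vec n" "A\<^sup>T *\<^sub>v v \<in> carrier_vec n"
    using car v by auto
  then have vecs2: "A *\<^sub>v (R *\<^sub>v v) \<in> carrier_vec n" "R *\<^sub>v (A\<^sup>T *\<^sub>v v) \<in> carrier_vec n"
    "Q *\<^sub>v (R *\<^sub>v v) \<in> carrier_vec n"
    using car by auto
  then have vecs3: "R *\<^sub>v (Q *\<^sub>v (R *\<^sub>v v)) \<in> carrier_vec n" using car by auto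
  have "(A * R + R * A\<^sup>T + N - R * Q * R) *\<^sub>v v =
      A *\<^sub>v (R *\<^sub>v v) + R *\<^sub>v (A\<^sup>T *\<^sub>v v) + N *\<^sub>v v - R *\<^sub>v (Q *\<^sub>v (R *\<^sub>v v))"
    using car v
    by (simp add: minus_mult_distrib_mat_vec[where nr=n and nc=n] add_mult_distrib_mat_vec[where nr=n and nc=n]
      assoc_mult_mat_vec[where n\<^sub>1=n and n\<^sub>2=n and n\<^sub>3=n])
  then have "qform (A * R + R * A\<^sup>T + N - R * Q * R) v =
      v \<bullet> (A *\<^sub>v (R *\<^sub>v v)) + v \<bullet> (R *\<^sub>v (A\<^sup>T *\<^sub>v v)) + qform N v - v \<bullet> (R *\<^sub>v (Q *\<^sub>v (R *\<^sub>v v)))"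
    using v vecs vecs2 vecs3 by (simp add: scalar_prod_minus_distrib[where n=n] scalar_prod_add_distrib[where n=n])
  moreover have "v \<bullet> (R *\<^sub>v (A\<^sup>T *\<^sub>v v)) = v \<bullet> (A *\<^sub>v (R *\<^sub>v v))"
    using scalar_prod_symmetric_mat[OF car(2) sym v vecs(3)] transpose_vec_mult_scalar[OF car(1) vecs(1) v] by simp
  moreover have "v \<bullet> (R *\<^sub>v (Q *\<^sub>v (R *\<^sub>v v))) = qform Q (R *\<^sub>v v)"
    using transpose_vec_mult_scalar[OF car(2) vecs2(3) v] sym by simp
  ultimately show ?thesis by simp
qed

lemma scaled_vec_simps:
  fixes A :: "real mat"
  assumes "A \<in> carrier_mat n n" "x \<in> carrier_vec n" "z \<in> carrier_vec n"
  shows "A *\<^sub>v (x + c \<cdot>\<^sub>v z) = A *\<^sub>v x + c \<cdot>\<^sub>v (A *\<^sub>v z)"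
  using assms by (simp add: mult_add_distrib_mat_vec[OF assms(1)] mult_mat_vec[OF assms(1)])

lemma quadform_add_scaled:
  fixes Q :: "real mat"
  assumes Q: "Q \<in> carrier_mat n n" "Q\<^sup>T = Q" and x: "x \<in> carrier_vec n" and z: "z \<in> carrier_vec n"
  shows "qform Q (x + c \<cdot>\<^sub>v z)
    = qform Q x + 2 * c * (x \<bullet> (Q *\<^sub>v z)) + c\<^sup>2 * qform Q z"
proof -
  have c: "Q *\<^sub>v x \<in> carrier_vec n" "Q *\<^sub>v z \<in> carrier_vec n" using Q x z by auto
  have "z \<bullet> (Q *\<^sub>v x) = x \<bullet> (Q *\<^sub>v z)" using scalar_prod_symmetric_mat[OF Q z x] .
  then show ?thesis
    using c x z by (simp add: scaled_vec_simps[OF Q(1) x z] add_scalar_prod_distrib[where n=n]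
        scalar_prod_add_distrib[where n=n] power2_eq_square algebra_simps)
qed

text \<open>Subtracting the algebraic equation leaves only terms in the deviation: the cross term of
  the quadratic part turns \<open>A\<close> into the closed loop \<open>A - Rb * Q\<close>. For
  semidefinite \<open>Q\<close> the remainder \<open>- c\<^sup>2 * qform Q z\<close> has a fixed
  sign, so deviations above and below \<open>Rb\<close> behave differently.\<close>

lemma riccati_deviation:
  fixes A R N Q Rb :: "real mat"
  assumes car: "A \<in> carrier_mat n n" "R \<in> carrier_mat n n" "N \<in> carrier_mat n n" "Q \<in> carrier_mat n n"
      "Rb \<in> carrier_mat n n"
    and sym: "R\<^sup>T = R" "Rb\<^sup>T = Rb" "Q\<^sup>T = Q"
    and are: "A * Rb + Rb * A\<^sup>T + N - Rb * Q * Rb = 0\<^sub>m n n"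
    and v: "v \<in> carrier_vec n" and z: "z \<in> carrier_vec n"
    and eq: "R *\<^sub>v v = Rb *\<^sub>v v + c \<cdot>\<^sub>v z"
  shows "qform (A * R + R * A\<^sup>T + N - R * Q * R) v
    = 2 * c * (v \<bullet> ((A - Rb * Q) *\<^sub>v z)) - c\<^sup>2 * qform Q z"
proof -
  define x where "x = Rb *\<^sub>v v"
  have x: "x \<in> carrier_vec n" using car v by (simp add: x_def)
  have Az: "A *\<^sub>v x \<in> carrier_vec n" "A *\<^sub>v z \<in> carrier_vec n" "Q *\<^sub>v z \<in> carrier_vec n" using car x z by auto
  have "0 = qform (0\<^sub>m n n) v" using quadform_zero[OF v] by simp
  also have "\<dots> = 2 * (v \<bullet> (A *\<^sub>v x)) + qform N v - qform Q x"
    unfolding are[symmetric] x_def by (rule riccati_quadform[OF car(1,5,3,4) sym(2) v])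
  finally have zero: "2 * (v \<bullet> (A *\<^sub>v x)) + qform N v = qform Q x" by simp
  have "v \<bullet> (A *\<^sub>v (x + c \<cdot>\<^sub>v z)) = v \<bullet> (A *\<^sub>v x) + c * (v \<bullet> (A *\<^sub>v z))"
    unfolding scaled_vec_simps[OF car(1) x z] using Az v by (simp add: scalar_prod_add_distrib[where n=n])
  moreover have "v \<bullet> (A *\<^sub>v z) = v \<bullet> ((A - Rb * Q) *\<^sub>v z) + x \<bullet> (Q *\<^sub>v z)"
  proof -
    have RQ: "Rb * Q \<in> carrier_mat n n" using car by auto
    have "(A - Rb * Q) *\<^sub>v z = A *\<^sub>v z - Rb *\<^sub>v (Q *\<^sub>v z)"
      using minus_mult_distrib_mat_vec[OF car(1) RQ z] assoc_mult_mat_vec[OF car(5,4) z] by simp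
    moreover have "v \<bullet> (Rb *\<^sub>v (Q *\<^sub>v z)) = x \<bullet> (Q *\<^sub>v z)"
      using transpose_vec_mult_scalar[OF car(5) Az(3) v] sym(2) by (simp add: x_def)
    ultimately show ?thesis using Az v car by (simp add: scalar_prod_minus_distrib[where n=n])
  qed
  ultimately show ?thesis
    unfolding riccati_quadform[OF car(1-4) sym(1) v] eq x_def[symmetric] quadform_add_scaled[OF car(4) sym(3) x z]
    using zero by (simp add: algebra_simps)
qed

lemma riccati_symmetric:
  fixes A N Q :: "real mat" and R :: "real \<Rightarrow> real mat"
  assumes car: "A \<in> carrier_mat n n" "N \<in> carrier_mat n n" "Q \<in> carrier_mat n n"
    and sym: "N\<^sup>T = N" "Q\<^sup>T = Q"
    and ode: "has_mat_deriv_on_nonneg R (\<lambda>t. A * R t + R t * A\<^sup>T + N - R t * Q * R t) n n"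
    and R0: "(R 0)\<^sup>T = R 0" and t: "t \<ge> 0"
  shows "(R t)\<^sup>T = R t"
proof (rule mat_ode_symmetric[OF ode R0 _ _ _ t, where M = "\<lambda>t. A - (R t)\<^sup>T * Q"])
  have R: "R t \<in> carrier_mat n n" if "t \<ge> 0" for t
    using ode that by (auto simp: has_mat_deriv_on_nonneg_def)
  show "A - (R t)\<^sup>T * Q \<in> carrier_mat n n" if "t \<ge> 0" for t
    using car R[OF that] by (auto intro!: minus_carrier_mat mult_carrier_mat)
  show "A * R t + R t * A\<^sup>T + N - R t * Q * R t - (A * R t + R t * A\<^sup>T + N - R t * Q * R t)\<^sup>T =
      (A - (R t)\<^sup>T * Q) * (R t - (R t)\<^sup>T) +
      (R t - (R t)\<^sup>T) * (A - (R t)\<^sup>T * Q)\<^sup>T" if "t \<ge> 0" for t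
    by (rule riccati_skew_part[OF car(1) R[OF that] car(2,3) sym])
  show "\<exists>L. mat_exp_conv 0 n n (\<lambda>t. A - (R (min t T))\<^sup>T * Q) L" if "T \<ge> 0" for T
    using mat_exp_conv_diff[OF mat_exp_conv_const[OF car(1)] mat_exp_conv_mult[OF mat_exp_conv_transpose[OF
        mat_continuous_bounded[OF ode that]] mat_exp_conv_const[OF car(3)] order_refl]] by blast
qed

text \<open>With \<open>P = Rb + \<epsilon> L\<close>, where \<open>L\<close> is a Lyapunov matrix of \<open>A - Rb Q\<close>, the derivative estimate is strict, and for \<open>\<epsilon>\<close> small
  it survives the quadratic term as long as the coefficient \<open>c\<close> stays below \<open>\<theta> < 1\<close>.\<close>

lemma riccati_barrier:
  fixes A N Q Rb :: "real mat"
  assumes car: "A \<in> carrier_mat n n" "N \<in> carrier_mat n n" "Q \<in> carrier_mat n n"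
    and N: "\<And>v. v \<in> carrier_vec n \<Longrightarrow> qform N v \<ge> 0"
    and Q: "Q\<^sup>T = Q" "\<And>v. v \<in> carrier_vec n \<Longrightarrow> qform Q v \<ge> 0"
    and Rb: "pos_def n Rb"
    and are: "A * Rb + Rb * A\<^sup>T + N - Rb * Q * Rb = 0\<^sub>m n n"
    and st: "mat_stable (A - Rb * Q)"
    and \<theta>: "0 < \<theta>" "\<theta> < 1"
  obtains P \<gamma> where "pos_def n P" "\<gamma> > 0"
    "\<And>v. v \<in> carrier_vec n \<Longrightarrow> qform Rb v \<le> qform P v"
    "\<And>v c. v \<in> carrier_vec n \<Longrightarrow> v \<noteq> 0\<^sub>v n \<Longrightarrow> c \<le> \<theta> \<Longrightarrow>
      2 * (v \<bullet> ((A - Rb * Q) *\<^sub>v (P *\<^sub>v v))) + c * qform Q (P *\<^sub>v v) < - \<gamma> * qform P v"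
proof -
  have Rbc: "Rb \<in> carrier_mat n n" "Rb\<^sup>T = Rb" using Rb by (auto simp: pos_def_def)
  define F where "F = A - Rb * Q"
  have F: "F \<in> carrier_mat n n" unfolding F_def using car Rbc by (auto intro!: minus_carrier_mat)
  obtain L \<alpha> where L: "pos_def n L" and \<alpha>: "\<alpha> > 0"
    and diss: "\<And>v. v \<in> carrier_vec n \<Longrightarrow> v \<bullet> (F *\<^sub>v (L *\<^sub>v v)) \<le> - \<alpha> * qform L v"
    using stable_lyapunov[OF F] st unfolding F_def by blast
  have Lc: "L \<in> carrier_mat n n" "L\<^sup>T = L"
    and Lpos: "\<And>v. v \<in> carrier_vec n \<Longrightarrow> v \<noteq> 0\<^sub>v n \<Longrightarrow> qform L v > 0" using L by (auto simp: pos_def_def)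
  have LQL: "L * (Q * L) \<in> carrier_mat n n" using Lc car by auto
  obtain q where q: "q > 0" "\<And>v. v \<in> carrier_vec n \<Longrightarrow> qform (L * (Q * L)) v \<le> q * qform L v"
    using quadform_dominated[OF LQL L] by blast
  have qL: "qform Q (L *\<^sub>v v) \<le> q * qform L v" if v: "v \<in> carrier_vec n" for v
  proof -
    have "(L * (Q * L)) *\<^sub>v v = L *\<^sub>v (Q *\<^sub>v (L *\<^sub>v v))"
      using Lc car v by (simp add: assoc_mult_mat_vec[where n\<^sub>1=n and n\<^sub>2=n and n\<^sub>3=n])
    moreover have "v \<bullet> (L *\<^sub>v (Q *\<^sub>v (L *\<^sub>v v))) = qform Q (L *\<^sub>v v)"
      using transpose_vec_mult_scalar[OF Lc(1) _ v, of "Q *\<^sub>v (L *\<^sub>v v)"] Lc car v by simp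
    ultimately show ?thesis using q(2)[OF v] by simp
  qed
  \<comment> \<open>The weight for completing the square below; it solves
    \<open>K * (1 - \<theta>) = \<theta>\<close>.\<close>
  define K where "K = \<theta> / (1 - \<theta>)"
  have K: "K > 0" using \<theta> by (simp add: K_def)
  \<comment> \<open>Makes the loss \<open>K * \<epsilon>\<^sup>2 * q\<close> equal to
    \<open>\<epsilon> * \<alpha>\<close>, half of the gain \<open>2 * \<epsilon> * \<alpha>\<close>
    contributed by \<open>L\<close>.\<close>
  define \<epsilon> where "\<epsilon> = \<alpha> / (K * q)"
  have \<epsilon>: "\<epsilon> > 0" using \<alpha> K q by (simp add: \<epsilon>_def)
  define P where "P = Rb + \<epsilon> \<cdot>\<^sub>m L"
  have Pc: "P \<in> carrier_mat n n" using Rbc Lc by (simp add: P_def)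
  have Pv: "P *\<^sub>v v = Rb *\<^sub>v v + \<epsilon> \<cdot>\<^sub>v (L *\<^sub>v v)" if "v \<in> carrier_vec n" for v
  proof -
    have "(\<epsilon> \<cdot>\<^sub>m L) *\<^sub>v v = \<epsilon> \<cdot>\<^sub>v (L *\<^sub>v v)"
      using Lc that by (intro eq_vecI) (auto simp: scalar_prod_def sum_distrib_left mult.assoc)
    then show ?thesis using add_mult_distrib_mat_vec[OF Rbc(1) smult_carrier_mat[OF Lc(1)] that] by (simp add: P_def)
  qed
  have vP: "qform P v = qform Rb v + \<epsilon> * qform L v" if "v \<in> carrier_vec n" for v
    using Pv[OF that] that Rbc Lc by (simp add: scalar_prod_add_distrib[where n=n])
  have Ppos: "qform P v > 0" if "v \<in> carrier_vec n" "v \<noteq> 0\<^sub>v n" for v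
  proof -
    have "qform Rb v > 0" using Rb that by (simp add: pos_def_def)
    moreover have "\<epsilon> * qform L v > 0" using Lpos[OF that] \<epsilon> by simp
    ultimately show ?thesis using vP[OF that(1)] by simp
  qed
  have Psym: "P\<^sup>T = P"
  proof (rule eq_matI)
    fix i j assume "i < dim_row P" "j < dim_col P"
    then have ij: "i < n" "j < n" using Pc by auto
    have "Rb $$ (j, i) = Rb $$ (i, j)" using Rbc ij by (metis carrier_matD index_transpose_mat(1))
    moreover have "L $$ (j, i) = L $$ (i, j)" using Lc ij by (metis carrier_matD index_transpose_mat(1))
    ultimately show "P\<^sup>T $$ (i, j) = P $$ (i, j)" using Rbc Lc ij by (simp add: P_def)
  qed (use Pc in auto)
  have PD: "pos_def n P" using Pc Psym Ppos by (simp add: pos_def_def)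
  obtain g where g: "g > 0" "\<And>v. v \<in> carrier_vec n \<Longrightarrow> qform P v \<le> g * qform L v"
    using quadform_dominated[OF Pc L] by blast
  \<comment> \<open>Half of the remaining gain, converted from \<open>L\<close> to \<open>P\<close>
    by \<open>g\<close>; the other half makes the final inequality strict.\<close>
  define \<gamma> where "\<gamma> = \<epsilon> * \<alpha> / (2 * g)"
  have \<gamma>: "\<gamma> > 0" using \<epsilon> \<alpha> g by (simp add: \<gamma>_def)
  have main: "2 * (v \<bullet> (F *\<^sub>v (P *\<^sub>v v))) + c * qform Q (P *\<^sub>v v) < - \<gamma> * qform P v"
    if v: "v \<in> carrier_vec n" "v \<noteq> 0\<^sub>v n" and c: "c \<le> \<theta>" for v c
  proof -
    define x where "x = Rb *\<^sub>v v"
    define y where "y = L *\<^sub>v v"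
    define l where "l = qform L v"
    have x: "x \<in> carrier_vec n" and y: "y \<in> carrier_vec n" using Rbc Lc v by (auto simp: x_def y_def)
    have l: "l > 0" using Lpos[OF v] by (simp add: l_def)
    have z: "P *\<^sub>v v = x + \<epsilon> \<cdot>\<^sub>v y" using Pv[OF v(1)] by (simp add: x_def y_def)
    have Fxy: "F *\<^sub>v x \<in> carrier_vec n" "F *\<^sub>v y \<in> carrier_vec n" using F x y by auto
    define a where "a = qform Q x"
    define b where "b = x \<bullet> (Q *\<^sub>v y)"
    define d where "d = qform Q y"
    have zQz: "qform Q (P *\<^sub>v v) = a + 2 * \<epsilon> * b + \<epsilon>\<^sup>2 * d"
      unfolding z a_def b_def d_def by (rule quadform_add_scaled[OF car(3) Q(1) x y])
    \<comment> \<open>By the algebraic equation \<open>Rb\<close> alone already dissipates, though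
      possibly not strictly; its term \<open>- a\<close> pays for the \<open>x\<close> part of the
      quadratic term.\<close>
    have Fx: "2 * (v \<bullet> (F *\<^sub>v x)) = - qform N v - a"
    proof -
      have "v \<bullet> (F *\<^sub>v x) = v \<bullet> (A *\<^sub>v x) - a"
      proof -
        have RQ: "Rb * Q \<in> carrier_mat n n" using car Rbc by auto
        have Qx: "Q *\<^sub>v x \<in> carrier_vec n" using car x by auto
        have "F *\<^sub>v x = A *\<^sub>v x - Rb *\<^sub>v (Q *\<^sub>v x)"
          using minus_mult_distrib_mat_vec[OF car(1) RQ x] assoc_mult_mat_vec[OF Rbc(1) car(3) x] by (simp add: F_def)
        moreover have "v \<bullet> (Rb *\<^sub>v (Q *\<^sub>v x)) = qform Q x"
          using transpose_vec_mult_scalar[OF Rbc(1) Qx v(1)] Rbc(2) by (simp add: x_def)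
        ultimately show ?thesis using Qx v car Rbc x by (simp add: scalar_prod_minus_distrib[where n=n] a_def)
      qed
      moreover have "0 = 2 * (v \<bullet> (A *\<^sub>v x)) + qform N v - a"
        using riccati_quadform[OF car(1) Rbc(1) car(2,3) Rbc(2) v(1)] quadform_zero[OF v(1)]
        unfolding are by (simp add: x_def a_def)
      ultimately show ?thesis by simp
    qed
    have vFz: "2 * (v \<bullet> (F *\<^sub>v (P *\<^sub>v v))) = - qform N v - a + 2 * \<epsilon> * (v \<bullet> (F *\<^sub>v y))"
      unfolding z scaled_vec_simps[OF F x y] using Fxy v Fx by (simp add: scalar_prod_add_distrib[where n=n])
    have "v \<bullet> (F *\<^sub>v y) \<le> - \<alpha> * l" using diss[OF v(1)] by (simp add: y_def l_def)
    then have t1: "2 * \<epsilon> * (v \<bullet> (F *\<^sub>v y)) \<le> 2 * \<epsilon> * (- \<alpha> * l)" using \<epsilon> by (intro mult_left_mono) auto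
    have d: "d \<le> q * l" using qL[OF v(1)] by (simp add: d_def y_def l_def)
    have "c * qform Q (P *\<^sub>v v) \<le> \<theta> * qform Q (P *\<^sub>v v)"
      using c Q(2)[of "P *\<^sub>v v"] Pc v by (intro mult_right_mono) auto
    also have "\<dots> \<le> a + K * \<epsilon>\<^sup>2 * d"
    proof -
      have K\<theta>: "K * (1 - \<theta>) = \<theta>" using \<theta> by (simp add: K_def)
      \<comment> \<open>Nonnegativity of \<open>Q\<close> at this combination, scaled by
        \<open>1 - \<theta>\<close>, trades the cross term
        \<open>2 * \<theta> * \<epsilon> * b\<close> for \<open>(1 - \<theta>) * a\<close>, which
        completes the coefficient of \<open>a\<close> to exactly 1.\<close>
      define s where "s = - (K * \<epsilon>)"
      have "0 \<le> qform Q (x + s \<cdot>\<^sub>v y)" using Q(2)[of "x + s \<cdot>\<^sub>v y"] x y by simp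
      also have "\<dots> = a + 2 * s * b + s\<^sup>2 * d"
        unfolding a_def b_def d_def by (rule quadform_add_scaled[OF car(3) Q(1) x y])
      finally have "0 \<le> (1 - \<theta>) * (a + 2 * s * b + s\<^sup>2 * d)" using \<theta> by simp
      also have "\<dots> = (1 - \<theta>) * a - 2 * (K * (1 - \<theta>)) * \<epsilon> * b + (K * (1 - \<theta>)) * K * \<epsilon>\<^sup>2 * d"
        by (simp add: s_def power2_eq_square algebra_simps)
      also have "\<dots> = (1 - \<theta>) * a - 2 * \<theta> * \<epsilon> * b + \<theta> * K * \<epsilon>\<^sup>2 * d" unfolding K\<theta> ..
      finally have "\<theta> * (a + 2 * \<epsilon> * b + \<epsilon>\<^sup>2 * d) \<le> a + (\<theta> + \<theta> * K) * \<epsilon>\<^sup>2 * d"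
        by (simp add: algebra_simps)
      also have "\<theta> + \<theta> * K = K" using K\<theta> by (simp add: algebra_simps)
      finally show ?thesis using zQz by simp
    qed
    also have "K * \<epsilon>\<^sup>2 * d \<le> K * \<epsilon>\<^sup>2 * (q * l)" using d K by (intro mult_left_mono) auto
    also have "K * \<epsilon>\<^sup>2 * (q * l) = \<epsilon> * \<alpha> * l" using K q by (simp add: \<epsilon>_def power2_eq_square)
    finally have t2: "c * qform Q (P *\<^sub>v v) \<le> a + \<epsilon> * \<alpha> * l" by simp
    have "\<gamma> * qform P v \<le> \<gamma> * (g * l)" using g(2)[OF v(1)] \<gamma> by (simp add: l_def)
    also have "\<dots> = \<epsilon> * \<alpha> * l / 2" using g by (simp add: \<gamma>_def)
    also have "\<dots> < \<epsilon> * \<alpha> * l" using \<epsilon> \<alpha> l by simp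
    finally show ?thesis using vFz t1 t2 N[OF v(1)] by (simp add: algebra_simps)
  qed
  have "qform Rb v \<le> qform P v" if v: "v \<in> carrier_vec n" for v
    unfolding vP[OF v] using Lpos[OF v] \<epsilon> Lc v by (cases "v = 0\<^sub>v n") (auto intro: less_imp_le)
  then show ?thesis using that[OF PD \<gamma> _ main[unfolded F_def]] by blast
qed

text \<open>From above the quadratic term helps, so a barrier of any height decays. From below it
  works against the decay, and \<open>riccati_barrier\<close> tolerates only coefficients up to some
  \<open>\<theta> < 1\<close>; positive definiteness of \<open>R 0\<close> places
  \<open>Rb - R 0\<close> below \<open>\<theta>\<close> times the barrier form.\<close>

lemma riccati_exp_conv:
  fixes A N Q Rb :: "real mat" and R :: "real \<Rightarrow> real mat"
  assumes car: "A \<in> carrier_mat n n" "N \<in> carrier_mat n n" "Q \<in> carrier_mat n n"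
    and N: "N\<^sup>T = N" "\<And>v. v \<in> carrier_vec n \<Longrightarrow> qform N v \<ge> 0"
    and Q: "Q\<^sup>T = Q" "\<And>v. v \<in> carrier_vec n \<Longrightarrow> qform Q v \<ge> 0"
    and Rb: "pos_def n Rb"
    and are: "A * Rb + Rb * A\<^sup>T + N - Rb * Q * Rb = 0\<^sub>m n n"
    and st: "mat_stable (A - Rb * Q)"
    and ode: "has_mat_deriv_on_nonneg R (\<lambda>t. A * R t + R t * A\<^sup>T + N - R t * Q * R t) n n"
    and R0: "pos_def n (R 0)"
  obtains \<beta> where "\<beta> > 0" "mat_exp_conv \<beta> n n R Rb"
proof -
  have Rbc: "Rb \<in> carrier_mat n n" "Rb\<^sup>T = Rb" using Rb by (auto simp: pos_def_def)
  have R: "R t \<in> carrier_mat n n" if "t \<ge> 0" for t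
    using ode that by (auto simp: has_mat_deriv_on_nonneg_def)
  have Rsym: "(R t)\<^sup>T = R t" if "t \<ge> 0" for t
    using riccati_symmetric[OF car N(1) Q(1) ode _ that] R0 by (simp add: pos_def_def)
  define R' where "R' = (\<lambda>t. A * R t + R t * A\<^sup>T + N - R t * Q * R t)"
  have R': "R' t \<in> carrier_mat n n" if "t \<ge> 0" for t
    using ode that by (auto simp: has_mat_deriv_on_nonneg_def R'_def)
  obtain k0 where k0: "k0 > 0" "\<And>v. v \<in> carrier_vec n \<Longrightarrow> qform Rb v \<le> k0 * qform (R 0) v"
    using quadform_dominated[OF Rbc(1) R0] by blast
  \<comment> \<open>Adding 1 makes \<open>1 - 1 / k\<close>, and with it \<open>\<theta>\<close>
    below, positive.\<close>
  define k where "k = k0 + 1"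
  have k: "k > 1" using k0 by (simp add: k_def)
  have R0k: "qform Rb v / k \<le> qform (R 0) v" if v: "v \<in> carrier_vec n" for v
  proof -
    have "qform (R 0) v \<ge> 0" using R0 v by (cases "v = 0\<^sub>v n") (auto simp: pos_def_def intro: less_imp_le)
    then show ?thesis using k0(2)[OF v] k by (simp add: k_def field_simps)
  qed
  \<comment> \<open>Strictly between 1 and \<open>1 - 1 / k\<close>, which bounds the initial
    deficit \<open>Rb - R 0\<close> relative to \<open>Rb\<close>.\<close>
  define \<theta> where "\<theta> = 1 - 1 / (2 * k)"
  have \<theta>: "0 < \<theta>" "\<theta> < 1" using k by (simp_all add: \<theta>_def field_simps)
  obtain P \<gamma> where P: "pos_def n P" and \<gamma>: "\<gamma> > 0"
    and RbP: "\<And>v. v \<in> carrier_vec n \<Longrightarrow> qform Rb v \<le> qform P v"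
    and barrier: "\<And>v c. v \<in> carrier_vec n \<Longrightarrow> v \<noteq> 0\<^sub>v n \<Longrightarrow> c \<le> \<theta> \<Longrightarrow>
      2 * (v \<bullet> ((A - Rb * Q) *\<^sub>v (P *\<^sub>v v))) + c * qform Q (P *\<^sub>v v) < - \<gamma> * qform P v"
    using riccati_barrier[OF car N(2) Q Rb are st \<theta>] by blast
  have Pc: "P \<in> carrier_mat n n" "P\<^sup>T = P"
    and Ppos: "\<And>v. v \<in> carrier_vec n \<Longrightarrow> v \<noteq> 0\<^sub>v n \<Longrightarrow> qform P v > 0" using P by (auto simp: pos_def_def)
  define E where "E = (\<lambda>t. R t - Rb)"
  define D where "D = (\<lambda>t. Rb - R t)"
  have Ed: "has_mat_deriv_on_nonneg E (\<lambda>t. R' t - 0\<^sub>m n n) n n"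
    unfolding E_def R'_def by (rule has_mat_deriv_diff[OF ode has_mat_deriv_const[OF Rbc(1)]])
  have Dd: "has_mat_deriv_on_nonneg D (\<lambda>t. 0\<^sub>m n n - R' t) n n"
    unfolding D_def R'_def by (rule has_mat_deriv_diff[OF has_mat_deriv_const[OF Rbc(1)] ode])
  have Ec: "E t \<in> carrier_mat n n" "(E t)\<^sup>T = E t"
    and Dc: "D t \<in> carrier_mat n n" "(D t)\<^sup>T = D t" if "t \<ge> 0" for t
    using R[OF that] Rsym[OF that] Rbc
    by (auto simp: E_def D_def transpose_minus_mat[where n=n and m=n] intro!: minus_carrier_mat)
  have touch: "qform (R' t) v = 2 * c * (v \<bullet> ((A - Rb * Q) *\<^sub>v (P *\<^sub>v v))) - c\<^sup>2 * qform Q (P *\<^sub>v v)"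
    if "t \<ge> 0" "v \<in> carrier_vec n" "R t *\<^sub>v v = Rb *\<^sub>v v + c \<cdot>\<^sub>v (P *\<^sub>v v)" for t v c
    unfolding R'_def
    by (rule riccati_deviation[OF car(1) R[OF that(1)] car(2,3) Rbc(1) Rsym[OF that(1)] Rbc(2) Q(1) are that(2) _ that(3)])
      (use Pc that in auto)
  obtain e where e: "e > 0" "\<And>v. v \<in> carrier_vec n \<Longrightarrow> qform (E 0) v \<le> e * qform P v"
    using quadform_dominated[OF Ec(1)[OF order_refl] P] by blast
  have der: "((\<lambda>t. c * exp (- \<gamma> * t)) has_real_derivative - \<gamma> * (c * exp (- \<gamma> * t))) (at t within {0..})" for c t
    by (auto intro!: derivative_eq_intros)
  have upper: "qform (E t) v \<le> (e + 1) * exp (- \<gamma> * t) * qform P v"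
    if t: "t \<ge> 0" and v: "v \<in> carrier_vec n" for t v
  proof (rule barrier_comparison[OF Ed Ec(2) Pc der _ _ t v])
    fix v :: "real vec" assume v: "v \<in> carrier_vec n" "v \<noteq> 0\<^sub>v n"
    show "qform (E 0) v < (e + 1) * exp (- \<gamma> * 0) * qform P v"
      using e(2)[OF v(1)] Ppos[OF v] by (simp add: algebra_simps)
    fix t :: real assume t: "t > 0"
    define c where "c = (e + 1) * exp (- \<gamma> * t)"
    have c: "c > 0" using e by (simp add: c_def)
    assume eq: "E t *\<^sub>v v = ((e + 1) * exp (- \<gamma> * t)) \<cdot>\<^sub>v (P *\<^sub>v v)"
    have "R t *\<^sub>v v = Rb *\<^sub>v v + c \<cdot>\<^sub>v (P *\<^sub>v v)"
      unfolding c_def eq[symmetric] using minus_mult_distrib_mat_vec[OF R Rbc(1) v(1), of t] t R[of t] Rbc v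
      by (intro eq_vecI) (auto simp: E_def)
    from touch[OF _ v(1) this] t
    have "qform (R' t) v = c * (2 * (v \<bullet> ((A - Rb * Q) *\<^sub>v (P *\<^sub>v v)))) - c\<^sup>2 * qform Q (P *\<^sub>v v)" by simp
    also have "\<dots> \<le> c * (2 * (v \<bullet> ((A - Rb * Q) *\<^sub>v (P *\<^sub>v v))))"
      using Q(2)[of "P *\<^sub>v v"] Pc v by simp
    \<comment> \<open>The quadratic term has been discarded, so \<open>riccati_barrier\<close> is
      used with coefficient 0, admissible whatever the height \<open>c\<close> of the
      barrier.\<close>
    also have "\<dots> < c * (- \<gamma> * qform P v)"
      using barrier[OF v, of 0] \<theta> c by (intro mult_strict_left_mono) auto
    finally show "qform (R' t - 0\<^sub>m n n) v < - \<gamma> * ((e + 1) * exp (- \<gamma> * t)) * qform P v"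
      using quadform_minus[OF R' zero_carrier_mat v(1), of t] quadform_zero[OF v(1)] t
      by (simp add: c_def algebra_simps)
  qed
  have lower: "qform (D t) v \<le> \<theta> * exp (- \<gamma> * t) * qform P v"
    if t: "t \<ge> 0" and v: "v \<in> carrier_vec n" for t v
  proof (rule barrier_comparison[OF Dd Dc(2) Pc der _ _ t v])
    fix v :: "real vec" assume v: "v \<in> carrier_vec n" "v \<noteq> 0\<^sub>v n"
    have "qform (D 0) v = qform Rb v - qform (R 0) v"
      using quadform_minus[OF Rbc(1) R v(1), of 0] by (simp add: D_def)
    also have "\<dots> \<le> (1 - 1 / k) * qform Rb v" using R0k[OF v(1)] by (simp add: algebra_simps)
    also have "\<dots> \<le> (1 - 1 / k) * qform P v" using RbP[OF v(1)] k by (intro mult_left_mono) auto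
    also have "\<dots> < \<theta> * qform P v"
      using Ppos[OF v] k by (intro mult_strict_right_mono) (auto simp: \<theta>_def field_simps)
    finally show "qform (D 0) v < \<theta> * exp (- \<gamma> * 0) * qform P v" by simp
    fix t :: real assume t: "t > 0"
    define c where "c = \<theta> * exp (- \<gamma> * t)"
    have c: "c > 0" "c \<le> \<theta>" using \<theta> \<gamma> t by (simp_all add: c_def)
    assume eq: "D t *\<^sub>v v = (\<theta> * exp (- \<gamma> * t)) \<cdot>\<^sub>v (P *\<^sub>v v)"
    have "R t *\<^sub>v v = Rb *\<^sub>v v + (- c) \<cdot>\<^sub>v (P *\<^sub>v v)"
    proof (rule eq_vecI)
      fix i assume "i < dim_vec (Rb *\<^sub>v v + (- c) \<cdot>\<^sub>v (P *\<^sub>v v))"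
      then have i: "i < n" using Pc by simp
      have "(D t *\<^sub>v v) $ i = (Rb *\<^sub>v v) $ i - (R t *\<^sub>v v) $ i"
        using minus_mult_distrib_mat_vec[OF Rbc(1) R v(1), of t] t R[of t] Rbc v i by (simp add: D_def)
      then show "(R t *\<^sub>v v) $ i = (Rb *\<^sub>v v + (- c) \<cdot>\<^sub>v (P *\<^sub>v v)) $ i"
        using i Pc Rbc by (simp add: eq c_def)
    qed (use Pc R[of t] t in auto)
    from touch[OF _ v(1) this] t
    have "- qform (R' t) v = c * (2 * (v \<bullet> ((A - Rb * Q) *\<^sub>v (P *\<^sub>v v))) + c * qform Q (P *\<^sub>v v))"
      by (simp add: power2_eq_square algebra_simps)
    also have "\<dots> < c * (- \<gamma> * qform P v)"
      using barrier[OF v c(2)] c by (intro mult_strict_left_mono) auto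
    finally show "qform (0\<^sub>m n n - R' t) v < - \<gamma> * (\<theta> * exp (- \<gamma> * t)) * qform P v"
      using quadform_minus[OF zero_carrier_mat R' v(1), of t] quadform_zero[OF v(1)] t
      by (simp add: c_def algebra_simps)
  qed
  obtain h where h: "h > 0" "\<And>v. v \<in> carrier_vec n \<Longrightarrow> qform P v \<le> h * (v \<bullet> v)"
    using quadform_upper_bound[OF Pc(1)] by blast
  define C where "C = (e + 1 + \<theta>) * h"
  have C: "C > 0" using e \<theta> h by (simp add: C_def)
  have both: "\<bar>qform (E t) v\<bar> \<le> C * exp (- \<gamma> * t) * (v \<bullet> v)" if t: "t \<ge> 0" and v: "v \<in> carrier_vec n" for t v
  proof -
    define p where "p = qform P v"
    have p: "p \<ge> 0" using Ppos[OF v] Pc v by (cases "v = 0\<^sub>v n") (auto simp: p_def intro: less_imp_le)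
    define x where "x = exp (- \<gamma> * t)"
    have x: "x > 0" by (simp add: x_def)
    have "qform (D t) v = - qform (E t) v"
      using quadform_minus[OF Rbc(1) R[OF t] v] quadform_minus[OF R[OF t] Rbc(1) v] by (simp add: D_def E_def)
    then have "- qform (E t) v \<le> \<theta> * x * p" "qform (E t) v \<le> (e + 1) * x * p"
      using lower[OF t v] upper[OF t v] by (simp_all add: p_def x_def)
    moreover have "0 \<le> \<theta> * x * p" "0 \<le> (e + 1) * x * p" using \<theta> e x p by auto
    ultimately have "\<bar>qform (E t) v\<bar> \<le> (e + 1 + \<theta>) * x * p" by (simp add: abs_le_iff algebra_simps)
    also have "\<dots> \<le> (e + 1 + \<theta>) * x * (h * (v \<bullet> v))"
      using h(2)[OF v] e \<theta> x by (intro mult_left_mono) (auto simp: p_def)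
    finally show ?thesis by (simp add: C_def x_def mult_ac)
  qed
  have "mat_exp_conv \<gamma> n n R Rb"
    unfolding mat_exp_conv_def
  proof (intro conjI allI impI Rbc R)
    fix i j assume ij: "i < n" "j < n"
    have "\<bar>R t $$ (i, j) - Rb $$ (i, j)\<bar> \<le> 3 * C * exp (- \<gamma> * t)" if t: "t \<ge> 0" for t
    proof -
      have "\<bar>E t $$ (i, j)\<bar> \<le> 3 * (C * exp (- \<gamma> * t))"
        by (rule entry_le_quadform[OF Ec[OF t] both[OF t] _ ij]) (use C in auto)
      then show ?thesis using R[OF t] Rbc ij by (simp add: E_def)
    qed
    then show "exp_conv \<gamma> (\<lambda>t. R t $$ (i, j)) (Rb $$ (i, j))" by (auto simp: exp_conv_def)
  qed
  then show ?thesis using that \<gamma> by blast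
qed

section \<open>The Lyapunov differential equation with converging coefficients\<close>

lemma lyapunov_quadform:
  fixes F X N :: "real mat"
  assumes car: "F \<in> carrier_mat n n" "X \<in> carrier_mat n n" "N \<in> carrier_mat n n"
    and sym: "X\<^sup>T = X" and v: "v \<in> carrier_vec n"
  shows "qform (F * X + X * F\<^sup>T + N) v = 2 * (v \<bullet> (F *\<^sub>v (X *\<^sub>v v))) + qform N v"
proof -
  \<comment> \<open>The Riccati identity with vanishing quadratic term.\<close>
  have Z: "X * 0\<^sub>m n n * X = 0\<^sub>m n n" using car by simp
  have "F * X + X * F\<^sup>T + N - X * 0\<^sub>m n n * X = F * X + X * F\<^sup>T + N"
    unfolding Z using car by (intro eq_matI) auto
  then show ?thesis
    using riccati_quadform[OF car zero_carrier_mat sym v] car v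
    by (simp add: quadform_zero[where n=n])
qed

lemma lyapunov_skew_part:
  fixes F X N :: "real mat"
  assumes car: "F \<in> carrier_mat n n" "X \<in> carrier_mat n n" "N \<in> carrier_mat n n"
    and sym: "N\<^sup>T = N"
  shows "F * X + X * F\<^sup>T + N - (F * X + X * F\<^sup>T + N)\<^sup>T
    = F * (X - X\<^sup>T) + (X - X\<^sup>T) * F\<^sup>T"
proof -
  have Z: "X * 0\<^sub>m n n * X = 0\<^sub>m n n" "X\<^sup>T * 0\<^sub>m n n = 0\<^sub>m n n" using car by auto
  have "F * X + X * F\<^sup>T + N - X * 0\<^sub>m n n * X = F * X + X * F\<^sup>T + N"
    unfolding Z using car by (intro eq_matI) auto
  moreover have "F - X\<^sup>T * 0\<^sub>m n n = F"
    unfolding Z using car by (intro eq_matI) auto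
  ultimately show ?thesis
    using riccati_skew_part[OF car zero_carrier_mat sym] by simp
qed

lemma mat_exp_conv_stopped:
  assumes X: "mat_exp_conv \<beta> n m X Y" and b: "\<beta> \<ge> 0" and T: "T \<ge> 0"
  shows "mat_exp_conv 0 n m (\<lambda>t. X (min t T)) Y"
  unfolding mat_exp_conv_def
proof (intro conjI allI impI)
  show "Y \<in> carrier_mat n m" using X by (simp add: mat_exp_conv_def)
  show "X (min t T) \<in> carrier_mat n m" if "t \<ge> 0" for t using X T that by (simp add: mat_exp_conv_def)
  fix i j assume ij: "i < n" "j < m"
  obtain c where c: "\<And>t i j. t \<ge> 0 \<Longrightarrow> i < n \<Longrightarrow> j < m \<Longrightarrow> \<bar>X t $$ (i, j) - Y $$ (i, j)\<bar> \<le> c * exp (- 0 * t)"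
    using mat_exp_convE[OF mat_exp_conv_mono[OF X b]] by metis
  have "\<bar>X (min t T) $$ (i, j) - Y $$ (i, j)\<bar> \<le> c" if "t \<ge> 0" for t
    using c[of "min t T" i j] ij T that by simp
  then show "exp_conv 0 (\<lambda>t. X (min t T) $$ (i, j)) (Y $$ (i, j))" by (auto simp: exp_conv_def)
qed

text \<open>Bridges entrywise convergence and comparison with \<open>P\<close>, in which the
  hypotheses of the barrier lemmas are expressed.\<close>

lemma mat_exp_conv_quadform:
  assumes X: "mat_exp_conv \<beta> n n X Y" and P: "pos_def n P"
  obtains k where "k \<ge> 0"
    "\<And>t v. t \<ge> 0 \<Longrightarrow> v \<in> carrier_vec n \<Longrightarrow>
      \<bar>qform (X t) v - qform Y v\<bar> \<le> k * exp (- \<beta> * t) * qform P v"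
proof -
  obtain c where c: "c \<ge> 0"
    "\<And>t i j. t \<ge> 0 \<Longrightarrow> i < n \<Longrightarrow> j < n \<Longrightarrow> \<bar>X t $$ (i, j) - Y $$ (i, j)\<bar> \<le> c * exp (- \<beta> * t)"
    using mat_exp_convE[OF X] by blast
  obtain e where e: "e > 0" "\<And>v. v \<in> carrier_vec n \<Longrightarrow> e * (v \<bullet> v) \<le> qform P v"
    using quadform_lower_bound[of P n] P by (auto simp: pos_def_def)
  have car: "Y \<in> carrier_mat n n" "\<And>t. t \<ge> 0 \<Longrightarrow> X t \<in> carrier_mat n n" using X by (auto simp: mat_exp_conv_def)
  have "\<bar>qform (X t) v - qform Y v\<bar> \<le> (c * real n / e) * exp (- \<beta> * t) * qform P v"
    if t: "t \<ge> 0" and v: "v \<in> carrier_vec n" for t v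
  proof -
    have "\<bar>qform (X t) v - qform Y v\<bar> = \<bar>qform (X t - Y) v\<bar>"
      using quadform_minus[OF car(2)[OF t] car(1) v] by simp
    also have "\<dots> \<le> (c * exp (- \<beta> * t)) * real n * (v \<bullet> v)"
      by (rule quadform_abs_le[OF minus_carrier_mat[OF car(1)] v]) (use c(2)[OF t] car t in auto)
    also have "\<dots> = (c * real n / e) * exp (- \<beta> * t) * (e * (v \<bullet> v))" using e by simp
    also have "\<dots> \<le> (c * real n / e) * exp (- \<beta> * t) * qform P v"
      using e(2)[OF v] e(1) c(1) by (intro mult_left_mono) auto
    finally show ?thesis .
  qed
  then show ?thesis using that[of "c * real n / e"] c e by simp
qed

text \<open>The bound is uniform in \<open>h\<close>, so integer times already determine the limit,
  and letting \<open>h\<close> run through \<open>k - t\<close> gives the same rate at every real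
  \<open>t\<close>.\<close>

lemma exp_cauchy_exp_conv:
  assumes c: "\<And>t h. t \<ge> 0 \<Longrightarrow> h \<ge> 0 \<Longrightarrow> \<bar>f (t + h) - f t\<bar> \<le> c * exp (- \<gamma> * t)" and \<gamma>: "\<gamma> > 0"
  obtains l where "exp_conv \<gamma> f l"
proof -
  have "c \<ge> 0" using c[of 0 0] by simp
  then have "exp_conv \<gamma> (\<lambda>t. c * exp (- \<gamma> * t)) 0" by (auto simp: exp_conv_def)
  from exp_conv_tendsto[OF this \<gamma>] have lim: "((\<lambda>t. c * exp (- \<gamma> * t)) \<longlongrightarrow> 0) at_top" .
  have "Cauchy (\<lambda>k. f (real k))"
    unfolding Cauchy_altdef
  proof (intro allI impI)
    fix e :: real assume "e > 0"
    with lim have "eventually (\<lambda>t. c * exp (- \<gamma> * t) < e) at_top" by (auto dest: order_tendstoD(2))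
    then obtain T where T: "\<And>t. t \<ge> T \<Longrightarrow> c * exp (- \<gamma> * t) < e" by (auto simp: eventually_at_top_linorder)
    have "dist (f (real m)) (f (real k)) < e" if "m \<ge> nat \<lceil>T\<rceil>" "k > m" for m k
    proof -
      have "real m \<ge> T" using that(1) by linarith
      then show ?thesis using c[of "real m" "real k - real m"] T[of "real m"] that(2)
        by (simp add: dist_real_def abs_minus_commute)
    qed
    then show "\<exists>M. \<forall>m\<ge>M. \<forall>k>m. dist (f (real m)) (f (real k)) < e" by blast
  qed
  then obtain l where l: "(\<lambda>k. f (real k)) \<longlonglongrightarrow> l" using Cauchy_convergent_iff convergent_def by blast
  have "\<bar>f t - l\<bar> \<le> c * exp (- \<gamma> * t)" if t: "t \<ge> 0" for t
  proof (rule tendsto_upperbound)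
    show "(\<lambda>k. \<bar>f t - f (real k)\<bar>) \<longlonglongrightarrow> \<bar>f t - l\<bar>" by (intro tendsto_intros l)
    show "eventually (\<lambda>k. \<bar>f t - f (real k)\<bar> \<le> c * exp (- \<gamma> * t)) sequentially"
      unfolding eventually_sequentially
    proof (intro exI allI impI)
      fix k assume "nat \<lceil>t\<rceil> \<le> k"
      then have "real k \<ge> t" by linarith
      then show "\<bar>f t - f (real k)\<bar> \<le> c * exp (- \<gamma> * t)"
        using c[OF t, of "real k - t"] by (simp add: abs_minus_commute)
    qed
  qed simp
  then show ?thesis using that by (auto simp: exp_conv_def)
qed

text \<open>If \<open>f\<close> settles, its mean slope over an interval of length 1 tends to 0, and
  that slope is a value of \<open>f'\<close>. This identifies the limit of a solution as a zero of
  the limiting right-hand side.\<close>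

lemma exp_conv_derivative_limit:
  assumes der: "\<And>t. t \<ge> 0 \<Longrightarrow> (f has_real_derivative f' t) (at t within {0..})"
    and f: "exp_conv \<gamma> f l" and f': "exp_conv \<gamma> f' m" and \<gamma>: "\<gamma> > 0"
  shows "m = 0"
proof -
  obtain c where c: "c \<ge> 0" "\<And>t. t \<ge> 0 \<Longrightarrow> \<bar>f t - l\<bar> \<le> c * exp (- \<gamma> * t)" using exp_convE[OF f] by blast
  obtain d where d: "d \<ge> 0" "\<And>t. t \<ge> 0 \<Longrightarrow> \<bar>f' t - m\<bar> \<le> d * exp (- \<gamma> * t)" using exp_convE[OF f'] by blast
  have "\<bar>m\<bar> \<le> (2 * c + d) * exp (- \<gamma> * t)" if t: "t \<ge> 0" for t
  proof -
    have "(f has_real_derivative f' s) (at s)" if "s > 0" for s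
    proof -
      have "at s within {0..} = at s" using that by (intro at_within_interior) (simp add: interior_real_atLeast)
      then show ?thesis using der[of s] that by simp
    qed
    \<comment> \<open>Starting at \<open>t + 1\<close> keeps the interval in the open half-line,
      where the derivative is two-sided.\<close>
    then obtain s where s: "s > t + 1" "s < t + 2" "f (t + 2) - f (t + 1) = (t + 2 - (t + 1)) * f' s"
      using MVT2[of "t + 1" "t + 2" f f'] t by auto
    have mono: "exp (- \<gamma> * u) \<le> exp (- \<gamma> * t)" if "u \<ge> t" for u
      using \<gamma> that by simp
    have "\<bar>f u - l\<bar> \<le> c * exp (- \<gamma> * t)" if "u \<ge> t" for u
      using c(2)[of u] mult_left_mono[OF mono[OF that] c(1)] that t by linarith
    from this[of "t + 1"] this[of "t + 2"]
    have "\<bar>f' s\<bar> \<le> 2 * (c * exp (- \<gamma> * t))" using s(3) by simp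
    moreover have "\<bar>f' s - m\<bar> \<le> d * exp (- \<gamma> * t)"
      using d(2)[of s] mult_left_mono[OF mono[of s] d(1)] s t by linarith
    ultimately show ?thesis by (simp add: algebra_simps)
  qed
  then have "exp_conv \<gamma> (\<lambda>_. m) 0" by (auto simp: exp_conv_def)
  from exp_conv_tendsto[OF this \<gamma>] show ?thesis by (simp add: tendsto_const_iff)
qed

text \<open>Solvability of the algebraic Lyapunov equation is a by-product. The difference
  \<open>V (t + s) - V t\<close> obeys an equation with source \<open>N (t + s) - N t\<close> and
  terms from \<open>(F (t + s) - F t) * V t\<close>; the estimate of the latter uses boundedness of
  \<open>V\<close>. Hence \<open>perturbed_lyapunov_bound\<close> is applied twice, at rate 0 for
  \<open>V\<close> and at a positive rate for the difference.\<close>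

lemma lyapunov_ode_converges:
  fixes F N V :: "real \<Rightarrow> real mat" and F0 N0 :: "real mat"
  assumes F: "mat_exp_conv \<beta> n n F F0" and N: "mat_exp_conv \<beta> n n N N0" and \<beta>: "\<beta> > 0"
    and st: "mat_stable F0"
    and Nsym: "\<And>t. t \<ge> 0 \<Longrightarrow> (N t)\<^sup>T = N t"
    and ode: "has_mat_deriv_on_nonneg V (\<lambda>t. F t * V t + V t * (F t)\<^sup>T + N t) n n"
    and V0: "(V 0)\<^sup>T = V 0"
  shows "mat_bounded_nonneg V n n \<and> (\<exists>V_inf. V_inf \<in> carrier_mat n n \<and> mat_tendsto V V_inf \<and>
    F0 * V_inf + V_inf * F0\<^sup>T + N0 = 0\<^sub>m n n)"
proof -
  have Fc: "F0 \<in> carrier_mat n n" "\<And>t. t \<ge> 0 \<Longrightarrow> F t \<in> carrier_mat n n" using F by (auto simp: mat_exp_conv_def)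
  have Nc: "N0 \<in> carrier_mat n n" "\<And>t. t \<ge> 0 \<Longrightarrow> N t \<in> carrier_mat n n" using N by (auto simp: mat_exp_conv_def)
  have Vc: "V t \<in> carrier_mat n n" if "t \<ge> 0" for t using ode that by (auto simp: has_mat_deriv_on_nonneg_def)
  define V' where "V' = (\<lambda>t. F t * V t + V t * (F t)\<^sup>T + N t)"
  have V'c: "V' t \<in> carrier_mat n n" if "t \<ge> 0" for t
    using Fc(2)[OF that] Nc(2)[OF that] Vc[OF that] by (simp add: V'_def)
  note V_ode = ode[folded V'_def]
  have Vsym: "(V t)\<^sup>T = V t" if "t \<ge> 0" for t
  proof (rule mat_ode_symmetric[OF ode V0 Fc(2) _ _ that])
    show "F t * V t + V t * (F t)\<^sup>T + N t - (F t * V t + V t * (F t)\<^sup>T + N t)\<^sup>T =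
        F t * (V t - (V t)\<^sup>T) + (V t - (V t)\<^sup>T) * (F t)\<^sup>T" if "t \<ge> 0" for t
      by (rule lyapunov_skew_part[OF Fc(2) Vc Nc(2) Nsym]) (fact that)+
    show "\<exists>L. mat_exp_conv 0 n n (\<lambda>t. F (min t T)) L" if "T \<ge> 0" for T
      using mat_exp_conv_stopped[OF F less_imp_le[OF \<beta>] that] by blast
  qed
  have V'q: "qform (V' t) v = 2 * (v \<bullet> (F t *\<^sub>v (V t *\<^sub>v v))) + qform (N t) v"
    if "t \<ge> 0" "v \<in> carrier_vec n" for t v
    unfolding V'_def by (rule lyapunov_quadform[OF Fc(2) Vc Nc(2) Vsym]) (fact that)+
  obtain P \<alpha> where P: "pos_def n P" and \<alpha>: "\<alpha> > 0"
    and diss: "\<And>v. v \<in> carrier_vec n \<Longrightarrow> v \<bullet> (F0 *\<^sub>v (P *\<^sub>v v)) \<le> - \<alpha> * qform P v"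
    using stable_lyapunov[OF Fc(1) st] by blast
  have Pc: "P \<in> carrier_mat n n" using P by (simp add: pos_def_def)
  have Pnn: "qform P v \<ge> 0" if "v \<in> carrier_vec n" for v
    using P that by (cases "v = 0\<^sub>v n") (auto simp: pos_def_def intro: less_imp_le)
  obtain h where h: "h > 0" "\<And>v. v \<in> carrier_vec n \<Longrightarrow> qform P v \<le> h * (v \<bullet> v)"
    using quadform_upper_bound[OF Pc] by blast
  have assoc: "(M * P) *\<^sub>v v = M *\<^sub>v (P *\<^sub>v v)" if "M \<in> carrier_mat n n" "v \<in> carrier_vec n" for M v
    using assoc_mult_mat_vec[OF that(1) Pc that(2)] .
  obtain k1 where k1: "k1 \<ge> 0" "\<And>t v. t \<ge> 0 \<Longrightarrow> v \<in> carrier_vec n \<Longrightarrow>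
      \<bar>v \<bullet> (F t *\<^sub>v (P *\<^sub>v v)) - v \<bullet> (F0 *\<^sub>v (P *\<^sub>v v))\<bar> \<le> k1 * exp (- \<beta> * t) * qform P v"
    using mat_exp_conv_quadform[OF mat_exp_conv_mult[OF F mat_exp_conv_const[OF Pc] less_imp_le[OF \<beta>]] P]
    using assoc Fc by (metis (no_types, lifting))
  obtain k2 where k2: "k2 \<ge> 0" "\<And>t v. t \<ge> 0 \<Longrightarrow> v \<in> carrier_vec n \<Longrightarrow>
      \<bar>qform (N t) v - qform N0 v\<bar> \<le> k2 * exp (- \<beta> * t) * qform P v"
    using mat_exp_conv_quadform[OF N P] by blast
  have dP: "v \<bullet> (M *\<^sub>v (d \<cdot>\<^sub>v (P *\<^sub>v v))) = d * (v \<bullet> (M *\<^sub>v (P *\<^sub>v v)))"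
    if "M \<in> carrier_mat n n" "v \<in> carrier_vec n" for M v d
    using that Pc mult_mat_vec[OF that(1), of "P *\<^sub>v v" d] by simp
  obtain k3 where k3: "k3 > 0" "\<And>v. v \<in> carrier_vec n \<Longrightarrow> qform N0 v \<le> k3 * qform P v"
    using quadform_dominated[OF Nc(1) P] by blast
  \<comment> \<open>Since \<open>quadform_dominated\<close> is one-sided, \<open>N0\<close> and
    \<open>V 0\<close> are bounded with the opposite sign as well.\<close>
  have N0m: "0\<^sub>m n n - N0 \<in> carrier_mat n n" using Nc by (simp add: minus_carrier_mat)
  obtain k4 where k4: "k4 > 0" "\<And>v. v \<in> carrier_vec n \<Longrightarrow> qform (0\<^sub>m n n - N0) v \<le> k4 * qform P v"
    using quadform_dominated[OF N0m P] by blast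
  have k4': "- qform N0 v \<le> k4 * qform P v" if "v \<in> carrier_vec n" for v
    using k4(2)[OF that] quadform_minus[OF zero_carrier_mat Nc(1) that] quadform_zero[OF that] by simp
  obtain k5 where k5: "k5 > 0" "\<And>v. v \<in> carrier_vec n \<Longrightarrow> qform (V 0) v \<le> k5 * qform P v"
    using quadform_dominated[OF Vc[OF order_refl] P] by blast
  have V0m: "0\<^sub>m n n - V 0 \<in> carrier_mat n n" using Vc[of 0] by (simp add: minus_carrier_mat)
  obtain k6 where k6: "k6 > 0" "\<And>v. v \<in> carrier_vec n \<Longrightarrow> qform (0\<^sub>m n n - V 0) v \<le> k6 * qform P v"
    using quadform_dominated[OF V0m P] by blast
  have k6': "- qform (V 0) v \<le> k6 * qform P v" if "v \<in> carrier_vec n" for v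
    using k6(2)[OF that] quadform_minus[OF zero_carrier_mat Vc[OF order_refl] that] quadform_zero[OF that] by simp

  \<comment> \<open>One constant for three tasks: \<open>2 * k1\<close> for the deviation of
    \<open>F\<close>, \<open>k2 + k3 + k4\<close> for the size of \<open>N\<close>, and
    \<open>k5 + k6\<close> for the initial value.\<close>
  define \<kappa> where "\<kappa> = 2 * k1 + k2 + k3 + k4 + k5 + k6"
  have \<kappa>: "\<kappa> \<ge> 0" "2 * k1 \<le> \<kappa>" "k2 + k3 + k4 \<le> \<kappa>" "k5 + k6 \<le> \<kappa>"
    using k1 k2 k3 k4 k5 k6 by (simp_all add: \<kappa>_def)
  define C where "C = (\<kappa> / \<alpha> + \<kappa> + 1) * exp (\<kappa> / \<beta>)"
  have C: "C \<ge> 0" using \<kappa> \<alpha> by (simp add: C_def)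
  have Vbound: "\<bar>qform (V t) v\<bar> \<le> C * qform P v" if t: "t \<ge> 0" and v: "v \<in> carrier_vec n" for t v
  proof -
    \<comment> \<open>Rate 0, because the source tends to \<open>N0\<close> and need not
      decay.\<close>
    have "\<bar>qform (V t) v\<bar> \<le> (\<kappa> / \<alpha> + \<kappa> + 1) * exp (\<kappa> / \<beta>) * exp (- 0 * t) * qform P v"
    proof (rule perturbed_lyapunov_bound[OF V_ode Vsym P diss \<alpha> \<beta> order_refl less_imp_le[OF \<alpha>] \<kappa>(1) _ _ t v])
      fix v :: "real vec" assume v: "v \<in> carrier_vec n"
      define p where "p = qform P v"
      have p: "p \<ge> 0" using Pnn[OF v] by (simp add: p_def)
      have "k5 * p \<le> \<kappa> * p" "k6 * p \<le> \<kappa> * p" using \<kappa> k5 k6 p by (auto intro!: mult_right_mono)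
      then show "\<bar>qform (V 0) v\<bar> \<le> \<kappa> * qform P v"
        using k5(2)[OF v] k6'[OF v] by (simp add: p_def abs_le_iff)
      fix t d :: real assume t: "t > 0" and eq: "V t *\<^sub>v v = d \<cdot>\<^sub>v (P *\<^sub>v v)"
      have "qform (V' t) v = 2 * d * (v \<bullet> (F t *\<^sub>v (P *\<^sub>v v))) + qform (N t) v"
        using V'q[of t v] dP[OF Fc(2) v, of t d] t v eq by simp
      then have "qform (V' t) v - 2 * d * (v \<bullet> (F0 *\<^sub>v (P *\<^sub>v v)))
          = 2 * d * (v \<bullet> (F t *\<^sub>v (P *\<^sub>v v)) - v \<bullet> (F0 *\<^sub>v (P *\<^sub>v v))) + qform (N t) v"
        by (simp add: algebra_simps)
      also have "\<bar>\<dots>\<bar> \<le> 2 * \<bar>d\<bar> * \<bar>v \<bullet> (F t *\<^sub>v (P *\<^sub>v v)) - v \<bullet> (F0 *\<^sub>v (P *\<^sub>v v))\<bar> + \<bar>qform (N t) v\<bar>"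
        by (rule order_trans[OF abs_triangle_ineq]) (simp add: abs_mult)
      also have "\<dots> \<le> 2 * \<bar>d\<bar> * (k1 * exp (- \<beta> * t) * p) + (k2 + k3 + k4) * p"
      proof (rule add_mono)
        show "2 * \<bar>d\<bar> * \<bar>v \<bullet> (F t *\<^sub>v (P *\<^sub>v v)) - v \<bullet> (F0 *\<^sub>v (P *\<^sub>v v))\<bar> \<le> 2 * \<bar>d\<bar> * (k1 * exp (- \<beta> * t) * p)"
          using k1(2)[of t v] t v by (intro mult_left_mono) (auto simp: p_def)
        have "k2 * exp (- \<beta> * t) * p \<le> k2 * 1 * p"
          using k2(1) \<beta> t p by (intro mult_right_mono mult_left_mono) auto
        then have "\<bar>qform (N t) v - qform N0 v\<bar> \<le> k2 * p"
          using k2(2)[of t v] t v by (simp add: p_def)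
        moreover have "\<bar>qform N0 v\<bar> \<le> (k3 + k4) * p"
        proof -
          have "0 \<le> k3 * p" "0 \<le> k4 * p" using k3(1) k4(1) p by auto
          then show ?thesis using k3(2)[OF v] k4'[OF v] by (simp add: p_def abs_le_iff algebra_simps)
        qed
        ultimately show "\<bar>qform (N t) v\<bar> \<le> (k2 + k3 + k4) * p" by (simp add: algebra_simps)
      qed
      also have "\<dots> = (\<bar>d\<bar> * (2 * k1) * exp (- \<beta> * t) + (k2 + k3 + k4)) * p" by (simp add: algebra_simps)
      also have "\<dots> \<le> (\<bar>d\<bar> * \<kappa> * exp (- \<beta> * t) + \<kappa> * exp (- 0 * t)) * p"
        using \<kappa> p by (intro mult_right_mono add_mono mult_left_mono) auto
      finally show "\<bar>qform (V' t) v - 2 * d * (v \<bullet> (F0 *\<^sub>v (P *\<^sub>v v)))\<bar> \<le>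
          (\<bar>d\<bar> * \<kappa> * exp (- \<beta> * t) + \<kappa> * exp (- 0 * t)) * qform P v" by (simp add: p_def)
    qed
    then show ?thesis by (simp add: C_def)
  qed
  define b where "b = 3 * (C * h)"
  have b: "b \<ge> 0" using C h by (simp add: b_def)
  have Ventry: "\<bar>V t $$ (i, j)\<bar> \<le> b" if t: "t \<ge> 0" and ij: "i < n" "j < n" for t i j
    unfolding b_def
  proof (rule entry_le_quadform[OF Vc[OF t] Vsym[OF t] _ _ ij])
    fix v :: "real vec" assume v: "v \<in> carrier_vec n"
    have "C * qform P v \<le> C * (h * (v \<bullet> v))" using h(2)[OF v] C by (rule mult_left_mono)
    then show "\<bar>qform (V t) v\<bar> \<le> C * h * (v \<bullet> v)" using Vbound[OF t v] by (simp add: mult.assoc)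
  qed (use C h in simp)
  obtain cF where cF: "cF \<ge> 0"
    "\<And>t i j. t \<ge> 0 \<Longrightarrow> i < n \<Longrightarrow> j < n \<Longrightarrow> \<bar>F t $$ (i, j) - F0 $$ (i, j)\<bar> \<le> cF * exp (- \<beta> * t)"
    using mat_exp_convE[OF F] by blast
  obtain e where e: "e > 0" "\<And>v. v \<in> carrier_vec n \<Longrightarrow> e * (v \<bullet> v) \<le> qform P v"
    using quadform_lower_bound[of P n] P by (auto simp: pos_def_def)
  \<comment> \<open>Entries of the product below are bounded by \<open>real n * (2 * cF * b)\<close>
    times the exponential; the second \<open>real n\<close> comes from
    \<open>quadform_abs_le\<close>, and dividing by \<open>e\<close> converts to
    \<open>P\<close>.\<close>
  define k7 where "k7 = (real n * (2 * cF * b)) * real n / e"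
  have k7: "k7 \<ge> 0" using cF b e by (simp add: k7_def)
  have FV: "\<bar>qform ((F (t + s) - F t) * V t) v\<bar> \<le> k7 * exp (- \<beta> * t) * qform P v"
    if t: "t \<ge> 0" and s: "s \<ge> 0" and v: "v \<in> carrier_vec n" for t s v
  proof -
    have Fd: "F (t + s) - F t \<in> carrier_mat n n" using Fc(2)[OF t] by (simp add: minus_carrier_mat)
    have "\<bar>((F (t + s) - F t) * V t) $$ (i, j)\<bar> \<le> real n * (2 * cF * b) * exp (- \<beta> * t)"
      if ij: "i < n" "j < n" for i j
    proof -
      have "((F (t + s) - F t) * V t) $$ (i, j) = (\<Sum>k<n. (F (t + s) - F t) $$ (i, k) * V t $$ (k, j))"
        using Fd Vc[OF t] ij by (simp add: scalar_prod_def atLeast0LessThan del: index_minus_mat)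
      also have "\<bar>\<dots>\<bar> \<le> (\<Sum>k<n. (2 * cF * exp (- \<beta> * t)) * b)"
      proof (intro order_trans[OF sum_abs] sum_mono)
        fix k assume "k \<in> {..<n}"
        then have k: "k < n" by simp
        have "cF * exp (- \<beta> * (t + s)) \<le> cF * exp (- \<beta> * t)"
          using cF(1) \<beta> s by (intro mult_left_mono) (auto simp: algebra_simps)
        then have "\<bar>(F (t + s) - F t) $$ (i, k)\<bar> \<le> 2 * cF * exp (- \<beta> * t)"
          using cF(2)[of "t + s" i k] cF(2)[OF t ij(1) k] t s ij k Fc(2)[of "t + s"] Fc(2)[OF t] by simp
        then show "\<bar>(F (t + s) - F t) $$ (i, k) * V t $$ (k, j)\<bar> \<le> (2 * cF * exp (- \<beta> * t)) * b"
          unfolding abs_mult using Ventry[OF t k ij(2)] cF(1) by (intro mult_mono) auto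
      qed
      finally show ?thesis by (simp add: mult_ac)
    qed
    then have "\<bar>qform ((F (t + s) - F t) * V t) v\<bar> \<le> (real n * (2 * cF * b) * exp (- \<beta> * t)) * real n * (v \<bullet> v)"
      using Fd Vc[OF t] by (intro quadform_abs_le[OF _ v]) auto
    also have "\<dots> = k7 * exp (- \<beta> * t) * (e * (v \<bullet> v))" using e by (simp add: k7_def)
    also have "\<dots> \<le> k7 * exp (- \<beta> * t) * qform P v" using e(2)[OF v] k7 by (intro mult_left_mono) auto
    finally show ?thesis .
  qed
  \<comment> \<open>The barrier may decay no faster than at rate \<open>\<alpha>\<close>, and the
    differences of the coefficients decay at rate \<open>\<beta>\<close>.\<close>
  define \<gamma> where "\<gamma> = min \<alpha> \<beta>"
  have \<gamma>: "\<gamma> > 0" "\<gamma> \<le> \<alpha>" "\<gamma> \<le> \<beta>" using \<alpha> \<beta> by (auto simp: \<gamma>_def)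
  \<comment> \<open>The summand \<open>2 * C\<close> bounds the initial value
    \<open>V s - V 0\<close> for all \<open>s\<close> at once, so that \<open>B\<close> is
    independent of \<open>s\<close>; the others belong to the deviation of \<open>F\<close> and to
    the source.\<close>
  define \<mu> where "\<mu> = 2 * k1 + 2 * k2 + 2 * k7 + 2 * C"
  have \<mu>: "\<mu> \<ge> 0" "2 * k1 \<le> \<mu>" "2 * k2 + 2 * k7 \<le> \<mu>" "2 * C \<le> \<mu>" using k1 k2 k7 C by (simp_all add: \<mu>_def)
  define B where "B = (\<mu> / \<alpha> + \<mu> + 1) * exp (\<mu> / \<beta>)"
  have B: "B \<ge> 0" using \<mu> \<alpha> by (simp add: B_def)
  have Wbound: "\<bar>qform (V (t + s) - V t) v\<bar> \<le> B * exp (- \<gamma> * t) * qform P v"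
    if t: "t \<ge> 0" and s: "s \<ge> 0" and v: "v \<in> carrier_vec n" for t s v
    unfolding B_def
  proof (rule perturbed_lyapunov_bound[OF has_mat_deriv_diff[OF has_mat_deriv_shift[OF V_ode s] V_ode] _ P diss \<alpha> \<beta>
        less_imp_le[OF \<gamma>(1)] \<gamma>(2) \<mu>(1) _ _ t v])
    show "(V (t + s) - V t)\<^sup>T = V (t + s) - V t" if "t \<ge> 0" for t
      using Vc[OF that] Vc[of "t + s"] Vsym[OF that] Vsym[of "t + s"] that s
      by (simp add: transpose_minus_mat[where n=n and m=n])
    fix v :: "real vec" assume v: "v \<in> carrier_vec n"
    define p where "p = qform P v"
    have p: "p \<ge> 0" using Pnn[OF v] by (simp add: p_def)
    have "\<bar>qform (V (0 + s) - V 0) v\<bar> \<le> 2 * C * p"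
      using quadform_minus[OF Vc[of "0 + s"] Vc[OF order_refl] v] Vbound[OF s v] Vbound[OF order_refl v] s
      by (simp add: p_def)
    also have "\<dots> \<le> \<mu> * p" using \<mu> p by (intro mult_right_mono) auto
    finally show "\<bar>qform (V (0 + s) - V 0) v\<bar> \<le> \<mu> * qform P v" by (simp add: p_def)
    fix t d :: real assume t: "t > 0" and eq: "(V (t + s) - V t) *\<^sub>v v = d \<cdot>\<^sub>v (P *\<^sub>v v)"
    have t0: "t \<ge> 0" and ts: "t + s \<ge> 0" using t s by auto
    define x where "x = V t *\<^sub>v v"
    have x: "x \<in> carrier_vec n" using Vc[OF t0] v by (simp add: x_def)
    have Pv: "P *\<^sub>v v \<in> carrier_vec n" using Pc v by simp
    \<comment> \<open>At a touching vector the difference of the solutions is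
      \<open>d \<cdot>\<^sub>v (P *\<^sub>v v)\<close>. In the difference of the right-hand sides
      \<open>F (t + s)\<close> acts on this vector, and \<open>F (t + s) - F t\<close> acts on
      \<open>x\<close>.\<close>
    have Vx: "V (t + s) *\<^sub>v v = x + d \<cdot>\<^sub>v (P *\<^sub>v v)"
      unfolding eq[symmetric] minus_mult_distrib_mat_vec[OF Vc[OF ts] Vc[OF t0] v] x_def
      using Vc[OF ts] Vc[OF t0] v by (intro eq_vecI) auto
    have Fd: "F (t + s) - F t \<in> carrier_mat n n" using Fc(2)[OF t0] by (simp add: minus_carrier_mat)
    define a1 where "a1 = v \<bullet> (F (t + s) *\<^sub>v (P *\<^sub>v v))"
    define a0 where "a0 = v \<bullet> (F0 *\<^sub>v (P *\<^sub>v v))"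
    define a2 where "a2 = qform ((F (t + s) - F t) * V t) v"
    define n1 where "n1 = qform (N (t + s)) v"
    define n2 where "n2 = qform (N t) v"
    define n0 where "n0 = qform N0 v"
    have a2': "a2 = v \<bullet> (F (t + s) *\<^sub>v x) - v \<bullet> (F t *\<^sub>v x)"
      unfolding a2_def assoc_mult_mat_vec[OF Fd Vc[OF t0] v] x_def[symmetric]
        minus_mult_distrib_mat_vec[OF Fc(2)[OF ts] Fc(2)[OF t0] x]
      using Fc(2)[OF ts] Fc(2)[OF t0] x v by (simp add: scalar_prod_minus_distrib[where n=n])
    have "qform (V' (t + s) - V' t) v = qform (V' (t + s)) v - qform (V' t) v"
      by (rule quadform_minus[OF V'c[OF ts] V'c[OF t0] v])
    also have "\<dots> = 2 * (v \<bullet> (F (t + s) *\<^sub>v (x + d \<cdot>\<^sub>v (P *\<^sub>v v)))) + n1 - (2 * (v \<bullet> (F t *\<^sub>v x)) + n2)"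
      unfolding V'q[OF ts v] V'q[OF t0 v] Vx by (simp add: x_def n1_def n2_def)
    also have "v \<bullet> (F (t + s) *\<^sub>v (x + d \<cdot>\<^sub>v (P *\<^sub>v v))) = v \<bullet> (F (t + s) *\<^sub>v x) + d * a1"
      unfolding scaled_vec_simps[OF Fc(2)[OF ts] x Pv] a1_def
      using Fc(2)[OF ts] x Pv v by (simp add: scalar_prod_add_distrib[where n=n])
    finally have "qform (V' (t + s) - V' t) v - 2 * d * a0 = 2 * d * (a1 - a0) + 2 * a2 + (n1 - n0) - (n2 - n0)"
      unfolding a2' by (simp add: algebra_simps)
    also have "\<bar>\<dots>\<bar> \<le> 2 * (\<bar>d\<bar> * \<bar>a1 - a0\<bar>) + 2 * \<bar>a2\<bar> + \<bar>n1 - n0\<bar> + \<bar>n2 - n0\<bar>"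
    proof -
      have "\<bar>2 * d * (a1 - a0)\<bar> = 2 * (\<bar>d\<bar> * \<bar>a1 - a0\<bar>)" by (simp add: abs_mult)
      then show ?thesis by linarith
    qed
    also have "\<dots> \<le> 2 * (\<bar>d\<bar> * (k1 * exp (- \<beta> * t) * p)) + 2 * (k7 * exp (- \<beta> * t) * p)
        + k2 * exp (- \<beta> * t) * p + k2 * exp (- \<beta> * t) * p"
    proof -
      have mono: "k * exp (- \<beta> * (t + s)) * p \<le> k * exp (- \<beta> * t) * p" if "k \<ge> 0" for k
        using that p \<beta> s by (intro mult_right_mono mult_left_mono) (auto simp: algebra_simps)
      have "\<bar>a1 - a0\<bar> \<le> k1 * exp (- \<beta> * t) * p"
        using k1(2)[OF ts v] mono[OF k1(1)] unfolding a1_def a0_def p_def by linarith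
      then have "\<bar>d\<bar> * \<bar>a1 - a0\<bar> \<le> \<bar>d\<bar> * (k1 * exp (- \<beta> * t) * p)" by (intro mult_left_mono) auto
      moreover have "\<bar>n1 - n0\<bar> \<le> k2 * exp (- \<beta> * t) * p"
        using k2(2)[OF ts v] mono[OF k2(1)] unfolding n1_def n0_def p_def by linarith
      moreover have "\<bar>n2 - n0\<bar> \<le> k2 * exp (- \<beta> * t) * p"
        using k2(2)[OF t0 v] unfolding n2_def n0_def p_def .
      moreover have "\<bar>a2\<bar> \<le> k7 * exp (- \<beta> * t) * p" using FV[OF t0 s v] unfolding a2_def p_def .
      ultimately show ?thesis by linarith
    qed
    also have "\<dots> = (\<bar>d\<bar> * (2 * k1) * exp (- \<beta> * t) + (2 * k2 + 2 * k7) * exp (- \<beta> * t)) * p"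
      by (simp add: algebra_simps)
    also have "\<dots> \<le> (\<bar>d\<bar> * \<mu> * exp (- \<beta> * t) + \<mu> * exp (- \<gamma> * t)) * p"
    proof -
      have "exp (- \<beta> * t) \<le> exp (- \<gamma> * t)" using \<gamma> t by (simp add: mult_right_mono)
      then show ?thesis using \<mu> p by (intro mult_right_mono add_mono mult_left_mono mult_mono) auto
    qed
    finally show "\<bar>qform (V' (t + s) - V' t) v - 2 * d * (v \<bullet> (F0 *\<^sub>v (P *\<^sub>v v)))\<bar> \<le>
        (\<bar>d\<bar> * \<mu> * exp (- \<beta> * t) + \<mu> * exp (- \<gamma> * t)) * qform P v"
      by (simp add: a0_def p_def)
  qed
  have "\<exists>l. exp_conv \<gamma> (\<lambda>t. V t $$ (i, j)) l" if ij: "i < n" "j < n" for i j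
  proof -
    have "\<bar>V (t + s) $$ (i, j) - V t $$ (i, j)\<bar> \<le> 3 * (B * h) * exp (- \<gamma> * t)" if t: "t \<ge> 0" and s: "s \<ge> 0" for t s
    proof -
      have ts: "t + s \<ge> 0" using t s by simp
      have W: "V (t + s) - V t \<in> carrier_mat n n" using Vc[OF t] by (simp add: minus_carrier_mat)
      have "\<bar>(V (t + s) - V t) $$ (i, j)\<bar> \<le> 3 * (B * exp (- \<gamma> * t) * h)"
      proof (rule entry_le_quadform[OF W _ _ _ ij])
        show "(V (t + s) - V t)\<^sup>T = V (t + s) - V t"
          using Vc[OF t] Vc[OF ts] Vsym[OF t] Vsym[OF ts] by (simp add: transpose_minus_mat[where n=n and m=n])
        fix v :: "real vec" assume v: "v \<in> carrier_vec n"
        have "B * exp (- \<gamma> * t) * qform P v \<le> B * exp (- \<gamma> * t) * (h * (v \<bullet> v))"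
          using h(2)[OF v] B by (intro mult_left_mono) auto
        then show "\<bar>qform (V (t + s) - V t) v\<bar> \<le> B * exp (- \<gamma> * t) * h * (v \<bullet> v)"
          using Wbound[OF t s v] by (simp add: mult.assoc)
      qed (use B h in simp)
      then show ?thesis using Vc[OF t] Vc[OF ts] ij by (simp add: mult_ac)
    qed
    from exp_cauchy_exp_conv[OF this \<gamma>(1)] show ?thesis by blast
  qed
  then obtain l where l: "\<And>i j. i < n \<Longrightarrow> j < n \<Longrightarrow> exp_conv \<gamma> (\<lambda>t. V t $$ (i, j)) (l i j)" by metis
  define V_inf where "V_inf = mat n n (\<lambda>(i, j). l i j)"
  have Vi: "V_inf \<in> carrier_mat n n" by (simp add: V_inf_def)
  have Vconv: "mat_exp_conv \<gamma> n n V V_inf"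
    unfolding mat_exp_conv_def using Vi Vc l by (auto simp: V_inf_def)
  \<comment> \<open>The right-hand side converges by the closure rules, and
    \<open>exp_conv_derivative_limit\<close> then forces its limit to vanish.\<close>
  have V'conv: "mat_exp_conv \<gamma> n n V' (F0 * V_inf + V_inf * F0\<^sup>T + N0)"
    unfolding V'_def
    by (intro mat_exp_conv_add mat_exp_conv_mult[where m = n] mat_exp_conv_transpose Vconv
        mat_exp_conv_mono[OF F \<gamma>(3)] mat_exp_conv_mono[OF N \<gamma>(3)] less_imp_le[OF \<gamma>(1)])
  have "F0 * V_inf + V_inf * F0\<^sup>T + N0 = 0\<^sub>m n n"
  proof (rule eq_matI)
    fix i j assume "i < dim_row (0\<^sub>m n n)" "j < dim_col (0\<^sub>m n n)"
    then have ij: "i < n" "j < n" by auto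
    have "(F0 * V_inf + V_inf * F0\<^sup>T + N0) $$ (i, j) = 0"
    proof (rule exp_conv_derivative_limit[where f = "\<lambda>t. V t $$ (i, j)" and f' = "\<lambda>t. V' t $$ (i, j)"])
      show "((\<lambda>t. V t $$ (i, j)) has_real_derivative V' t $$ (i, j)) (at t within {0..})" if "t \<ge> 0" for t
        using V_ode ij that by (auto simp: has_mat_deriv_on_nonneg_def)
      show "exp_conv \<gamma> (\<lambda>t. V t $$ (i, j)) (V_inf $$ (i, j))"
        "exp_conv \<gamma> (\<lambda>t. V' t $$ (i, j)) ((F0 * V_inf + V_inf * F0\<^sup>T + N0) $$ (i, j))"
        using Vconv V'conv ij unfolding mat_exp_conv_def by blast+
    qed (fact \<gamma>(1))
    then show "(F0 * V_inf + V_inf * F0\<^sup>T + N0) $$ (i, j) = 0\<^sub>m n n $$ (i, j)" using ij by simp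
  qed (use Nc in auto)
  moreover have "mat_tendsto V V_inf"
    using Vconv Vi exp_conv_tendsto[OF _ \<gamma>(1)] by (auto simp: mat_tendsto_def mat_exp_conv_def)
  moreover have "mat_bounded_nonneg V n n"
    unfolding mat_bounded_nonneg_def using Ventry by blast
  ultimately show ?thesis using Vi by blast
qed

section \<open>Observability and stability of the closed loop\<close>

lemma index_mult_mat_sum:
  assumes "A \<in> carrier_mat n m" "B \<in> carrier_mat m k" "i < n" "j < k"
  shows "(A * B) $$ (i, j) = (\<Sum>l<m. A $$ (i, l) * B $$ (l, j))"
  using assms by (simp add: scalar_prod_def atLeast0LessThan)

lemma unit_if_injective:
  fixes M :: "'a :: field mat"
  assumes M: "M \<in> carrier_mat n n"
    and inj: "\<And>v. v \<in> carrier_vec n \<Longrightarrow> M *\<^sub>v v = 0\<^sub>v n \<Longrightarrow> v = 0\<^sub>v n"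
  shows "M \<in> Units (ring_mat TYPE('a) n b)"
  using det_0_iff_vec_prod_zero_field[OF M] inj det_non_zero_imp_unit[OF M] by metis

text \<open>Positive definiteness makes \<open>M\<close> injective, so \<open>mat_inverse\<close>
  returns an actual inverse and \<open>the\<close> is harmless. The form of \<open>S\<close> at
  \<open>x\<close> is that of \<open>M\<close> at \<open>S *\<^sub>v x\<close>, hence
  positive.\<close>

lemma pos_def_inverse:
  assumes "pos_def p M"
  defines "S \<equiv> the (mat_inverse M)"
  shows "S \<in> carrier_mat p p" "S\<^sup>T = S" "\<And>x. x \<in> carrier_vec p \<Longrightarrow> x \<noteq> 0\<^sub>v p \<Longrightarrow> qform S x > 0"
proof -
  have M: "M \<in> carrier_mat p p" "M\<^sup>T = M"
    and pos: "\<And>x. x \<in> carrier_vec p \<Longrightarrow> x \<noteq> 0\<^sub>v p \<Longrightarrow> qform M x > 0"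
    using assms(1) by (auto simp: pos_def_def)
  have "M \<in> Units (ring_mat TYPE(real) p ())"
  proof (rule unit_if_injective[OF M(1)])
    fix v :: "real vec" assume v: "v \<in> carrier_vec p" "M *\<^sub>v v = 0\<^sub>v p"
    then show "v = 0\<^sub>v p" using pos[OF v(1)] by fastforce
  qed
  then obtain S' where "mat_inverse M = Some S'"
    using mat_inverse(1)[OF M(1), where b = "()"] by (cases "mat_inverse M") auto
  then have inv: "M * S = 1\<^sub>m p" "S * M = 1\<^sub>m p" and S: "S \<in> carrier_mat p p"
    using mat_inverse(2)[OF M(1)] by (auto simp: S_def)
  show "S \<in> carrier_mat p p" by (fact S)
  have "S\<^sup>T * M = 1\<^sub>m p"
    using transpose_mult[OF M(1) S] inv(1) M(2) by simp
  then have "S\<^sup>T * M * S = S" using S by simp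
  then show "S\<^sup>T = S" using assoc_mult_mat[of "S\<^sup>T" p p M p S p] S M inv(1) by simp
  fix x :: "real vec" assume x: "x \<in> carrier_vec p" "x \<noteq> 0\<^sub>v p"
  define y where "y = S *\<^sub>v x"
  have y: "y \<in> carrier_vec p" using S x by (simp add: y_def)
  have My: "M *\<^sub>v y = x" using assoc_mult_mat_vec[OF M(1) S x(1)] inv(1) x by (simp add: y_def)
  then have "y \<noteq> 0\<^sub>v p" using x(2) M by auto
  from pos[OF y this] have "y \<bullet> x > 0" using My by simp
  then show "qform S x > 0" using comm_scalar_prod[OF x(1) y] by (simp add: y_def)
qed

text \<open>A maximal independent set of columns has \<open>n\<close> elements and forms an
  invertible matrix \<open>B\<close>; orthogonality puts \<open>x\<close> into the kernel of
  \<open>B\<^sup>T\<close>.\<close>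

lemma full_row_rank_orthogonal:
  fixes M :: "'a :: field mat"
  assumes M: "M \<in> carrier_mat n nc" and rank: "vec_space.rank n M = n"
    and x: "x \<in> carrier_vec n" and orth: "\<And>j. j < nc \<Longrightarrow> col M j \<bullet> x = 0"
  shows "x = 0\<^sub>v n"
proof -
  interpret vec_space "TYPE('a)" n .
  obtain S where S: "maximal S (\<lambda>T. T \<subseteq> set (cols M) \<and> lin_indpt T)"
    using maximal_exists_superset[of "set (cols M)" "\<lambda>T. T \<subseteq> set (cols M) \<and> lin_indpt T" "{}"]
    by (metis List.finite_set empty_subsetI finite_lin_indpt2 finite.emptyI ex_in_conv lin_dep_def subset_empty)
  then have sub: "S \<subseteq> set (cols M)" and li: "lin_indpt S" by (auto simp: maximal_def)
  have card: "card S = n" using rank_card_indpt[OF M S] rank by simp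
  obtain xs where xs: "set xs = S" "distinct xs"
    using finite_distinct_list[OF finite_subset[OF sub List.finite_set]] by blast
  have len: "length xs = n" using distinct_card[OF xs(2)] xs(1) card by simp
  have xc: "set xs \<subseteq> carrier_vec n" using sub xs cols_dim M by blast
  define B where "B = mat_of_cols n xs"
  have B: "B \<in> carrier_mat n n" "cols B = xs" using len xc by (auto simp: B_def cols_mat_of_cols)
  have "rank B = n" using lin_indpt_full_rank[OF B(1)] B(2) xs li by simp
  then have "det B \<noteq> 0" using det_rank_iff[OF B(1)] by simp
  then have det: "det (B\<^sup>T) \<noteq> 0" using det_transpose[OF B(1)] by simp
  have "B\<^sup>T *\<^sub>v x = 0\<^sub>v n"
  proof (rule eq_vecI)
    fix i assume "i < dim_vec (0\<^sub>v n :: 'a vec)"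
    then have i: "i < n" by simp
    have "xs ! i \<in> set (cols M)" using sub xs len i nth_mem by blast
    then obtain j where "j < nc" "xs ! i = col M j" using M by (auto simp: cols_def)
    then have "xs ! i \<bullet> x = 0" using orth by simp
    moreover have "col B i = xs ! i" using B len i by (metis carrier_matD(2) cols_nth)
    ultimately show "(B\<^sup>T *\<^sub>v x) $ i = 0\<^sub>v n $ i" using B i by simp
  qed (use B in simp)
  then show ?thesis using det det_0_iff_vec_prod_zero_field[of "B\<^sup>T" n] B x by auto
qed

text \<open>Complex eigenvectors appear as pairs \<open>(a, b)\<close> of real vectors, standing for \<open>a + i b\<close>.\<close>

lemma observable_no_hidden_eigenvector:
  assumes A: "A \<in> carrier_mat n n" and C: "C \<in> carrier_mat p n" and obs: "observable A C"
    and a: "a \<in> carrier_vec n" and b: "b \<in> carrier_vec n"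
    and eig: "A *\<^sub>v a = \<alpha> \<cdot>\<^sub>v a - \<beta> \<cdot>\<^sub>v b" "A *\<^sub>v b = \<beta> \<cdot>\<^sub>v a + \<alpha> \<cdot>\<^sub>v b"
    and C0: "C *\<^sub>v a = 0\<^sub>v p" "C *\<^sub>v b = 0\<^sub>v p"
  shows "a = 0\<^sub>v n \<and> b = 0\<^sub>v n"
proof -
  define T where "T = A\<^sup>T"
  have T: "T \<in> carrier_mat n n" using A by (simp add: T_def)
  \<comment> \<open>The real span of both parts is invariant under \<open>A\<close> and annihilated
    by \<open>C\<close>, so every column of the observability matrix is orthogonal to it.\<close>
  define Sp where "Sp = {s \<cdot>\<^sub>v a + t \<cdot>\<^sub>v b | s t. True}"
  have Spc: "x \<in> carrier_vec n" if "x \<in> Sp" for x using that a b by (auto simp: Sp_def)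
  have ASp: "A *\<^sub>v x \<in> Sp" if xS: "x \<in> Sp" for x
  proof -
    obtain s t where x: "x = s \<cdot>\<^sub>v a + t \<cdot>\<^sub>v b" using xS unfolding Sp_def by blast
    have "A *\<^sub>v x = s \<cdot>\<^sub>v (A *\<^sub>v a) + t \<cdot>\<^sub>v (A *\<^sub>v b)"
      using a b unfolding x by (simp add: mult_add_distrib_mat_vec[OF A] mult_mat_vec[OF A])
    also have "\<dots> = (s * \<alpha> + t * \<beta>) \<cdot>\<^sub>v a + (t * \<alpha> - s * \<beta>) \<cdot>\<^sub>v b"
      unfolding eig using a b by (intro eq_vecI) (auto simp: algebra_simps)
    finally show ?thesis by (auto simp: Sp_def)
  qed
  have CSp: "C *\<^sub>v x = 0\<^sub>v p" if xS: "x \<in> Sp" for x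
  proof -
    obtain s t where x: "x = s \<cdot>\<^sub>v a + t \<cdot>\<^sub>v b" using xS unfolding Sp_def by blast
    have "C *\<^sub>v x = s \<cdot>\<^sub>v 0\<^sub>v p + t \<cdot>\<^sub>v 0\<^sub>v p" unfolding x using a b C0
      by (simp add: mult_add_distrib_mat_vec[OF C] mult_mat_vec[OF C])
    also have "\<dots> = 0\<^sub>v p" by (intro eq_vecI) auto
    finally show ?thesis .
  qed
  \<comment> \<open>The witness \<open>y\<close> is obtained by applying \<open>A\<close> to
    \<open>x\<close> repeatedly; moving powers of the transpose across the product only uses that it
    stays in \<open>Sp\<close>.\<close>
  have pow: "\<exists>y\<in>Sp. \<forall>w\<in>carrier_vec n. (T ^\<^sub>m k *\<^sub>v w) \<bullet> x = w \<bullet> y" if "x \<in> Sp" for k x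
  proof (induction k)
    case 0
    then show ?case using that T by (intro bexI[of _ x]) auto
  next
    case (Suc k)
    then obtain y where y: "y \<in> Sp" "\<And>w. w \<in> carrier_vec n \<Longrightarrow> (T ^\<^sub>m k *\<^sub>v w) \<bullet> x = w \<bullet> y" by blast
    have "(T ^\<^sub>m Suc k *\<^sub>v w) \<bullet> x = w \<bullet> (A *\<^sub>v y)" if w: "w \<in> carrier_vec n" for w
    proof -
      have "T ^\<^sub>m Suc k *\<^sub>v w = T ^\<^sub>m k *\<^sub>v (T *\<^sub>v w)"
        using assoc_mult_mat_vec[OF pow_carrier_mat[OF T] T w] by simp
      then show ?thesis
        using y(2)[of "T *\<^sub>v w"] T w transpose_vec_mult_scalar[OF A Spc[OF y(1)] w] by (simp add: T_def)
    qed
    then show ?case using ASp[OF y(1)] by blast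
  qed
  define Om where "Om = ctrb_mat T (C\<^sup>T)"
  have Om: "Om \<in> carrier_mat n (n * p)" using T C by (simp add: Om_def ctrb_mat_def Let_def)
  have rank: "vec_space.rank n Om = n"
    using obs A unfolding observable_def controllable_def Om_def T_def by simp
  have "x = 0\<^sub>v n" if x: "x \<in> Sp" for x
  proof (rule full_row_rank_orthogonal[OF Om rank Spc[OF x]])
    fix j assume j: "j < n * p"
    then have p: "p > 0" by (cases p) auto
    \<comment> \<open>Column \<open>j\<close> belongs to the power \<open>j div p\<close> of
      \<open>T\<close> and to row \<open>j mod p\<close> of \<open>C\<close>.\<close>
    define k where "k = j div p"
    define l where "l = j mod p"
    have l: "l < p" using p by (simp add: l_def)
    have "col Om j = col (T ^\<^sub>m k * C\<^sup>T) l"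
      using T C j l by (intro eq_vecI) (auto simp: Om_def ctrb_mat_def Let_def k_def l_def)
    also have "\<dots> = T ^\<^sub>m k *\<^sub>v col (C\<^sup>T) l"
      using T C l by (intro col_mult2[of _ n n _ p]) auto
    finally have col: "col Om j = T ^\<^sub>m k *\<^sub>v col (C\<^sup>T) l" .
    obtain y where y: "y \<in> Sp" "\<And>w. w \<in> carrier_vec n \<Longrightarrow> (T ^\<^sub>m k *\<^sub>v w) \<bullet> x = w \<bullet> y" using pow[OF x] by blast
    have "col Om j \<bullet> x = col (C\<^sup>T) l \<bullet> y" unfolding col using C by (intro y(2) carrier_vecI) simp
    also have "\<dots> = (C *\<^sub>v y) $ l" using C l by simp
    also have "\<dots> = 0" using CSp[OF y(1)] l by simp
    finally show "col Om j \<bullet> x = 0" .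
  qed
  moreover have "a \<in> Sp" unfolding Sp_def using a b by (intro CollectI exI[of _ 1] exI[of _ 0]) auto
  moreover have "b \<in> Sp" unfolding Sp_def using a b by (intro CollectI exI[of _ 0] exI[of _ 1]) auto
  ultimately show ?thesis by blast
qed

text \<open>A matrix and its transpose share the characteristic polynomial, so it suffices to
  exclude left eigenvectors, which are the ones the Riccati equation speaks about. Real and
  imaginary parts of the eigenvector equation keep the argument within real matrices.\<close>

lemma stable_if_no_unstable_left_eigenvector:
  fixes F :: "real mat"
  assumes F: "F \<in> carrier_mat n n"
    and no: "\<And>a b \<alpha> \<beta>. a \<in> carrier_vec n \<Longrightarrow> b \<in> carrier_vec n \<Longrightarrow>
      F\<^sup>T *\<^sub>v a = \<alpha> \<cdot>\<^sub>v a - \<beta> \<cdot>\<^sub>v b \<Longrightarrow> F\<^sup>T *\<^sub>v b = \<beta> \<cdot>\<^sub>v a + \<alpha> \<cdot>\<^sub>v b \<Longrightarrow>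
      \<alpha> \<ge> 0 \<Longrightarrow> a = 0\<^sub>v n \<and> b = 0\<^sub>v n"
  shows "mat_stable F"
  unfolding mat_stable_def
proof (intro allI impI)
  fix z assume "eigenvalue (cmat F) z"
  then have "poly (char_poly (cmat F)) z = 0" using eigenvalue_root_char_poly[of "cmat F" n] F by simp
  then have "poly (char_poly ((cmat F)\<^sup>T)) z = 0" using char_poly_transpose_mat[of "cmat F" n] F by simp
  then have "eigenvalue ((cmat F)\<^sup>T) z"
    using eigenvalue_root_char_poly[of "(cmat F)\<^sup>T" n] F by simp
  then obtain w where w: "w \<in> carrier_vec n" "w \<noteq> 0\<^sub>v n" "(cmat F)\<^sup>T *\<^sub>v w = z \<cdot>\<^sub>v w"
    using F by (auto simp: eigenvalue_def eigenvector_def)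
  define a where "a = map_vec Re w"
  define b where "b = map_vec Im w"
  have ab: "a \<in> carrier_vec n" "b \<in> carrier_vec n" using w by (auto simp: a_def b_def)
  have entry: "(\<Sum>j<n. complex_of_real (F $$ (j, i)) * w $ j) = z * w $ i" if i: "i < n" for i
  proof -
    have "((cmat F)\<^sup>T *\<^sub>v w) $ i = z * w $ i" using w i by simp
    then show ?thesis using F w(1) i by (simp add: scalar_prod_def atLeast0LessThan)
  qed
  have "F\<^sup>T *\<^sub>v a = Re z \<cdot>\<^sub>v a - Im z \<cdot>\<^sub>v b"
  proof (rule eq_vecI)
    fix i assume "i < dim_vec (Re z \<cdot>\<^sub>v a - Im z \<cdot>\<^sub>v b)"
    then have i: "i < n" using ab by simp
    have "Re (\<Sum>j<n. complex_of_real (F $$ (j, i)) * w $ j) = Re (z * w $ i)" using entry[OF i] by simp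
    then show "(F\<^sup>T *\<^sub>v a) $ i = (Re z \<cdot>\<^sub>v a - Im z \<cdot>\<^sub>v b) $ i"
      using F w i by (simp add: scalar_prod_def atLeast0LessThan a_def b_def)
  qed (use F ab in simp)
  moreover have "F\<^sup>T *\<^sub>v b = Im z \<cdot>\<^sub>v a + Re z \<cdot>\<^sub>v b"
  proof (rule eq_vecI)
    fix i assume "i < dim_vec (Im z \<cdot>\<^sub>v a + Re z \<cdot>\<^sub>v b)"
    then have i: "i < n" using ab by simp
    have "Im (\<Sum>j<n. complex_of_real (F $$ (j, i)) * w $ j) = Im (z * w $ i)" using entry[OF i] by simp
    then show "(F\<^sup>T *\<^sub>v b) $ i = (Im z \<cdot>\<^sub>v a + Re z \<cdot>\<^sub>v b) $ i"
      using F w i by (simp add: scalar_prod_def atLeast0LessThan a_def b_def)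
  qed (use F ab in simp)
  moreover have "\<not> (a = 0\<^sub>v n \<and> b = 0\<^sub>v n)"
  proof
    assume "a = 0\<^sub>v n \<and> b = 0\<^sub>v n"
    then have "\<forall>i<n. Re (w $ i) = 0 \<and> Im (w $ i) = 0"
      using w(1) unfolding a_def b_def by (metis carrier_vecD index_map_vec(1) index_zero_vec(1))
    then have "w = 0\<^sub>v n" using w(1) by (intro eq_vecI) (auto simp: complex_eq_iff)
    with w(2) show False by simp
  qed
  ultimately show "Re z < 0" using no[OF ab] by (meson not_le)
qed

text \<open>If \<open>w\<close> is a left eigenvector of \<open>F = A - R Q\<close> for a nonnegative real part, the Lyapunov identity
  forces \<open>N w = 0\<close> and \<open>Q R w = 0\<close>; the Riccati equation then makes \<open>R w\<close> an eigenvector of \<open>A\<close>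
  that \<open>Q\<close> does not see.\<close>

lemma riccati_closed_loop_stable:
  fixes A N Q Rb :: "real mat"
  assumes car: "A \<in> carrier_mat n n" "N \<in> carrier_mat n n" "Q \<in> carrier_mat n n"
    and N: "N\<^sup>T = N" "\<And>v. v \<in> carrier_vec n \<Longrightarrow> qform N v \<ge> 0"
    and Q: "Q\<^sup>T = Q" "\<And>v. v \<in> carrier_vec n \<Longrightarrow> qform Q v \<ge> 0"
    and Rb: "pos_def n Rb"
    and are: "A * Rb + Rb * A\<^sup>T + N - Rb * Q * Rb = 0\<^sub>m n n"
    and obs: "\<And>a b \<alpha> \<beta>. a \<in> carrier_vec n \<Longrightarrow> b \<in> carrier_vec n \<Longrightarrow>
      A *\<^sub>v a = \<alpha> \<cdot>\<^sub>v a - \<beta> \<cdot>\<^sub>v b \<Longrightarrow> A *\<^sub>v b = \<beta> \<cdot>\<^sub>v a + \<alpha> \<cdot>\<^sub>v b \<Longrightarrow>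
      Q *\<^sub>v a = 0\<^sub>v n \<Longrightarrow> Q *\<^sub>v b = 0\<^sub>v n \<Longrightarrow> a = 0\<^sub>v n \<and> b = 0\<^sub>v n"
  shows "mat_stable (A - Rb * Q)"
proof -
  have Rbc: "Rb \<in> carrier_mat n n" "Rb\<^sup>T = Rb" using Rb by (auto simp: pos_def_def)
  have RQ: "Rb * Q \<in> carrier_mat n n" using Rbc car by auto
  have F: "A - Rb * Q \<in> carrier_mat n n" using RQ by (simp add: minus_carrier_mat)
  have FT: "(A - Rb * Q)\<^sup>T *\<^sub>v v = A\<^sup>T *\<^sub>v v - Q *\<^sub>v (Rb *\<^sub>v v)" if v: "v \<in> carrier_vec n" for v
  proof -
    have "(A - Rb * Q)\<^sup>T = A\<^sup>T - Q * Rb"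
      using transpose_minus_mat[OF car(1) RQ] transpose_mult[OF Rbc(1) car(3)] Q(1) Rbc(2) by simp
    then show ?thesis
      using minus_mult_distrib_mat_vec[of "A\<^sup>T" n n "Q * Rb" v] assoc_mult_mat_vec[OF car(3) Rbc(1) v] car Rbc v
      by simp
  qed
  \<comment> \<open>The algebraic equation in Lyapunov form: with the closed loop \<open>F\<close>,
    it reads \<open>F * Rb + Rb * F\<^sup>T = - N - Rb * Q * Rb\<close>.\<close>
  have lyap: "2 * (((A - Rb * Q)\<^sup>T *\<^sub>v v) \<bullet> (Rb *\<^sub>v v)) = - qform N v - qform Q (Rb *\<^sub>v v)"
    if v: "v \<in> carrier_vec n" for v
  proof -
    define x where "x = Rb *\<^sub>v v"
    have x: "x \<in> carrier_vec n" using Rbc v by (simp add: x_def)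
    have Qx: "Q *\<^sub>v x \<in> carrier_vec n" using car x by simp
    have Av: "A\<^sup>T *\<^sub>v v \<in> carrier_vec n" using car v by simp
    have "((A - Rb * Q)\<^sup>T *\<^sub>v v) \<bullet> x = v \<bullet> (A *\<^sub>v x) - qform Q x"
      unfolding FT[OF v] x_def[symmetric] using minus_scalar_prod_distrib[OF Av Qx x]
        transpose_vec_mult_scalar[OF car(1) x v] comm_scalar_prod[OF Qx x] by simp
    moreover have "0 = 2 * (v \<bullet> (A *\<^sub>v x)) + qform N v - qform Q x"
      using riccati_quadform[OF car(1) Rbc(1) car(2,3) Rbc(2) v] quadform_zero[OF v]
      unfolding are by (simp add: x_def)
    ultimately show ?thesis by (simp add: x_def)
  qed
  \<comment> \<open>Where \<open>N\<close> and \<open>Q\<close> drop out, the equation reduces to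
    this identity. The eigenvalue changes sign, which does no harm: \<open>obs\<close> excludes
    hidden eigenvectors for every eigenvalue.\<close>
  have ker: "A *\<^sub>v (Rb *\<^sub>v v) = (- 1) \<cdot>\<^sub>v (Rb *\<^sub>v ((A - Rb * Q)\<^sup>T *\<^sub>v v))"
    if v: "v \<in> carrier_vec n" and Nv: "N *\<^sub>v v = 0\<^sub>v n" and Qv: "Q *\<^sub>v (Rb *\<^sub>v v) = 0\<^sub>v n" for v
  proof -
    have Av: "A\<^sup>T *\<^sub>v v \<in> carrier_vec n" using car v by simp
    have F': "(A - Rb * Q)\<^sup>T *\<^sub>v v = A\<^sup>T *\<^sub>v v" unfolding FT[OF v] Qv using Av by simp
    have "(A * Rb + Rb * A\<^sup>T + N - Rb * Q * Rb) *\<^sub>v v =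
        A *\<^sub>v (Rb *\<^sub>v v) + Rb *\<^sub>v (A\<^sup>T *\<^sub>v v) + N *\<^sub>v v - Rb *\<^sub>v (Q *\<^sub>v (Rb *\<^sub>v v))"
      using car Rbc v
      by (simp add: minus_mult_distrib_mat_vec[where nr=n and nc=n] add_mult_distrib_mat_vec[where nr=n and nc=n]
        assoc_mult_mat_vec[where n\<^sub>1=n and n\<^sub>2=n and n\<^sub>3=n])
    moreover have "Rb *\<^sub>v 0\<^sub>v n = 0\<^sub>v n" using Rbc by (intro eq_vecI) auto
    moreover have "0\<^sub>m n n *\<^sub>v v = 0\<^sub>v n" using v by (intro eq_vecI) auto
    ultimately have eq: "0\<^sub>v n = A *\<^sub>v (Rb *\<^sub>v v) + Rb *\<^sub>v (A\<^sup>T *\<^sub>v v) + 0\<^sub>v n - 0\<^sub>v n"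
      unfolding are Nv Qv by simp
    show ?thesis unfolding F'
    proof (rule eq_vecI)
      fix i assume "i < dim_vec ((- 1) \<cdot>\<^sub>v (Rb *\<^sub>v (A\<^sup>T *\<^sub>v v)))"
      then have i: "i < n" using Rbc by simp
      have "(0\<^sub>v n :: real vec) $ i = (A *\<^sub>v (Rb *\<^sub>v v) + Rb *\<^sub>v (A\<^sup>T *\<^sub>v v) + 0\<^sub>v n - 0\<^sub>v n) $ i" using eq by simp
      then have "0 = (A *\<^sub>v (Rb *\<^sub>v v)) $ i + (Rb *\<^sub>v (A\<^sup>T *\<^sub>v v)) $ i"
        using i car Rbc by simp
      then show "(A *\<^sub>v (Rb *\<^sub>v v)) $ i = ((- 1) \<cdot>\<^sub>v (Rb *\<^sub>v (A\<^sup>T *\<^sub>v v))) $ i" using i Rbc by simp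
    qed (use car Rbc in simp)
  qed
  show ?thesis
  proof (rule stable_if_no_unstable_left_eigenvector[OF F])
    fix a b :: "real vec" and \<alpha> \<beta> :: real
    assume a: "a \<in> carrier_vec n" and b: "b \<in> carrier_vec n" and \<alpha>: "\<alpha> \<ge> 0"
      and Fa: "(A - Rb * Q)\<^sup>T *\<^sub>v a = \<alpha> \<cdot>\<^sub>v a - \<beta> \<cdot>\<^sub>v b"
      and Fb: "(A - Rb * Q)\<^sup>T *\<^sub>v b = \<beta> \<cdot>\<^sub>v a + \<alpha> \<cdot>\<^sub>v b"
    define x where "x = Rb *\<^sub>v a"
    define y where "y = Rb *\<^sub>v b"
    have x: "x \<in> carrier_vec n" and y: "y \<in> carrier_vec n" using Rbc a b by (auto simp: x_def y_def)
    have ay: "b \<bullet> x = a \<bullet> y" unfolding x_def y_def by (rule scalar_prod_symmetric_mat[OF Rbc b a])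
    have nn: "a \<bullet> x \<ge> 0" "b \<bullet> y \<ge> 0"
      using Rb a b by (cases "a = 0\<^sub>v n"; cases "b = 0\<^sub>v n"; force simp: pos_def_def x_def y_def intro: less_imp_le)+
    \<comment> \<open>Adding the contributions of real and imaginary part cancels the terms with
      \<open>\<beta>\<close>, by symmetry of \<open>Rb\<close>. What remains is nonnegative, whereas
      \<open>lyap\<close> makes it nonpositive.\<close>
    have "(\<alpha> \<cdot>\<^sub>v a - \<beta> \<cdot>\<^sub>v b) \<bullet> x + (\<beta> \<cdot>\<^sub>v a + \<alpha> \<cdot>\<^sub>v b) \<bullet> y = \<alpha> * (a \<bullet> x + b \<bullet> y)"
      using a b x y ay by (simp add: minus_scalar_prod_distrib[where n=n] add_scalar_prod_distrib[where n=n] algebra_simps)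
    moreover have "\<alpha> * (a \<bullet> x + b \<bullet> y) \<ge> 0" using \<alpha> nn by simp
    moreover have "qform N a \<ge> 0" "qform N b \<ge> 0" "qform Q x \<ge> 0" "qform Q y \<ge> 0"
      using N(2) Q(2) a b x y by auto
    ultimately have z: "qform N a = 0" "qform N b = 0" "qform Q x = 0" "qform Q y = 0"
      using lyap[OF a, unfolded Fa, folded x_def] lyap[OF b, unfolded Fb, folded y_def] by linarith+
    have Nz: "N *\<^sub>v a = 0\<^sub>v n" "N *\<^sub>v b = 0\<^sub>v n" and Qz: "Q *\<^sub>v x = 0\<^sub>v n" "Q *\<^sub>v y = 0\<^sub>v n"
      using semidef_null_vector[OF car(2) N a z(1)] semidef_null_vector[OF car(2) N b z(2)]
        semidef_null_vector[OF car(3) Q x z(3)] semidef_null_vector[OF car(3) Q y z(4)] by blast+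
    have Rab: "Rb *\<^sub>v (\<alpha> \<cdot>\<^sub>v a - \<beta> \<cdot>\<^sub>v b) = \<alpha> \<cdot>\<^sub>v x - \<beta> \<cdot>\<^sub>v y" "Rb *\<^sub>v (\<beta> \<cdot>\<^sub>v a + \<alpha> \<cdot>\<^sub>v b) = \<beta> \<cdot>\<^sub>v x + \<alpha> \<cdot>\<^sub>v y"
      using a b Rbc by (simp_all add: x_def y_def mult_minus_distrib_mat_vec[OF Rbc(1)] mult_add_distrib_mat_vec[OF Rbc(1)] mult_mat_vec[OF Rbc(1)])
    have "A *\<^sub>v x = (- \<alpha>) \<cdot>\<^sub>v x - (- \<beta>) \<cdot>\<^sub>v y"
      using ker[OF a Nz(1) Qz(1)[unfolded x_def]] unfolding Fa Rab x_def[symmetric]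
      using x y by (auto intro!: eq_vecI)
    moreover have "A *\<^sub>v y = (- \<beta>) \<cdot>\<^sub>v x + (- \<alpha>) \<cdot>\<^sub>v y"
      using ker[OF b Nz(2) Qz(2)[unfolded y_def]] unfolding Fb Rab y_def[symmetric]
      using x y by (auto intro!: eq_vecI)
    ultimately have "x = 0\<^sub>v n \<and> y = 0\<^sub>v n" using obs[OF x y] Qz by blast
    then have "qform Rb a = 0" "qform Rb b = 0" using a b by (simp_all add: x_def y_def)
    then show "a = 0\<^sub>v n \<and> b = 0\<^sub>v n" using Rb a b unfolding pos_def_def by (metis less_irrefl)
  qed
qed

section \<open>Block structure at an equilibrium\<close>

lemma char_poly_four_block_upper:
  fixes A1 :: "'a :: idom mat"
  assumes A1: "A1 \<in> carrier_mat r r" and A2: "A2 \<in> carrier_mat r m" and A4: "A4 \<in> carrier_mat m m"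
  shows "char_poly (four_block_mat A1 A2 (0\<^sub>m m r) A4) = char_poly A1 * char_poly A4"
proof -
  have "char_poly_matrix (four_block_mat A1 A2 (0\<^sub>m m r) A4)
      = four_block_mat (char_poly_matrix A1) (map_mat (\<lambda>a. [:- a:]) A2) (0\<^sub>m m r) (char_poly_matrix A4)"
    unfolding char_poly_matrix_def
    by (rule eq_matI) (use A1 A2 A4 in \<open>auto simp: one_poly_def\<close>)
  then show ?thesis
    unfolding char_poly_def
    using det_four_block_mat_lower_left_zero[of "char_poly_matrix A1" r "map_mat (\<lambda>a. [:- a:]) A2" m "0\<^sub>m m r" "char_poly_matrix A4"]
      A1 A2 A4 by simp
qed

lemma Units_ring_matE:
  assumes "M \<in> Units (ring_mat TYPE('a :: field) n b)"
  obtains Mi where "Mi \<in> carrier_mat n n" "M * Mi = 1\<^sub>m n" "Mi * M = 1\<^sub>m n"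
  using assms by (auto simp: Units_def ring_mat_simps)

text \<open>\<open>U\<close> spans the same space as the first \<open>r\<close> columns of \<open>Psi\<close>. Replacing these columns of
  \<open>Psi\<close> by \<open>U\<close> gives the basis \<open>S = Psi E\<close>, in which \<open>A\<close> and \<open>A - U L\<close> are block triangular.\<close>

lemma equilibrium_block_structure:
  fixes A Psi Pi U UL L :: "complex mat"
  assumes car: "A \<in> carrier_mat n n" "Psi \<in> carrier_mat n n" "Pi \<in> carrier_mat n n"
      "U \<in> carrier_mat n r" "UL \<in> carrier_mat r n" "L \<in> carrier_mat r n"
    and inv: "Psi * Pi = 1\<^sub>m n" "Pi * Psi = 1\<^sub>m n" and rn: "r \<le> n"
    and J: "Pi * A * Psi = J" "upper_triangular J"
    and UL: "UL * U = 1\<^sub>m r"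
    and low: "\<And>i j. r \<le> i \<Longrightarrow> i < n \<Longrightarrow> j < r \<Longrightarrow> (Pi * U) $$ (i, j) = 0"
  shows "A * U = U * (UL * A * U)"
    and "char_poly (A - U * L) = char_poly (UL * A * U - L * U) * (\<Prod>i\<leftarrow>[r..<n]. [:- J $$ (i, i), 1:])"
proof -
  define X where "X = Pi * U"
  have X: "X \<in> carrier_mat n r" using car by (simp add: X_def)
  have Jc: "J \<in> carrier_mat n n" using car J(1) by auto
  have PX: "Psi * X = U"
    unfolding X_def using assoc_mult_mat[OF car(2,3,4)] inv(1) car(4) by simp
  define E where "E = mat n n (\<lambda>(i, j). if j < r then X $$ (i, j) else if i = j then 1 else 0)"
  have E: "E \<in> carrier_mat n n" by (simp add: E_def)
  have Ejr: "E $$ (i, j) = X $$ (i, j)" if "i < n" "j < r" for i j using that rn by (simp add: E_def)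
  have Elow: "E $$ (i, j) = (if i = j then 1 else 0)" if "i < n" "j < n" "r \<le> i" for i j
    using that low by (auto simp: E_def X_def simp del: index_mult_mat)
  \<comment> \<open>The first \<open>r\<close> columns of the identity; multiplying by it on the
    right selects columns, so that \<open>S * I1 = U\<close> below.\<close>
  define I1 where "I1 = mat n r (\<lambda>(i, j). if i = j then 1 else (0 :: complex))"
  have I1: "I1 \<in> carrier_mat n r" by (simp add: I1_def)
  have multI1: "(M * I1) $$ (i, j) = M $$ (i, j)" if "M \<in> carrier_mat k n" "i < k" "j < r" for M k i j
  proof -
    have "(M * I1) $$ (i, j) = (\<Sum>l<n. M $$ (i, l) * I1 $$ (l, j))"
      by (rule index_mult_mat_sum[OF that(1) I1 that(2,3)])
    also have "\<dots> = (\<Sum>l<n. if l = j then M $$ (i, l) else 0)"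
      using that by (intro sum.cong) (auto simp: I1_def)
    also have "\<dots> = M $$ (i, j)" using that rn by simp
    finally show ?thesis .
  qed
  have EI1: "E * I1 = X"
    using E X I1 multI1[OF E] Ejr by (intro eq_matI) (auto simp del: index_mult_mat(1))
  \<comment> \<open>By \<open>low\<close> the rows of \<open>E\<close> from index \<open>r\<close>
    on are those of the identity, and its first \<open>r\<close> columns are independent because
    \<open>U\<close> has a left inverse.\<close>
  have "E \<in> Units (ring_mat TYPE(complex) n ())"
  proof (rule unit_if_injective[OF E])
    fix v :: "complex vec" assume v: "v \<in> carrier_vec n" "E *\<^sub>v v = 0\<^sub>v n"
    have Ev: "(\<Sum>j<n. E $$ (i, j) * v $ j) = 0" if "i < n" for i
    proof -
      have "(E *\<^sub>v v) $ i = 0" using v(2) that by simp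
      then show ?thesis using E v(1) that by (simp add: scalar_prod_def atLeast0LessThan)
    qed
    have vlow: "v $ i = 0" if "r \<le> i" "i < n" for i
    proof -
      have "(\<Sum>j<n. E $$ (i, j) * v $ j) = (\<Sum>j<n. if j = i then v $ j else 0)"
        using that Elow by (intro sum.cong) auto
      then show ?thesis using Ev[of i] that by simp
    qed
    define w where "w = Matrix.vec r (\<lambda>i. v $ i)"
    have w: "w \<in> carrier_vec r" by (simp add: w_def)
    have "X *\<^sub>v w = 0\<^sub>v n"
    proof (rule eq_vecI)
      fix i assume "i < dim_vec (0\<^sub>v n :: complex vec)"
      then have i: "i < n" by simp
      have "0 = (\<Sum>j\<in>{..<r} \<union> {r..<n}. E $$ (i, j) * v $ j)"
        using Ev[OF i] rn by (simp add: ivl_disj_un)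
      also have "\<dots> = (\<Sum>j<r. E $$ (i, j) * v $ j) + (\<Sum>j\<in>{r..<n}. E $$ (i, j) * v $ j)"
        by (rule sum.union_disjoint) auto
      also have "(\<Sum>j\<in>{r..<n}. E $$ (i, j) * v $ j) = 0" using vlow by (intro sum.neutral) auto
      also have "(\<Sum>j<r. E $$ (i, j) * v $ j) = (X *\<^sub>v w) $ i"
        using X i Ejr[OF i] by (simp add: scalar_prod_def atLeast0LessThan w_def)
      finally show "(X *\<^sub>v w) $ i = 0\<^sub>v n $ i" using i by simp
    qed (use X in simp)
    then have "U *\<^sub>v w = Psi *\<^sub>v 0\<^sub>v n" using assoc_mult_mat_vec[OF car(2) X w] PX by simp
    also have "\<dots> = 0\<^sub>v n" using car by (intro eq_vecI) auto
    finally have "UL *\<^sub>v (U *\<^sub>v w) = UL *\<^sub>v 0\<^sub>v n" by simp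
    also have "\<dots> = 0\<^sub>v r" using car by (intro eq_vecI) auto
    finally have "w = 0\<^sub>v r" using assoc_mult_mat_vec[OF car(5,4) w] UL w by simp
    then have "v $ i = 0" if "i < r" for i using that by (metis w_def index_vec index_zero_vec(1))
    then show "v = 0\<^sub>v n" using v(1) vlow by (intro eq_vecI) (auto simp: not_less[symmetric])
  qed
  then obtain Ei where Ei: "Ei \<in> carrier_mat n n" "E * Ei = 1\<^sub>m n" "Ei * E = 1\<^sub>m n" by (rule Units_ring_matE)
  have Eilow: "Ei $$ (i, j) = (if i = j then 1 else 0)" if "i < n" "j < n" "r \<le> i" for i j
  proof -
    have "(E * Ei) $$ (i, j) = (\<Sum>l<n. E $$ (i, l) * Ei $$ (l, j))"
      by (rule index_mult_mat_sum[OF E Ei(1) that(1,2)])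
    also have "\<dots> = (\<Sum>l<n. if l = i then Ei $$ (l, j) else 0)"
      using that Elow by (intro sum.cong) auto
    finally show ?thesis using Ei(2) that by simp
  qed
  define S where "S = Psi * E"
  define Si where "Si = Ei * Pi"
  have S: "S \<in> carrier_mat n n" "Si \<in> carrier_mat n n" using car E Ei by (auto simp: S_def Si_def)
  have SSi: "S * Si = 1\<^sub>m n"
  proof -
    have "S * Si = Psi * (E * (Ei * Pi))" unfolding S_def Si_def using car E Ei by (intro assoc_mult_mat) auto
    also have "E * (Ei * Pi) = Pi" using assoc_mult_mat[OF E Ei(1) car(3)] Ei(2) car by simp
    finally show ?thesis using inv by simp
  qed
  have SiS: "Si * S = 1\<^sub>m n" using mat_mult_left_right_inverse[OF S SSi] .
  have SI1: "S * I1 = U" unfolding S_def using assoc_mult_mat[OF car(2) E I1] EI1 PX by simp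
  have SiU: "Si * U = I1"
    unfolding SI1[symmetric] using assoc_mult_mat[OF S(2,1) I1] SiS I1 by simp
  define B where "B = Si * A * S"
  have B: "B \<in> carrier_mat n n" using S car by (simp add: B_def)
  \<comment> \<open>The last rows of \<open>E\<close> and of its inverse are those of the identity
    and \<open>J\<close> is upper triangular, so the change of basis from \<open>Psi\<close> to
    \<open>S\<close> leaves the last rows of \<open>J\<close> as they are.\<close>
  have Blow: "B $$ (i, j) = (if j < r then 0 else J $$ (i, j))" if ij: "i < n" "j < n" "r \<le> i" for i j
  proof -
    have "B = Ei * Pi * A * (Psi * E)" by (simp add: B_def S_def Si_def)
    also have "\<dots> = Ei * (Pi * A * Psi * E)"
    proof -
      have "Ei * Pi * A * (Psi * E) = Ei * (Pi * A) * (Psi * E)" using assoc_mult_mat[OF Ei(1) car(3,1)] by simp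
      also have "\<dots> = Ei * (Pi * A * (Psi * E))" using car E Ei by (intro assoc_mult_mat[where n\<^sub>2 = n and n\<^sub>3 = n]) auto
      also have "Pi * A * (Psi * E) = Pi * A * Psi * E"
        using car E by (intro assoc_mult_mat[symmetric, where n\<^sub>2 = n and n\<^sub>3 = n]) auto
      finally show ?thesis .
    qed
    finally have "B $$ (i, j) = (Ei * (J * E)) $$ (i, j)" using J(1) by simp
    also have "\<dots> = (\<Sum>l<n. Ei $$ (i, l) * (J * E) $$ (l, j))"
      using Ei Jc E ij by (intro index_mult_mat_sum) auto
    also have "\<dots> = (\<Sum>l<n. if l = i then (J * E) $$ (l, j) else 0)"
      using Eilow ij by (intro sum.cong) auto
    also have "\<dots> = (J * E) $$ (i, j)" using ij by simp
    also have "\<dots> = (\<Sum>l<n. J $$ (i, l) * E $$ (l, j))" by (rule index_mult_mat_sum[OF Jc E ij(1,2)])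
    also have "\<dots> = (\<Sum>l<n. if l = j then (if j < r then 0 else J $$ (i, j)) else 0)"
    proof (intro sum.cong refl)
      fix l assume "l \<in> {..<n}"
      then have l: "l < n" by simp
      show "J $$ (i, l) * E $$ (l, j) = (if l = j then (if j < r then 0 else J $$ (i, j)) else 0)"
      proof (cases "l < r")
        case True
        then have "J $$ (i, l) = 0" using J(2) Jc ij by auto
        then show ?thesis using True ij by auto
      next
        case False
        then show ?thesis using Elow[of l j] l ij by auto
      qed
    qed
    finally show ?thesis using ij by simp
  qed
  define B1 where "B1 = mat r r (\<lambda>p. B $$ p)"
  have B1: "B1 \<in> carrier_mat r r" by (simp add: B1_def)
  have BI1: "B * I1 = I1 * B1"
  proof (rule eq_matI)
    fix i j assume "i < dim_row (I1 * B1)" "j < dim_col (I1 * B1)"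
    then have ij: "i < n" "j < r" using I1 B1 by auto
    have "(I1 * B1) $$ (i, j) = (\<Sum>l<r. I1 $$ (i, l) * B1 $$ (l, j))"
      by (rule index_mult_mat_sum[OF I1 B1 ij])
    also have "\<dots> = (\<Sum>l<r. if l = i then B $$ (l, j) else 0)"
      using ij by (intro sum.cong) (auto simp: I1_def B1_def)
    also have "\<dots> = B $$ (i, j)" using Blow[of i j] ij rn by (auto simp: sum.delta)
    finally show "(B * I1) $$ (i, j) = (I1 * B1) $$ (i, j)" using multI1[OF B ij] by simp
  qed (use B I1 B1 in auto)
  have SB: "S * B = A * S"
  proof -
    have "S * B = S * (Si * (A * S))"
      unfolding B_def using assoc_mult_mat[OF S(2) car(1) S(1)] by simp
    also have "\<dots> = S * Si * (A * S)" using S car by (intro assoc_mult_mat[symmetric]) auto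
    finally show ?thesis using SSi S car by simp
  qed
  have AU: "A * U = U * B1"
  proof -
    have "A * U = A * S * I1" unfolding SI1[symmetric] using assoc_mult_mat[OF car(1) S(1) I1] by simp
    also have "\<dots> = S * (I1 * B1)" unfolding SB[symmetric] BI1[symmetric] by (rule assoc_mult_mat[OF S(1) B I1])
    also have "\<dots> = U * B1" unfolding SI1[symmetric] by (rule assoc_mult_mat[OF S(1) I1 B1, symmetric])
    finally show ?thesis .
  qed
  have ULAU: "UL * A * U = B1"
  proof -
    have "UL * A * U = UL * (U * B1)" unfolding AU[symmetric] by (rule assoc_mult_mat[OF car(5,1,4)])
    also have "\<dots> = UL * U * B1" by (rule assoc_mult_mat[OF car(5,4) B1, symmetric])
    finally show ?thesis using UL B1 by simp
  qed
  show "A * U = U * (UL * A * U)" unfolding ULAU by (fact AU)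
  define D where "D = Si * (A - U * L) * S"
  have ULc: "U * L \<in> carrier_mat n n" using car by auto
  have Acl: "A - U * L \<in> carrier_mat n n" using ULc by (simp add: minus_carrier_mat)
  have LS: "L * S \<in> carrier_mat r n" using car S by auto
  have Dc: "D \<in> carrier_mat n n" using S Acl by (simp add: D_def)
  \<comment> \<open>Since \<open>Si * U = I1\<close>, the feedback reaches only the first
    \<open>r\<close> rows, and the last diagonal block stays that of \<open>J\<close>.\<close>
  have Dexp: "D = B - I1 * (L * S)"
  proof -
    have "D = (Si * A - Si * (U * L)) * S"
      unfolding D_def using mult_minus_distrib_mat[OF S(2) car(1) ULc] by simp
    also have "\<dots> = Si * A * S - Si * (U * L) * S"
      using S car ULc by (intro minus_mult_distrib_mat) auto
    also have "Si * (U * L) * S = Si * U * L * S" using assoc_mult_mat[OF S(2) car(4,6)] by simp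
    also have "\<dots> = I1 * (L * S)" unfolding SiU by (rule assoc_mult_mat[OF I1 car(6) S(1)])
    finally show ?thesis by (simp add: B_def)
  qed
  have I1LS: "(I1 * (L * S)) $$ (i, j) = (if i < r then (L * S) $$ (i, j) else 0)" if ij: "i < n" "j < n" for i j
  proof -
    have "(I1 * (L * S)) $$ (i, j) = (\<Sum>l<r. I1 $$ (i, l) * (L * S) $$ (l, j))"
      by (rule index_mult_mat_sum[OF I1 LS ij])
    also have "\<dots> = (\<Sum>l<r. if l = i then (L * S) $$ (l, j) else 0)"
      using ij by (intro sum.cong) (auto simp: I1_def)
    finally show ?thesis by (simp add: sum.delta)
  qed
  have LU: "(L * U) $$ (i, j) = (L * S) $$ (i, j)" if "i < r" "j < r" for i j
  proof -
    have "L * U = L * S * I1" unfolding SI1[symmetric] using assoc_mult_mat[OF car(6) S(1) I1] by simp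
    then show ?thesis using multI1[OF LS that] by simp
  qed
  have LUc: "L * U \<in> carrier_mat r r" using car by auto
  have BL: "B1 - L * U \<in> carrier_mat r r" using LUc by (simp add: minus_carrier_mat)
  define Y where "Y = mat r (n - r) (\<lambda>(i, j). D $$ (i, j + r))"
  define J4 where "J4 = mat (n - r) (n - r) (\<lambda>(i, j). J $$ (i + r, j + r))"
  have J4c: "J4 \<in> carrier_mat (n - r) (n - r)" by (simp add: J4_def)
  have Dblock: "D = four_block_mat (B1 - L * U) Y (0\<^sub>m (n - r) r) J4"
  proof (rule eq_matI)
    let ?R = "four_block_mat (B1 - L * U) Y (0\<^sub>m (n - r) r) J4"
    have dims: "dim_row ?R = n" "dim_col ?R = n" using LUc rn by (auto simp: J4_def)
    show "dim_row D = dim_row ?R" "dim_col D = dim_col ?R" unfolding dims using Dc by auto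
    fix i j assume "i < dim_row ?R" "j < dim_col ?R"
    then have ij: "i < n" "j < n" unfolding dims by auto
    have Dij: "D $$ (i, j) = B $$ (i, j) - (if i < r then (L * S) $$ (i, j) else 0)"
      unfolding Dexp I1LS[OF ij, symmetric] using B I1 LS ij by (intro index_minus_mat(1)) auto
    have R: "?R $$ (i, j) = (if i < r then if j < r then (B1 - L * U) $$ (i, j) else Y $$ (i, j - r)
        else if j < r then 0 else J4 $$ (i - r, j - r))"
      using ij BL J4c rn by (subst index_mat_four_block(1)) (simp_all del: index_minus_mat)
    show "D $$ (i, j) = ?R $$ (i, j)"
    proof (cases "i < r")
      case True
      show ?thesis
      proof (cases "j < r")
        case True
        have "(B1 - L * U) $$ (i, j) = B $$ (i, j) - (L * S) $$ (i, j)"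
          using \<open>i < r\<close> True LUc LU[OF \<open>i < r\<close> True] by (subst index_minus_mat(1)) (auto simp: B1_def simp del: index_mult_mat(1))
        then show ?thesis unfolding R Dij using \<open>i < r\<close> True by simp
      next
        case False
        then show ?thesis unfolding R using \<open>i < r\<close> ij by (simp add: Y_def)
      qed
    next
      case False
      then show ?thesis unfolding R Dij using Blow[OF ij] ij by (auto simp: J4_def)
    qed
  qed
  have "A - U * L = S * D * Si"
  proof -
    have "S * D * Si = S * (D * Si)" by (rule assoc_mult_mat[OF S(1) Dc S(2)])
    also have "D * Si = Si * (A - U * L)"
      unfolding D_def using assoc_mult_mat[of "Si * (A - U * L)" n n S n Si n] S Acl SSi by auto
    also have "S * (Si * (A - U * L)) = S * Si * (A - U * L)" by (rule assoc_mult_mat[OF S Acl, symmetric])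
    finally show ?thesis unfolding SSi left_mult_one_mat[OF Acl] by simp
  qed
  then have "similar_mat (A - U * L) D"
    unfolding similar_mat_def similar_mat_wit_def Let_def using Acl S Dc SSi SiS car(4,6)
    by (intro exI[of _ S] exI[of _ Si]) auto
  then have "char_poly (A - U * L) = char_poly D" by (rule char_poly_similar)
  also have "\<dots> = char_poly (B1 - L * U) * char_poly J4"
    unfolding Dblock using LUc by (intro char_poly_four_block_upper) (auto simp: Y_def J4_def minus_carrier_mat)
  also have "char_poly J4 = (\<Prod>i\<leftarrow>[r..<n]. [:- J $$ (i, i), 1:])"
  proof -
    have J4: "J4 \<in> carrier_mat (n - r) (n - r)" by (simp add: J4_def)
    have "upper_triangular J4" using J(2) Jc by (auto simp: J4_def upper_triangular_def)
    then have "char_poly J4 = (\<Prod>a\<leftarrow>diag_mat J4. [:- a, 1:])" by (rule char_poly_upper_triangular[OF J4])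
    also have "map (\<lambda>a. [:- a, 1:]) (diag_mat J4) = map (\<lambda>i. [:- J $$ (i, i), 1:]) [r..<n]"
      using rn by (intro nth_equalityI) (auto simp: diag_mat_def J4_def add.commute)
    finally show ?thesis .
  qed
  finally show "char_poly (A - U * L) = char_poly (UL * A * U - L * U) * (\<Prod>i\<leftarrow>[r..<n]. [:- J $$ (i, i), 1:])"
    unfolding ULAU .
qed

section \<open>Counting unstable eigenvalues on the diagonal of a triangular form\<close>

lemma eig_mset_triangular:
  fixes A :: "real mat"
  assumes "similar_mat (cmat A) J" "J \<in> carrier_mat n n" "upper_triangular J"
  shows "eig_mset A = mset (diag_mat J)"
proof -
  have "char_poly (cmat A) = (\<Prod>a\<leftarrow>diag_mat J. [:- a, 1:])"
    using char_poly_similar[OF assms(1)] char_poly_upper_triangular[OF assms(2,3)] by simp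
  moreover have "proots (\<Prod>a\<leftarrow>as. [:- a, 1:]) = mset as" for as :: "complex list"
  proof (induction as)
    case (Cons a as)
    have "(\<Prod>a\<leftarrow>as. [:- a, 1:]) \<noteq> 0" by (auto simp: prod_list_zero_iff)
    then have "proots ([:- a, 1:] * (\<Prod>a\<leftarrow>as. [:- a, 1:])) = {#a#} + mset as"
      using Cons by (subst proots_mult) auto
    then show ?case by (simp del: mult_pCons_left)
  qed simp
  ultimately show ?thesis by (simp add: eig_mset_def)
qed

text \<open>In a nonincreasing list the nonnegative entries form an initial segment, so its length
  is decided by the sign at the 0-based index \<open>r\<close>, the place of the eigenvalue after
  the \<open>r\<close>-th.\<close>

lemma filter_sorted_length_le_iff:
  fixes ds :: "real list"
  assumes "sorted_wrt (\<ge>) ds"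
  shows "length (filter (\<lambda>x. x \<ge> 0) ds) \<le> r \<longleftrightarrow> (\<forall>i. r \<le> i \<longrightarrow> i < length ds \<longrightarrow> ds ! i < 0)"
proof
  assume le: "length (filter (\<lambda>x. x \<ge> 0) ds) \<le> r"
  show "\<forall>i. r \<le> i \<longrightarrow> i < length ds \<longrightarrow> ds ! i < 0"
  proof (intro allI impI, rule ccontr)
    fix i assume i: "r \<le> i" "i < length ds" "\<not> ds ! i < 0"
    have "ds ! j \<ge> 0" if "j \<le> i" for j
    proof (cases "j = i")
      case False
      then have "ds ! j \<ge> ds ! i" using assms i that sorted_wrt_nth_less[of "(\<ge>)" ds j i] by simp
      then show ?thesis using i by simp
    qed (use i in simp)
    then have "{..i} \<subseteq> {j. j < length ds \<and> ds ! j \<ge> 0}" using i by auto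
    then have "card {..i} \<le> card {j. j < length ds \<and> ds ! j \<ge> 0}" by (intro card_mono) auto
    then show False using le i by (simp add: length_filter_conv_card)
  qed
next
  assume neg: "\<forall>i. r \<le> i \<longrightarrow> i < length ds \<longrightarrow> ds ! i < 0"
  then have "{j. j < length ds \<and> ds ! j \<ge> 0} \<subseteq> {..<r}" by (force simp: not_less[symmetric])
  then have "card {j. j < length ds \<and> ds ! j \<ge> 0} \<le> card {..<r}" by (intro card_mono) auto
  then show "length (filter (\<lambda>x. x \<ge> 0) ds) \<le> r" by (simp add: length_filter_conv_card)
qed

lemma has_mat_deriv_cong:
  assumes "has_mat_deriv_on_nonneg X X' n m" "\<And>t. t \<ge> 0 \<Longrightarrow> X' t = Y' t"
  shows "has_mat_deriv_on_nonneg X Y' n m"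
  using assms by (simp add: has_mat_deriv_on_nonneg_def)

text \<open>Serves \<open>Q = CU\<^sup>T * S * CU\<close>: its form sees a vector only through the
  output \<open>CU *\<^sub>v v\<close>.\<close>

lemma gram_quadform:
  fixes M S :: "real mat"
  assumes M: "M \<in> carrier_mat p n" and S: "S \<in> carrier_mat p p" and v: "v \<in> carrier_vec n"
  shows "qform (M\<^sup>T * S * M) v = qform S (M *\<^sub>v v)"
proof -
  have Mv: "M *\<^sub>v v \<in> carrier_vec p" using M v by simp
  then have SMv: "S *\<^sub>v (M *\<^sub>v v) \<in> carrier_vec p" using S by simp
  have "(M\<^sup>T * S * M) *\<^sub>v v = M\<^sup>T *\<^sub>v (S *\<^sub>v (M *\<^sub>v v))"
    using M S v by (simp add: assoc_mult_mat_vec[where n\<^sub>1=n and n\<^sub>2=p and n\<^sub>3=n] assoc_mult_mat_vec[where n\<^sub>1=n and n\<^sub>2=p and n\<^sub>3=p])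
  then show ?thesis
    using transpose_vec_mult_scalar[of "M\<^sup>T" n p "S *\<^sub>v (M *\<^sub>v v)" v] M v SMv by simp
qed

lemma gram_symmetric:
  fixes M S :: "real mat"
  assumes "M \<in> carrier_mat p n" "S \<in> carrier_mat p p" "S\<^sup>T = S"
  shows "(M\<^sup>T * S * M)\<^sup>T = M\<^sup>T * S * M"
proof -
  have "(M\<^sup>T * S * M)\<^sup>T = M\<^sup>T * (M\<^sup>T * S)\<^sup>T"
    using assms by (intro transpose_mult[where n = p]) auto
  also have "(M\<^sup>T * S)\<^sup>T = S * M"
    using assms transpose_mult[of "M\<^sup>T" n p S p] by simp
  finally show ?thesis using assms by (simp add: assoc_mult_mat[of "M\<^sup>T" n p S p M n])
qed

section \<open>Closed loop and error covariance of the low-rank filter\<close>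

theorem theorem3:
  fixes n p m r :: nat
    and A G C H :: "real mat"
    and Psi Psi_inv :: "complex mat"
    and U R_bar :: "real mat"
    and R V :: "real \<Rightarrow> real mat"
  assumes A: "A \<in> carrier_mat n n" and G: "G \<in> carrier_mat n n"
    and C: "C \<in> carrier_mat p n" and H: "H \<in> carrier_mat p m"
    and HH: "pos_def p (H * transpose_mat H)"
    and ctrb: "controllable A G" and obsv: "observable A C"
    and r: "1 \<le> r" "r \<le> n - 1"
    and gap: "re_eigs_desc A ! (r - 1) > re_eigs_desc A ! r"
    and Psi: "jordan_basis A Psi Psi_inv"
    and U: "U \<in> equilibria_U r n Psi_inv"
    and R_ode: "has_mat_deriv_on_nonneg R
       (\<lambda>t. (transpose_mat U * A * U) * R t + R t * transpose_mat (transpose_mat U * A * U)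
          + (transpose_mat U * G) * transpose_mat (transpose_mat U * G)
          - R t * transpose_mat (C * U) * the (mat_inverse (H * transpose_mat H)) * (C * U) * R t)
       r r"
    and R0: "pos_def r (R 0)"
    and V_ode: "has_mat_deriv_on_nonneg V
       (\<lambda>t. (A - (U * R t * transpose_mat U) * transpose_mat C
                 * the (mat_inverse (H * transpose_mat H)) * C) * V t
          + V t * transpose_mat (A - (U * R t * transpose_mat U) * transpose_mat C
                 * the (mat_inverse (H * transpose_mat H)) * C)
          + G * transpose_mat G
          + (U * R t * transpose_mat U) * transpose_mat C
                 * the (mat_inverse (H * transpose_mat H)) * C * (U * R t * transpose_mat U))
       n n"
    and V0: "pos_semidef n (V 0)"
    and R_bar: "pos_def r R_bar"
    and R_bar_are: "(transpose_mat U * A * U) * R_bar + R_bar * transpose_mat (transpose_mat U * A * U)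
          + (transpose_mat U * G) * transpose_mat (transpose_mat U * G)
          - R_bar * transpose_mat (C * U) * the (mat_inverse (H * transpose_mat H)) * (C * U) * R_bar
          = 0\<^sub>m r r"
    and R_bar_unique: "\<And>R'. pos_def r R' \<Longrightarrow>
          (transpose_mat U * A * U) * R' + R' * transpose_mat (transpose_mat U * A * U)
          + (transpose_mat U * G) * transpose_mat (transpose_mat U * G)
          - R' * transpose_mat (C * U) * the (mat_inverse (H * transpose_mat H)) * (C * U) * R'
          = 0\<^sub>m r r \<Longrightarrow> R' = R_bar"
  shows "(mat_stable (A - (U * R_bar * transpose_mat U) * transpose_mat C
             * the (mat_inverse (H * transpose_mat H)) * C)
          \<longleftrightarrow> r \<ge> num_unstable A)
       \<and> (mat_stable (A - (U * R_bar * transpose_mat U) * transpose_mat C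
             * the (mat_inverse (H * transpose_mat H)) * C)
          \<longrightarrow> mat_bounded_nonneg V n n
            \<and> (\<exists>V_inf. V_inf \<in> carrier_mat n n \<and> mat_tendsto V V_inf
               \<and> (A - (U * R_bar * transpose_mat U) * transpose_mat C
                    * the (mat_inverse (H * transpose_mat H)) * C) * V_inf
                 + V_inf * transpose_mat (A - (U * R_bar * transpose_mat U) * transpose_mat C
                    * the (mat_inverse (H * transpose_mat H)) * C)
                 + G * transpose_mat G
                 + (U * R_bar * transpose_mat U) * transpose_mat C
                    * the (mat_inverse (H * transpose_mat H)) * C * (U * R_bar * transpose_mat U)
                 = 0\<^sub>m n n))"
proof -
  define S where "S = the (mat_inverse (H * H\<^sup>T))"
  define AU where "AU = U\<^sup>T * A * U"
  define CU where "CU = C * U"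
  define Q where "Q = CU\<^sup>T * S * CU"
  define N where "N = (U\<^sup>T * G) * (U\<^sup>T * G)\<^sup>T"
  have rn: "r \<le> n" using r by simp
  have S: "S \<in> carrier_mat p p" "S\<^sup>T = S"
    and Spos: "\<And>x. x \<in> carrier_vec p \<Longrightarrow> x \<noteq> 0\<^sub>v p \<Longrightarrow> qform S x > 0"
    using pos_def_inverse[OF HH] by (simp_all add: S_def)
  have Snn: "qform S x \<ge> 0" if "x \<in> carrier_vec p" for x
    using Spos[OF that] S that by (cases "x = 0\<^sub>v p") (auto intro: less_imp_le)
  have Uc: "U \<in> carrier_mat n r" and UU: "U\<^sup>T * U = 1\<^sub>m r"
    and Ulow: "\<And>i j. r \<le> i \<Longrightarrow> i < n \<Longrightarrow> j < r \<Longrightarrow> (Psi_inv * cmat U) $$ (i, j) = 0"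
    using U by (auto simp: equilibria_U_def stiefel_def)
  have car: "AU \<in> carrier_mat r r" "CU \<in> carrier_mat p r" "Q \<in> carrier_mat r r" "N \<in> carrier_mat r r"
    using A G C Uc S by (auto simp: AU_def CU_def Q_def N_def)
  have Rb: "R_bar \<in> carrier_mat r r" "R_bar\<^sup>T = R_bar" using R_bar by (auto simp: pos_def_def)
  \<comment> \<open>Brings the left-associated quadratic term of the Riccati equation into the shape
    \<open>X * Q * X\<close> used by the lemmas.\<close>
  have RQR: "X * CU\<^sup>T * S * CU * X = X * Q * X" if "X \<in> carrier_mat r r" for X
  proof -
    have "X * CU\<^sup>T * S * CU = X * (CU\<^sup>T * S) * CU"
      using assoc_mult_mat[of X r r "CU\<^sup>T" p S p] that car S by simp
    also have "\<dots> = X * Q"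
      unfolding Q_def using that car S by (intro assoc_mult_mat[where n\<^sub>2 = r and n\<^sub>3 = p]) auto
    finally show ?thesis by simp
  qed
  have Nq: "qform N v \<ge> 0" if v: "v \<in> carrier_vec r" for v
  proof -
    have UG: "U\<^sup>T * G \<in> carrier_mat r n" using Uc G by simp
    have "N *\<^sub>v v = (U\<^sup>T * G) *\<^sub>v ((U\<^sup>T * G)\<^sup>T *\<^sub>v v)"
      unfolding N_def using UG v by (intro assoc_mult_mat_vec) auto
    then have "qform N v = ((U\<^sup>T * G)\<^sup>T *\<^sub>v v) \<bullet> ((U\<^sup>T * G)\<^sup>T *\<^sub>v v)"
      using transpose_vec_mult_scalar[OF UG _ v] UG v by simp
    then show ?thesis using scalar_prod_self_nonneg by simp
  qed
  have Nsym: "N\<^sup>T = N"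
    unfolding N_def using transpose_mult[of "U\<^sup>T * G" r n "(U\<^sup>T * G)\<^sup>T" r] Uc G by simp
  have Qq: "qform Q v = qform S (CU *\<^sub>v v)" if "v \<in> carrier_vec r" for v
    unfolding Q_def by (rule gram_quadform[OF car(2) S(1) that])
  have Qnn: "qform Q v \<ge> 0" if "v \<in> carrier_vec r" for v
    unfolding Qq[OF that] using car that by (intro Snn) auto
  have Qsym: "Q\<^sup>T = Q" unfolding Q_def by (rule gram_symmetric[OF car(2) S])
  have are: "AU * R_bar + R_bar * AU\<^sup>T + N - R_bar * Q * R_bar = 0\<^sub>m r r"
    using R_bar_are RQR[OF Rb(1)] by (simp add: AU_def N_def S_def CU_def)

  obtain n_as where n_as: "Psi_inv * cmat A * Psi = jordan_matrix n_as"
    and sorted: "sorted_wrt (\<ge>) (map Re (diag_mat (jordan_matrix n_as)))"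
    using Psi by (auto simp: jordan_basis_def Let_def)
  have Pc: "Psi \<in> carrier_mat n n" "Psi_inv \<in> carrier_mat n n"
    and PP: "Psi * Psi_inv = 1\<^sub>m n" "Psi_inv * Psi = 1\<^sub>m n"
    using Psi A by (auto simp: jordan_basis_def Let_def)
  define J where "J = jordan_matrix n_as"
  have Jeq: "Psi_inv * cmat A * Psi = J" using n_as by (simp add: J_def)
  have Jc: "J \<in> carrier_mat n n" using Jeq Pc A by auto
  have Jup: "upper_triangular J"
    unfolding upper_triangular_def J_def by (auto intro: jordan_matrix_upper_triangular)
  have cU: "cmat (U\<^sup>T) * cmat U = 1\<^sub>m r"
    using of_real_hom.mat_hom_mult[of "U\<^sup>T" r n U r, where 'a = complex] UU Uc
    by (simp add: of_real_hom.mat_hom_one)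
  \<comment> \<open>The filter gain in reduced coordinates: the closed loop is
    \<open>A - U * L\<close> and \<open>L * U = R_bar * Q\<close>, so the first factor in
    \<open>equilibrium_block_structure\<close> belongs to the reduced Riccati closed loop.\<close>
  define L where "L = R_bar * U\<^sup>T * C\<^sup>T * S * C"
  have Lc: "L \<in> carrier_mat r n" using Rb Uc C S by (auto simp: L_def)
  note block = equilibrium_block_structure[of "cmat A" n Psi Psi_inv "cmat U" r "cmat (U\<^sup>T)" "cmat L" J,
      OF _ Pc _ _ _ PP rn Jeq Jup cU Ulow]
  have cAU: "cmat (U\<^sup>T) * cmat A * cmat U = cmat AU"
  proof -
    have "U\<^sup>T * A \<in> carrier_mat r n" "U\<^sup>T \<in> carrier_mat r n" using Uc A by auto
    then show ?thesis unfolding AU_def using of_real_hom.mat_hom_mult[of "U\<^sup>T * A" r n U r, where 'a = complex]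
      of_real_hom.mat_hom_mult[of "U\<^sup>T" r n A n, where 'a = complex] Uc A by metis
  qed
  \<comment> \<open>The invariance is obtained over the complex numbers; injectivity of the
    embedding on entries brings it back to real matrices.\<close>
  have AUinv: "A * U = U * AU"
  proof -
    have "cmat (A * U) = cmat A * cmat U" using A Uc by (rule of_real_hom.mat_hom_mult)
    also have "\<dots> = cmat U * cmat AU" using block(1) A Uc Lc cAU by simp
    also have "\<dots> = cmat (U * AU)" using Uc car(1) by (rule of_real_hom.mat_hom_mult[symmetric])
    finally have eq: "cmat (A * U) = cmat (U * AU)" .
    show ?thesis
    proof (rule eq_matI)
      fix i j assume ij: "i < dim_row (U * AU)" "j < dim_col (U * AU)"
      have "cmat (A * U) $$ (i, j) = cmat (U * AU) $$ (i, j)" using eq by simp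
      then show "(A * U) $$ (i, j) = (U * AU) $$ (i, j)" using ij A Uc car by (simp del: index_mult_mat(1))
    qed (use A Uc car in auto)
  qed
  \<comment> \<open>Observability descends to the reduced pair: \<open>U\<close> is injective and,
    by \<open>AUinv\<close>, maps eigenvectors of \<open>AU\<close> to eigenvectors of
    \<open>A\<close>.\<close>
  have Fst: "mat_stable (AU - R_bar * Q)"
  proof (rule riccati_closed_loop_stable[OF car(1,4,3) Nsym Nq Qsym Qnn R_bar are])
    fix a b :: "real vec" and \<alpha> \<beta> :: real
    assume a: "a \<in> carrier_vec r" and b: "b \<in> carrier_vec r"
      and eig: "AU *\<^sub>v a = \<alpha> \<cdot>\<^sub>v a - \<beta> \<cdot>\<^sub>v b" "AU *\<^sub>v b = \<beta> \<cdot>\<^sub>v a + \<alpha> \<cdot>\<^sub>v b"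
      and Q0: "Q *\<^sub>v a = 0\<^sub>v r" "Q *\<^sub>v b = 0\<^sub>v r"
    \<comment> \<open>As \<open>S\<close> is positive definite, the kernel of \<open>Q\<close> is
      that of \<open>C * U\<close>.\<close>
    have C0: "C *\<^sub>v (U *\<^sub>v x) = 0\<^sub>v p" if x: "x \<in> carrier_vec r" and "Q *\<^sub>v x = 0\<^sub>v r" for x
    proof -
      have "qform S (CU *\<^sub>v x) = 0" using Qq[OF x] that by simp
      then have "CU *\<^sub>v x = 0\<^sub>v p" using Spos[of "CU *\<^sub>v x"] car x by fastforce
      then show ?thesis using assoc_mult_mat_vec[OF C Uc x] by (simp add: CU_def)
    qed
    have AUx: "A *\<^sub>v (U *\<^sub>v x) = U *\<^sub>v (AU *\<^sub>v x)" if x: "x \<in> carrier_vec r" for x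
      using assoc_mult_mat_vec[OF A Uc x] assoc_mult_mat_vec[OF Uc car(1) x] AUinv by simp
    have "U *\<^sub>v a = 0\<^sub>v n \<and> U *\<^sub>v b = 0\<^sub>v n"
    proof (rule observable_no_hidden_eigenvector[OF A C obsv])
      show "A *\<^sub>v (U *\<^sub>v a) = \<alpha> \<cdot>\<^sub>v (U *\<^sub>v a) - \<beta> \<cdot>\<^sub>v (U *\<^sub>v b)"
        unfolding AUx[OF a] eig using a b by (simp add: mult_minus_distrib_mat_vec[OF Uc] mult_mat_vec[OF Uc])
      show "A *\<^sub>v (U *\<^sub>v b) = \<beta> \<cdot>\<^sub>v (U *\<^sub>v a) + \<alpha> \<cdot>\<^sub>v (U *\<^sub>v b)"
        unfolding AUx[OF b] eig using a b by (simp add: mult_add_distrib_mat_vec[OF Uc] mult_mat_vec[OF Uc])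
    qed (use a b Uc C0 Q0 in auto)
    moreover have "x = 0\<^sub>v r" if x: "x \<in> carrier_vec r" "U *\<^sub>v x = 0\<^sub>v n" for x
    proof -
      have "x = U\<^sup>T *\<^sub>v (U *\<^sub>v x)"
        using assoc_mult_mat_vec[of "U\<^sup>T" r n U r x] Uc x UU by simp
      also have "\<dots> = 0\<^sub>v r" unfolding x(2) using Uc by (intro eq_vecI) auto
      finally show ?thesis .
    qed
    ultimately show "a = 0\<^sub>v r \<and> b = 0\<^sub>v r" using a b by blast
  qed
  define F0 where "F0 = A - (U * R_bar * U\<^sup>T) * C\<^sup>T * S * C"
  have F0L: "F0 = A - U * L"
  proof -
    have "U * R_bar * U\<^sup>T * C\<^sup>T * S * C = U * (R_bar * U\<^sup>T) * C\<^sup>T * S * C"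
      using assoc_mult_mat[OF Uc Rb(1), of "U\<^sup>T" n] Uc by simp
    also have "\<dots> = U * (R_bar * U\<^sup>T * C\<^sup>T) * S * C"
      using assoc_mult_mat[of U n r "R_bar * U\<^sup>T" n "C\<^sup>T" p] Uc Rb C by simp
    also have "\<dots> = U * (R_bar * U\<^sup>T * C\<^sup>T * S) * C"
      using assoc_mult_mat[of U n r "R_bar * U\<^sup>T * C\<^sup>T" p S p] Uc Rb C S by simp
    also have "\<dots> = U * L"
      unfolding L_def using Uc Rb C S by (intro assoc_mult_mat[where n\<^sub>2 = r and n\<^sub>3 = p]) auto
    finally show ?thesis by (simp add: F0_def)
  qed
  have LU: "L * U = R_bar * Q"
  proof -
    have "CU\<^sup>T = U\<^sup>T * C\<^sup>T" unfolding CU_def using C Uc by (rule transpose_mult)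
    then have "R_bar * Q = R_bar * (U\<^sup>T * C\<^sup>T * S * (C * U))" by (simp add: Q_def CU_def)
    also have "\<dots> = R_bar * (U\<^sup>T * C\<^sup>T * S) * (C * U)"
      using Rb Uc C S by (intro assoc_mult_mat[symmetric, where n\<^sub>2 = r and n\<^sub>3 = p]) auto
    also have "R_bar * (U\<^sup>T * C\<^sup>T * S) = R_bar * (U\<^sup>T * C\<^sup>T) * S"
      using Rb Uc C S by (intro assoc_mult_mat[symmetric, where n\<^sub>2 = r and n\<^sub>3 = p]) auto
    also have "R_bar * (U\<^sup>T * C\<^sup>T) = R_bar * U\<^sup>T * C\<^sup>T"
      using Rb Uc C by (intro assoc_mult_mat[symmetric, where n\<^sub>2 = r and n\<^sub>3 = n]) auto
    also have "R_bar * U\<^sup>T * C\<^sup>T * S * (C * U) = L * U"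
      unfolding L_def using Rb Uc C S by (intro assoc_mult_mat[symmetric, where n\<^sub>2 = p and n\<^sub>3 = n]) auto
    finally show ?thesis by simp
  qed
  have ULc: "U * L \<in> carrier_mat n n" using Uc Lc by simp
  have F0c: "F0 \<in> carrier_mat n n" unfolding F0L using ULc by (simp add: minus_carrier_mat)
  have char: "char_poly (cmat F0) = char_poly (cmat (AU - R_bar * Q)) * (\<Prod>i\<leftarrow>[r..<n]. [:- J $$ (i, i), 1:])"
  proof -
    have minus: "cmat (M - M') = cmat M - cmat M'" if "M \<in> carrier_mat k k" "M' \<in> carrier_mat k k" for M M' k
      using that by (intro eq_matI) auto
    have "cmat F0 = cmat A - cmat U * cmat L"
      unfolding F0L minus[OF A ULc] of_real_hom.mat_hom_mult[OF Uc Lc] ..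
    moreover have "cmat (AU - R_bar * Q) = cmat AU - cmat L * cmat U"
      unfolding LU[symmetric] minus[OF car(1) mult_carrier_mat[OF Lc Uc]] of_real_hom.mat_hom_mult[OF Lc Uc] ..
    ultimately show ?thesis using block(2) A Uc Lc cAU by simp
  qed
  \<comment> \<open>The spectrum consists of that of the stable reduced loop and of the diagonal of
    \<open>J\<close> from the 0-based index \<open>r\<close> on, that is, of the eigenvalues of
    \<open>A\<close> after the \<open>r\<close>-th.\<close>
  have stable_iff: "mat_stable F0 \<longleftrightarrow> (\<forall>i. r \<le> i \<longrightarrow> i < n \<longrightarrow> Re (J $$ (i, i)) < 0)"
  proof -
    have FQ: "cmat (AU - R_bar * Q) \<in> carrier_mat r r" using car Rb by (auto intro!: minus_carrier_mat)
    have "eigenvalue (cmat F0) z \<longleftrightarrow> eigenvalue (cmat (AU - R_bar * Q)) z \<or> (\<exists>i\<in>{r..<n}. z = J $$ (i, i))" for z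
    proof -
      have "poly (\<Prod>i\<leftarrow>is. [:- J $$ (i, i), 1:]) z = 0 \<longleftrightarrow> (\<exists>i\<in>set is. z = J $$ (i, i))" for "is"
        by (induction "is") auto
      from this[of "[r..<n]"] show ?thesis
        using eigenvalue_root_char_poly[of "cmat F0" n z] eigenvalue_root_char_poly[OF FQ, of z] F0c
        by (simp add: char)
    qed
    then show ?thesis using Fst unfolding mat_stable_def by (metis atLeastLessThan_iff)
  qed
  \<comment> \<open>The diagonal of \<open>J\<close> lists the eigenvalues by nonincreasing real
    part, so the unstable ones come first.\<close>
  have unstable_iff: "r \<ge> num_unstable A \<longleftrightarrow> (\<forall>i. r \<le> i \<longrightarrow> i < n \<longrightarrow> Re (J $$ (i, i)) < 0)"
  proof -
    have Acar: "cmat A \<in> carrier_mat n n" using A by simp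
    have "cmat A = Psi * J * Psi_inv"
    proof -
      have "Psi * J * Psi_inv = Psi * (J * Psi_inv)" by (rule assoc_mult_mat[OF Pc(1) Jc Pc(2)])
      also have "J * Psi_inv = Psi_inv * cmat A"
        unfolding Jeq[symmetric] assoc_mult_mat[OF mult_carrier_mat[OF Pc(2) Acar] Pc]
          PP(1) right_mult_one_mat[OF mult_carrier_mat[OF Pc(2) Acar]] ..
      also have "Psi * (Psi_inv * cmat A) = Psi * Psi_inv * cmat A" by (rule assoc_mult_mat[OF Pc Acar, symmetric])
      finally show ?thesis unfolding PP(1) left_mult_one_mat[OF Acar] by simp
    qed
    then have "similar_mat (cmat A) J"
      unfolding similar_mat_def similar_mat_wit_def Let_def using Acar Pc Jc PP
      by (intro exI[of _ Psi] exI[of _ Psi_inv]) auto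
    from eig_mset_triangular[OF this Jc Jup]
    have "num_unstable A = length (filter (\<lambda>x. x \<ge> 0) (map Re (diag_mat J)))"
      by (simp add: num_unstable_def filter_map o_def flip: mset_filter)
    then have "r \<ge> num_unstable A \<longleftrightarrow> (\<forall>i. r \<le> i \<longrightarrow> i < length (map Re (diag_mat J)) \<longrightarrow> map Re (diag_mat J) ! i < 0)"
      using filter_sorted_length_le_iff[OF sorted[folded J_def], of r] by simp
    then show ?thesis using Jc by (simp add: diag_mat_def)
  qed
  have part1: "mat_stable F0 \<longleftrightarrow> r \<ge> num_unstable A" using stable_iff unstable_iff by simp
  \<comment> \<open>Collects both constant terms of the limiting equation into the single source
    that \<open>lyapunov_ode_converges\<close> expects.\<close>
  define N0 where "N0 = G * G\<^sup>T
      + (U * R_bar * U\<^sup>T) * C\<^sup>T * S * C * (U * R_bar * U\<^sup>T)"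
  have part2: "mat_bounded_nonneg V n n \<and> (\<exists>V_inf. V_inf \<in> carrier_mat n n \<and> mat_tendsto V V_inf \<and>
      F0 * V_inf + V_inf * F0\<^sup>T + N0 = 0\<^sub>m n n)" if st: "mat_stable F0"
  proof -
    have Rc: "R t \<in> carrier_mat r r" if "t \<ge> 0" for t using R_ode that by (simp add: has_mat_deriv_on_nonneg_def)
    have Rode: "has_mat_deriv_on_nonneg R (\<lambda>t. AU * R t + R t * AU\<^sup>T + N - R t * Q * R t) r r"
      by (rule has_mat_deriv_cong[OF R_ode]) (simp add: RQR[OF Rc, symmetric] AU_def N_def S_def CU_def)
    obtain \<beta> where \<beta>: "\<beta> > 0" and R: "mat_exp_conv \<beta> r r R R_bar"
      by (rule riccati_exp_conv[OF car(1,4,3) Nsym Nq Qsym Qnn R_bar are Fst Rode R0])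
    \<comment> \<open>Gives the symmetry of \<open>P t\<close> and thereby of the source
      \<open>W t\<close>.\<close>
    have Rsym: "(R t)\<^sup>T = R t" if "t \<ge> 0" for t
      using riccati_symmetric[OF car(1,4,3) Nsym Qsym Rode _ that] R0 by (simp add: pos_def_def)
    define P where "P = (\<lambda>t. U * R t * U\<^sup>T)"
    define P0 where "P0 = U * R_bar * U\<^sup>T"
    have UT: "U\<^sup>T \<in> carrier_mat r n" "C\<^sup>T \<in> carrier_mat n p" using Uc C by auto
    have Pconv: "mat_exp_conv \<beta> n n P P0"
      unfolding P_def P0_def
      by (intro mat_exp_conv_mult[OF mat_exp_conv_mult[OF mat_exp_conv_const[OF Uc] R] mat_exp_conv_const[OF UT(1)]] less_imp_le[OF \<beta>])
    have PCSC: "mat_exp_conv \<beta> n n (\<lambda>t. P t * C\<^sup>T * S * C) (P0 * C\<^sup>T * S * C)"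
      by (intro mat_exp_conv_mult[OF mat_exp_conv_mult[OF mat_exp_conv_mult[OF Pconv mat_exp_conv_const[OF UT(2)]]
          mat_exp_conv_const[OF S(1)]] mat_exp_conv_const[OF C]] less_imp_le[OF \<beta>])
    define F where "F = (\<lambda>t. A - P t * C\<^sup>T * S * C)"
    define W where "W = (\<lambda>t. G * G\<^sup>T + P t * C\<^sup>T * S * C * P t)"
    have F: "mat_exp_conv \<beta> n n F F0"
      unfolding F_def F0_def P0_def[symmetric] by (rule mat_exp_conv_diff[OF mat_exp_conv_const[OF A] PCSC])
    have GG: "G * G\<^sup>T \<in> carrier_mat n n" using G by simp
    have W: "mat_exp_conv \<beta> n n W N0"
      unfolding W_def N0_def P0_def[symmetric]
      by (rule mat_exp_conv_add[OF mat_exp_conv_const[OF GG] mat_exp_conv_mult[OF PCSC Pconv less_imp_le[OF \<beta>]]])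
    have Pc: "P t \<in> carrier_mat n n" if "t \<ge> 0" for t using Pconv that by (simp add: mat_exp_conv_def)
    have Fc: "F t \<in> carrier_mat n n" "F0 \<in> carrier_mat n n" if "t \<ge> 0" for t using F that by (simp_all add: mat_exp_conv_def)
    have Vc: "V t \<in> carrier_mat n n" if "t \<ge> 0" for t using V_ode that by (simp add: has_mat_deriv_on_nonneg_def)
    have PCSCP: "P t * C\<^sup>T * S * C * P t \<in> carrier_mat n n" if "t \<ge> 0" for t
      using Pc[OF that] C S by auto
    have Wsym: "(W t)\<^sup>T = W t" if t: "t \<ge> 0" for t
    proof -
      have Psym: "(P t)\<^sup>T = P t"
      proof -
        have "(P t)\<^sup>T = U * (U * R t)\<^sup>T"
          unfolding P_def using transpose_mult[of "U * R t" n r "U\<^sup>T" n] Uc Rc[OF t] by simp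
        also have "(U * R t)\<^sup>T = R t * U\<^sup>T"
          using transpose_mult[OF Uc Rc[OF t]] Rsym[OF t] by simp
        finally show ?thesis unfolding P_def using assoc_mult_mat[OF Uc Rc[OF t] UT(1)] by simp
      qed
      have CP: "C * P t \<in> carrier_mat p n" using C Pc[OF t] by simp
      \<comment> \<open>Written as a Gram expression in \<open>C * P t\<close>, the term is visibly
        symmetric.\<close>
      have "P t * C\<^sup>T * S * C * P t = (C * P t)\<^sup>T * S * (C * P t)"
        using transpose_mult[OF C Pc[OF t]] Psym assoc_mult_mat[of "P t * C\<^sup>T * S" n p C n "P t" n] Pc[OF t] C S
        by simp
      then have "(P t * C\<^sup>T * S * C * P t)\<^sup>T = P t * C\<^sup>T * S * C * P t"
        using gram_symmetric[OF CP S] by simp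
      moreover have "(G * G\<^sup>T)\<^sup>T = G * G\<^sup>T"
        using transpose_mult[of G n n "G\<^sup>T" n] G by simp
      ultimately show ?thesis unfolding W_def using transpose_add[OF GG PCSCP[OF t]] by simp
    qed
    have "has_mat_deriv_on_nonneg V (\<lambda>t. F t * V t + V t * (F t)\<^sup>T + W t) n n"
    proof (rule has_mat_deriv_cong[OF V_ode])
      fix t :: real assume t: "t \<ge> 0"
      have "F t * V t + V t * (F t)\<^sup>T + G * G\<^sup>T + P t * C\<^sup>T * S * C * P t
          = F t * V t + V t * (F t)\<^sup>T + W t"
        unfolding W_def using Fc[OF t] Vc[OF t] GG PCSCP[OF t] by (intro assoc_add_mat) auto
      then show "(A - (U * R t * U\<^sup>T) * C\<^sup>T * the (mat_inverse (H * H\<^sup>T)) * C) * V t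
          + V t * (A - (U * R t * U\<^sup>T) * C\<^sup>T * the (mat_inverse (H * H\<^sup>T)) * C)\<^sup>T
          + G * G\<^sup>T
          + (U * R t * U\<^sup>T) * C\<^sup>T * the (mat_inverse (H * H\<^sup>T)) * C * (U * R t * U\<^sup>T)
          = F t * V t + V t * (F t)\<^sup>T + W t"
        unfolding F_def P_def S_def .
    qed
    from lyapunov_ode_converges[OF F W \<beta> st Wsym this] V0 show ?thesis by (simp add: pos_semidef_def)
  qed
  have assoc: "F0 * X + X * F0\<^sup>T + G * G\<^sup>T
      + (U * R_bar * U\<^sup>T) * C\<^sup>T * S * C * (U * R_bar * U\<^sup>T)
      = F0 * X + X * F0\<^sup>T + N0" if "X \<in> carrier_mat n n" for X
    unfolding N0_def using that F0c G Uc Rb C S by (intro assoc_add_mat) auto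
  show ?thesis
    unfolding S_def[symmetric] F0_def[symmetric]
  proof (intro conjI impI part1)
    assume st: "mat_stable F0"
    show "mat_bounded_nonneg V n n" using part2[OF st] ..
    from part2[OF st] obtain V_inf where V_inf: "V_inf \<in> carrier_mat n n" "mat_tendsto V V_inf"
      "F0 * V_inf + V_inf * F0\<^sup>T + N0 = 0\<^sub>m n n" by blast
    show "\<exists>V_inf. V_inf \<in> carrier_mat n n \<and> mat_tendsto V V_inf \<and>
        F0 * V_inf + V_inf * F0\<^sup>T + G * G\<^sup>T
        + (U * R_bar * U\<^sup>T) * C\<^sup>T * S * C * (U * R_bar * U\<^sup>T) = 0\<^sub>m n n"
      using V_inf unfolding assoc[OF V_inf(1), symmetric] by blast
  qed
qed

end
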